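(* Let $k$ be an algebraically closed field of characteristic zero, $\mathfrak{g}$ a finite-dimensional simple Lie algebra over $k$ with a fixed Cartan subalgebra $\mathfrak{h}$, $S$ a commutative, associative, unital $k$-algebra of finite type, and $\mathcal{L}=\mathfrak{g}\otimes_k S$. Let $\phi:\mathcal{L}\rightarrow\operatorname{End}V$ be an irreducible admissible representation. Then $V$ is isomorphic to an evaluation module.
   Context: The Lie bracket on $\mathcal{L}=\mathfrak{g}\otimes S$ is $[x\otimes r,y\otimes s]=[x,y]\otimes rs$. An $\mathcal{L}$-module $V$ is a weight module if $V=\bigoplus_{\lambda\in\mathfrak{h}^*}V_\lambda$ with each weight space $V_\lambda=\{v\in V\mid (h\otimes 1)v=\lambda(h)v\text{ for all }h\in\mathfrak{h}\}$ finite dimensional. A weight module is admissible if there is $B\in\mathbb{Z}_{>0}$ with $\dim V_\lambda\le B$ for all $\lambda$. For $s\in S$ and a maximal ideal $M$ of $S$, $s(M)\in k$ is the residue of $s$ in $S/M\cong k$. Given distinct maximal ideals $M_1,\ldots,M_r$ of $S$ and simple $\mathfrak{g}$-modules $W_1,\ldots,W_r$, the evaluation module $V(\underline{M},\underline{W})$ is the vector space $W_1\otimes\cdots\otimes W_r$ with $\mathcal{L}$-action $(x\otimes s).(w_1\otimes\cdots\otimes w_r)=\sum_{i=1}^r s(M_i)\,w_1\otimes\cdots\otimes xw_i\otimes\cdots\otimes w_r$. *)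

theory Defs
  imports
    "HOL-Computational_Algebra.Polynomial"
    "HOL-Library.Poly_Mapping"
    "HOL-Library.Set_Algebras"
    "HOL-Library.FuncSet"
begin

section \<open>Commutative algebras\<close>

text \<open>
  Vector spaces over \<^typ>\<open>'k\<close> are types of class \<^class>\<open>ab_group_add\<close> with a scalar multiplication
  satisfying \<^locale>\<open>vector_space\<close>.  The sort of \<^typ>\<open>'s\<close> below is that of commutative unital rings
  in which \<open>1 = 0\<close> is not excluded (unlike \<^class>\<open>comm_ring_1\<close>), so the zero algebra is covered.
\<close>

locale comm_algebra = vector_space scale
  for scale :: "'k::field \<Rightarrow> 's::{comm_ring, comm_monoid_mult} \<Rightarrow> 's" +
  assumes scale_mult: "scale c (a * b) = scale c a * b"

definition subalgebra ::
  "('k::field \<Rightarrow> 's::{comm_ring, comm_monoid_mult} \<Rightarrow> 's) \<Rightarrow> 's set \<Rightarrow> bool"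
  where "subalgebra scale T \<longleftrightarrow>
    module.subspace scale T \<and> 1 \<in> T \<and> (\<forall>a\<in>T. \<forall>b\<in>T. a * b \<in> T)"

definition finite_type :: "('k::field \<Rightarrow> 's::{comm_ring, comm_monoid_mult} \<Rightarrow> 's) \<Rightarrow> bool"
  where "finite_type scale \<longleftrightarrow> (\<exists>X. finite X \<and> subalgebra scale hull X = UNIV)"

definition ring_ideal :: "'s::{comm_ring, comm_monoid_mult} set \<Rightarrow> bool"
  where "ring_ideal I \<longleftrightarrow> 0 \<in> I \<and> (\<forall>a\<in>I. \<forall>b\<in>I. a + b \<in> I) \<and> (\<forall>s. \<forall>a\<in>I. s * a \<in> I)"

definition maximal_ideal :: "'s::{comm_ring, comm_monoid_mult} set \<Rightarrow> bool"
  where "maximal_ideal M \<longleftrightarrow> ring_ideal M \<and> M \<noteq> UNIV \<and>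
    (\<forall>J. ring_ideal J \<and> M \<subseteq> J \<longrightarrow> J = M \<or> J = UNIV)"

text \<open>
  The value \<open>s(M)\<close>: the scalar whose image under \<open>k \<rightarrow> S/M\<close> is the class of \<open>s\<close>.  It is unique since
  \<open>M\<close> is proper, and exists when \<open>S/M = k\<close> (Nullstellensatz).
\<close>

definition residue ::
  "('k::field \<Rightarrow> 's::{comm_ring, comm_monoid_mult} \<Rightarrow> 's) \<Rightarrow> 's set \<Rightarrow> 's \<Rightarrow> 'k"
  where "residue scale M s = (THE c. s - scale c 1 \<in> M)"

lemma (in comm_algebra) residue_eqI:
  assumes "maximal_ideal M" and "s - scale c 1 \<in> M"
  shows "residue scale M s = c"
  unfolding residue_def
proof (rule the_equality)
  show "s - scale c 1 \<in> M" by fact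
next
  fix d assume d: "s - scale d 1 \<in> M"
  have M: "ring_ideal M" "M \<noteq> UNIV" using assms(1) by (auto simp: maximal_ideal_def)
  have "(-1) * (s - scale d 1) \<in> M" using M d unfolding ring_ideal_def by blast
  then have "(s - scale c 1) + (-1) * (s - scale d 1) \<in> M"
    using M assms(2) unfolding ring_ideal_def by blast
  then have *: "scale (d - c) 1 \<in> M" by (simp add: scale_left_diff_distrib algebra_simps)
  show "d = c"
  proof (rule ccontr)
    assume "d \<noteq> c"
    have "t \<in> M" for t
    proof -
      have "(scale (inverse (d - c)) t) * scale (d - c) 1 \<in> M"
        using M * unfolding ring_ideal_def by blast
      moreover have "(scale (inverse (d - c)) t) * scale (d - c) 1 = t"
        using \<open>d \<noteq> c\<close> by (metis scale_mult mult.commute mult_1 scale_scale right_minus_eq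
            right_inverse scale_one)
      ultimately show "t \<in> M" by simp
    qed
    with M show False by blast
  qed
qed


section \<open>Lie algebras\<close>

locale lie_algebra = vector_space scale
  for scale :: "'k::field \<Rightarrow> 'g::ab_group_add \<Rightarrow> 'g" +
  fixes bracket :: "'g \<Rightarrow> 'g \<Rightarrow> 'g"
  assumes linear_bracket_right: "Vector_Spaces.linear scale scale (\<lambda>y. bracket x y)"
    and linear_bracket_left: "Vector_Spaces.linear scale scale (\<lambda>x. bracket x y)"
    and bracket_self: "bracket x x = 0"
    and jacobi: "bracket x (bracket y z) + bracket y (bracket z x) + bracket z (bracket x y) = 0"

definition lie_ideal ::
  "('k::field \<Rightarrow> 'g::ab_group_add \<Rightarrow> 'g) \<Rightarrow> ('g \<Rightarrow> 'g \<Rightarrow> 'g) \<Rightarrow> 'g set \<Rightarrow> bool"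
  where "lie_ideal scale bracket I \<longleftrightarrow>
    module.subspace scale I \<and> (\<forall>x. \<forall>y\<in>I. bracket x y \<in> I)"

definition simple_lie_algebra ::
  "('k::field \<Rightarrow> 'g::ab_group_add \<Rightarrow> 'g) \<Rightarrow> ('g \<Rightarrow> 'g \<Rightarrow> 'g) \<Rightarrow> bool"
  where "simple_lie_algebra scale bracket \<longleftrightarrow> lie_algebra scale bracket \<and>
    (\<exists>x y. bracket x y \<noteq> 0) \<and>
    (\<forall>I. lie_ideal scale bracket I \<longrightarrow> I = {0} \<or> I = UNIV)"

definition lie_subalgebra ::
  "('k::field \<Rightarrow> 'g::ab_group_add \<Rightarrow> 'g) \<Rightarrow> ('g \<Rightarrow> 'g \<Rightarrow> 'g) \<Rightarrow> 'g set \<Rightarrow> bool"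
  where "lie_subalgebra scale bracket H \<longleftrightarrow>
    module.subspace scale H \<and> (\<forall>x\<in>H. \<forall>y\<in>H. bracket x y \<in> H)"

primrec lower_central ::
  "('k::field \<Rightarrow> 'g::ab_group_add \<Rightarrow> 'g) \<Rightarrow> ('g \<Rightarrow> 'g \<Rightarrow> 'g) \<Rightarrow> 'g set \<Rightarrow> nat \<Rightarrow> 'g set"
  where
    "lower_central scale bracket H 0 = H"
  | "lower_central scale bracket H (Suc n) =
      module.span scale {bracket x y |x y. x \<in> H \<and> y \<in> lower_central scale bracket H n}"

definition cartan_subalgebra ::
  "('k::field \<Rightarrow> 'g::ab_group_add \<Rightarrow> 'g) \<Rightarrow> ('g \<Rightarrow> 'g \<Rightarrow> 'g) \<Rightarrow> 'g set \<Rightarrow> bool"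
  where "cartan_subalgebra scale bracket H \<longleftrightarrow> lie_subalgebra scale bracket H \<and>
    (\<exists>n. lower_central scale bracket H n = {0}) \<and>
    {x. \<forall>y\<in>H. bracket x y \<in> H} = H"


section \<open>Representations\<close>

text \<open>
  \<open>lie_rep scl br A scV W \<rho>\<close>: \<open>\<rho>\<close> is a representation of the Lie algebra with carrier \<open>A\<close>, addition
  \<open>+\<close>, scalar multiplication \<open>scl\<close> and bracket \<open>br\<close> on the subspace \<open>W\<close>.  Two carriers occur: \<open>UNIV\<close>
  for the finite-dimensional Lie algebra, and a set of cosets (where \<open>+\<close> is the sum of cosets) for
  its tensor product with the commutative algebra.
\<close>

definition lie_rep ::
  "('k::field \<Rightarrow> 'a::plus \<Rightarrow> 'a) \<Rightarrow> ('a \<Rightarrow> 'a \<Rightarrow> 'a) \<Rightarrow> 'a set \<Rightarrow>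
   ('k \<Rightarrow> 'v::ab_group_add \<Rightarrow> 'v) \<Rightarrow> 'v set \<Rightarrow> ('a \<Rightarrow> 'v \<Rightarrow> 'v) \<Rightarrow> bool"
  where "lie_rep scl br A scV W \<rho> \<longleftrightarrow>
    module.subspace scV W \<and>
    (\<forall>x\<in>A. \<forall>v\<in>W. \<rho> x v \<in> W) \<and>
    (\<forall>x\<in>A. \<forall>v\<in>W. \<forall>w\<in>W. \<rho> x (v + w) = \<rho> x v + \<rho> x w) \<and>
    (\<forall>x\<in>A. \<forall>c. \<forall>v\<in>W. \<rho> x (scV c v) = scV c (\<rho> x v)) \<and>
    (\<forall>x\<in>A. \<forall>y\<in>A. \<forall>v\<in>W. \<rho> (x + y) v = \<rho> x v + \<rho> y v) \<and>
    (\<forall>c. \<forall>x\<in>A. \<forall>v\<in>W. \<rho> (scl c x) v = scV c (\<rho> x v)) \<and>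
    (\<forall>x\<in>A. \<forall>y\<in>A. \<forall>v\<in>W. \<rho> (br x y) v = \<rho> x (\<rho> y v) - \<rho> y (\<rho> x v))"

definition irreducible_rep ::
  "('k::field \<Rightarrow> 'a::plus \<Rightarrow> 'a) \<Rightarrow> ('a \<Rightarrow> 'a \<Rightarrow> 'a) \<Rightarrow> 'a set \<Rightarrow>
   ('k \<Rightarrow> 'v::ab_group_add \<Rightarrow> 'v) \<Rightarrow> 'v set \<Rightarrow> ('a \<Rightarrow> 'v \<Rightarrow> 'v) \<Rightarrow> bool"
  where "irreducible_rep scl br A scV W \<rho> \<longleftrightarrow>
    lie_rep scl br A scV W \<rho> \<and> W \<noteq> {0} \<and>
    (\<forall>U. module.subspace scV U \<and> U \<subseteq> W \<and> (\<forall>x\<in>A. \<forall>u\<in>U. \<rho> x u \<in> U) \<longrightarrow> U = {0} \<or> U = W)"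

definition module_iso ::
  "'a set \<Rightarrow> ('k \<Rightarrow> 'u::plus \<Rightarrow> 'u) \<Rightarrow> 'u set \<Rightarrow> ('a \<Rightarrow> 'u \<Rightarrow> 'u) \<Rightarrow>
   ('k \<Rightarrow> 'v::plus \<Rightarrow> 'v) \<Rightarrow> 'v set \<Rightarrow> ('a \<Rightarrow> 'v \<Rightarrow> 'v) \<Rightarrow> ('u \<Rightarrow> 'v) \<Rightarrow> bool"
  where "module_iso A scU U \<rho> scV V \<sigma> f \<longleftrightarrow>
    bij_betw f U V \<and>
    (\<forall>u\<in>U. \<forall>v\<in>U. f (u + v) = f u + f v) \<and>
    (\<forall>c. \<forall>u\<in>U. f (scU c u) = scV c (f u)) \<and>
    (\<forall>x\<in>A. \<forall>u\<in>U. f (\<rho> x u) = \<sigma> x (f u))"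


section \<open>Free vector spaces and their quotients\<close>

text \<open>
  \<^typ>\<open>'x \<Rightarrow>\<^sub>0 'k\<close> is the free vector space on \<^typ>\<open>'x\<close>.  The quotient by a subspace \<open>R\<close> consists of the
  cosets \<open>p +o R\<close>; the sum of two cosets is their elementwise sum \<open>A + B\<close>.
\<close>

definition fscale :: "'k::field \<Rightarrow> ('x \<Rightarrow>\<^sub>0 'k) \<Rightarrow> ('x \<Rightarrow>\<^sub>0 'k)"
  where "fscale c p = Poly_Mapping.map ((*) c) p"

definition fgen :: "'x \<Rightarrow> ('x \<Rightarrow>\<^sub>0 'k::field)"
  where "fgen x = Poly_Mapping.single x 1"

definition free_on :: "'x set \<Rightarrow> ('x \<Rightarrow>\<^sub>0 'k::field) set"
  where "free_on X = {p. Poly_Mapping.keys p \<subseteq> X}"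

definition qscale :: "('x \<Rightarrow>\<^sub>0 'k::field) set \<Rightarrow> 'k \<Rightarrow> ('x \<Rightarrow>\<^sub>0 'k) set \<Rightarrow> ('x \<Rightarrow>\<^sub>0 'k) set"
  where "qscale R c A = fscale c ` A + R"

definition bilinear_ext ::
  "('x \<Rightarrow> 'y \<Rightarrow> ('z \<Rightarrow>\<^sub>0 'k::field)) \<Rightarrow> ('x \<Rightarrow>\<^sub>0 'k) \<Rightarrow> ('y \<Rightarrow>\<^sub>0 'k) \<Rightarrow> ('z \<Rightarrow>\<^sub>0 'k)"
  where "bilinear_ext f p q = (\<Sum>x\<in>Poly_Mapping.keys p. \<Sum>y\<in>Poly_Mapping.keys q.
    fscale (Poly_Mapping.lookup p x * Poly_Mapping.lookup q y) (f x y))"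

text \<open>
  The map induced on cosets by \<open>bilinear_ext f\<close>; it is independent of representatives as soon as
  \<open>bilinear_ext f\<close> sends the relations in either argument into \<open>R\<close>.
\<close>

definition qbilinear ::
  "('z \<Rightarrow>\<^sub>0 'k::field) set \<Rightarrow> ('x \<Rightarrow> 'y \<Rightarrow> ('z \<Rightarrow>\<^sub>0 'k)) \<Rightarrow>
   ('x \<Rightarrow>\<^sub>0 'k) set \<Rightarrow> ('y \<Rightarrow>\<^sub>0 'k) set \<Rightarrow> ('z \<Rightarrow>\<^sub>0 'k) set"
  where "qbilinear R f A B = {bilinear_ext f p q |p q. p \<in> A \<and> q \<in> B} + R"

lemma lookup_fscale: "Poly_Mapping.lookup (fscale c p) x = c * Poly_Mapping.lookup p x"
  by (simp add: fscale_def map.rep_eq when_def)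

interpretation free: vector_space "fscale :: 'k::field \<Rightarrow> ('x \<Rightarrow>\<^sub>0 'k) \<Rightarrow> _"
  by unfold_locales
    (auto intro!: poly_mapping_eqI simp: lookup_fscale lookup_add algebra_simps)

lemma bilinear_ext_superset:
  assumes "finite P" "Poly_Mapping.keys p \<subseteq> P" "finite Q" "Poly_Mapping.keys q \<subseteq> Q"
  shows "bilinear_ext f p q = (\<Sum>x\<in>P. \<Sum>y\<in>Q.
    fscale (Poly_Mapping.lookup p x * Poly_Mapping.lookup q y) (f x y))"
proof -
  have "bilinear_ext f p q = (\<Sum>x\<in>Poly_Mapping.keys p. \<Sum>y\<in>Q.
    fscale (Poly_Mapping.lookup p x * Poly_Mapping.lookup q y) (f x y))"
    unfolding bilinear_ext_def
    by (intro sum.cong sum.mono_neutral_left refl) (use assms in \<open>auto simp: in_keys_iff\<close>)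
  also have "\<dots> = (\<Sum>x\<in>P. \<Sum>y\<in>Q.
    fscale (Poly_Mapping.lookup p x * Poly_Mapping.lookup q y) (f x y))"
    by (intro sum.mono_neutral_left) (use assms in \<open>auto simp: in_keys_iff\<close>)
  finally show ?thesis .
qed

lemma bilinear_ext_add_left:
  "bilinear_ext f (p + p') q = bilinear_ext f p q + bilinear_ext f p' q"
proof -
  let ?P = "Poly_Mapping.keys p \<union> Poly_Mapping.keys p'" and ?Q = "Poly_Mapping.keys q"
  have "Poly_Mapping.keys (p + p') \<subseteq> ?P" by (rule keys_add)
  then show ?thesis
    by (simp add: bilinear_ext_superset[of ?P _ ?Q] lookup_add algebra_simps
        free.scale_left_distrib sum.distrib)
qed

lemma bilinear_ext_add_right:
  "bilinear_ext f p (q + q') = bilinear_ext f p q + bilinear_ext f p q'"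
proof -
  let ?P = "Poly_Mapping.keys p" and ?Q = "Poly_Mapping.keys q \<union> Poly_Mapping.keys q'"
  have "Poly_Mapping.keys (q + q') \<subseteq> ?Q" by (rule keys_add)
  then show ?thesis
    by (simp add: bilinear_ext_superset[of ?P _ ?Q] lookup_add algebra_simps
        free.scale_left_distrib sum.distrib)
qed

lemma keys_fscale: "Poly_Mapping.keys (fscale c p) \<subseteq> Poly_Mapping.keys p"
  by (auto simp: in_keys_iff lookup_fscale)

lemma bilinear_ext_scale_left: "bilinear_ext f (fscale c p) q = fscale c (bilinear_ext f p q)"
  by (simp add: bilinear_ext_superset[of "Poly_Mapping.keys p" _ "Poly_Mapping.keys q"]
      keys_fscale lookup_fscale free.scale_sum_right mult.assoc)

lemma bilinear_ext_scale_right: "bilinear_ext f p (fscale c q) = fscale c (bilinear_ext f p q)"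
  by (simp add: bilinear_ext_superset[of "Poly_Mapping.keys p" _ "Poly_Mapping.keys q"]
      keys_fscale lookup_fscale free.scale_sum_right mult_ac)

lemma bilinear_ext_fgen [simp]: "bilinear_ext f (fgen x) (fgen y) = f x y"
  by (simp add: bilinear_ext_def fgen_def)

lemma bilinear_ext_0 [simp]: "bilinear_ext f 0 q = 0" "bilinear_ext f p 0 = 0"
  by (simp_all add: bilinear_ext_def)

lemma bilinear_ext_diff_left:
  "bilinear_ext f (p - p') q = bilinear_ext f p q - bilinear_ext f p' q"
  by (metis add_diff_cancel diff_add_cancel bilinear_ext_add_left)

lemma bilinear_ext_diff_right:
  "bilinear_ext f p (q - q') = bilinear_ext f p q - bilinear_ext f p q'"
  by (metis add_diff_cancel diff_add_cancel bilinear_ext_add_right)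

lemma free_on_span: "p \<in> free_on X \<Longrightarrow> p \<in> free.span (fgen ` X)"
proof -
  assume p: "p \<in> free_on X"
  have "p = (\<Sum>x\<in>Poly_Mapping.keys p. fscale (Poly_Mapping.lookup p x) (fgen x))"
  proof (rule poly_mapping_eqI)
    fix k
    have "(\<Sum>x\<in>Poly_Mapping.keys p. Poly_Mapping.lookup p x * (1 when x = k)) =
        (\<Sum>x\<in>Poly_Mapping.keys p. if x = k then Poly_Mapping.lookup p x else 0)"
      by (rule sum.cong) (auto simp: when_def)
    then show "Poly_Mapping.lookup p k = Poly_Mapping.lookup
        (\<Sum>x\<in>Poly_Mapping.keys p. fscale (Poly_Mapping.lookup p x) (fgen x)) k"
      by (simp add: lookup_sum lookup_fscale fgen_def lookup_single in_keys_iff)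
  qed
  also have "\<dots> \<in> free.span (fgen ` X)"
    by (intro free.span_sum free.span_scale free.span_base) (use p in \<open>auto simp: free_on_def\<close>)
  finally show ?thesis .
qed

lemma bilinear_ext_in_span:
  assumes "\<And>a b. a \<in> A \<Longrightarrow> b \<in> B \<Longrightarrow> bilinear_ext f a b \<in> free.span C"
    and "p \<in> free.span A" "q \<in> free.span B"
  shows "bilinear_ext f p q \<in> free.span C"
  using assms(2)
proof (induction rule: free.span_induct_alt)
  case base
  show ?case by (simp add: free.span_zero)
next
  case (step c a p')
  have "bilinear_ext f a q \<in> free.span C"
    using assms(3)
  proof (induction rule: free.span_induct_alt)
    case base
    show ?case by (simp add: free.span_zero)
  next
    case (step d b q')
    then show ?case using \<open>a \<in> A\<close> assms(1)
      by (simp add: bilinear_ext_add_right bilinear_ext_scale_right free.span_add free.span_scale)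
  qed
  with step show ?case
    by (simp add: bilinear_ext_add_left bilinear_ext_scale_left free.span_add free.span_scale)
qed

lemma qbilinear_coset:
  assumes R: "R = free.span C"
    and l: "\<And>a q. a \<in> R1 \<Longrightarrow> q \<in> q0 +o R2 \<Longrightarrow> bilinear_ext f a q \<in> R"
    and r: "\<And>b. b \<in> R2 \<Longrightarrow> bilinear_ext f p0 b \<in> R"
    and z: "0 \<in> R1" "0 \<in> R2"
  shows "qbilinear R f (p0 +o R1) (q0 +o R2) = bilinear_ext f p0 q0 +o R"
proof
  show "qbilinear R f (p0 +o R1) (q0 +o R2) \<subseteq> bilinear_ext f p0 q0 +o R"
  proof
    fix t assume "t \<in> qbilinear R f (p0 +o R1) (q0 +o R2)"
    then obtain a b c where a: "a \<in> R1" and b: "b \<in> R2" and c: "c \<in> R"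
      and t: "t = bilinear_ext f (p0 + a) (q0 + b) + c"
      unfolding qbilinear_def set_plus_def elt_set_plus_def by blast
    have "q0 + b \<in> q0 +o R2" using b by (rule set_plus_intro2)
    then have *: "bilinear_ext f a (q0 + b) \<in> R" "bilinear_ext f p0 b \<in> R"
      using l r a b by blast+
    have "t = bilinear_ext f p0 q0 + (bilinear_ext f p0 b + bilinear_ext f a (q0 + b) + c)"
      unfolding t bilinear_ext_add_left[of f p0 a] bilinear_ext_add_right[of f p0 q0 b]
      by (simp add: algebra_simps)
    moreover have "bilinear_ext f p0 b + bilinear_ext f a (q0 + b) + c \<in> R"
      using * c unfolding R by (intro free.span_add)
    ultimately show "t \<in> bilinear_ext f p0 q0 +o R" by (auto simp: elt_set_plus_def)
  qed
next
  have "p0 \<in> p0 +o R1" "q0 \<in> q0 +o R2"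
    using z by (force simp: elt_set_plus_def)+
  then show "bilinear_ext f p0 q0 +o R \<subseteq> qbilinear R f (p0 +o R1) (q0 +o R2)"
    unfolding qbilinear_def set_plus_def elt_set_plus_def by blast
qed

lemma coset_eqI:
  assumes "p - q \<in> free.span C"
  shows "p +o free.span C = q +o free.span C"
proof -
  have "x +o free.span C \<subseteq> y +o free.span C" if "x - y \<in> free.span C" for x y
  proof
    fix t assume "t \<in> x +o free.span C"
    then obtain b where b: "b \<in> free.span C" "t = x + b" by (auto simp: elt_set_plus_def)
    then have "t = y + ((x - y) + b)" by simp
    with b that show "t \<in> y +o free.span C"
      unfolding elt_set_plus_def using free.span_add by blast
  qed
  moreover have "q - p \<in> free.span C" using free.span_neg[OF assms] by simp
  ultimately show ?thesis using assms by blast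
qed

lemma span_plus_span: "free.span C + free.span C = free.span C"
proof
  show "free.span C + free.span C \<subseteq> free.span C"
    by (auto simp: set_plus_def intro: free.span_add)
  show "free.span C \<subseteq> free.span C + free.span C"
    using free.span_zero[of C] by (force simp: set_plus_def)
qed

lemma coset_add: "(p +o free.span C) + (q +o free.span C) = (p + q) +o free.span C"
  by (simp add: set_plus_rearrange span_plus_span)

lemma coset_scale: "qscale (free.span C) c (p +o free.span C) = fscale c p +o free.span C"
proof
  show "qscale (free.span C) c (p +o free.span C) \<subseteq> fscale c p +o free.span C"
  proof
    fix t assume "t \<in> qscale (free.span C) c (p +o free.span C)"
    then obtain a b where "a \<in> free.span C" "b \<in> free.span C" "t = fscale c (p + a) + b"
      unfolding qscale_def set_plus_def elt_set_plus_def by blast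
    then have "t = fscale c p + (fscale c a + b)" "fscale c a + b \<in> free.span C"
      by (simp_all add: free.scale_right_distrib add.assoc free.span_add free.span_scale)
    then show "t \<in> fscale c p +o free.span C" unfolding elt_set_plus_def by blast
  qed
  have "p \<in> p +o free.span C" using free.span_zero[of C] by (force simp: elt_set_plus_def)
  then show "fscale c p +o free.span C \<subseteq> qscale (free.span C) c (p +o free.span C)"
    unfolding qscale_def set_plus_def elt_set_plus_def by blast
qed


section \<open>The Lie algebra \<open>\<gg> \<otimes> S\<close>\<close>

definition tensor_gens ::
  "('k::field \<Rightarrow> 'a::ab_group_add \<Rightarrow> 'a) \<Rightarrow> ('k \<Rightarrow> 'b::ab_group_add \<Rightarrow> 'b) \<Rightarrow> ('a \<times> 'b \<Rightarrow>\<^sub>0 'k) set"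
  where "tensor_gens scA scB =
    {fgen (x + y, s) - fgen (x, s) - fgen (y, s) |x y s. True} \<union>
    {fgen (x, s + t) - fgen (x, s) - fgen (x, t) |x s t. True} \<union>
    {fgen (scA c x, s) - fscale c (fgen (x, s)) |c x s. True} \<union>
    {fgen (x, scB c s) - fscale c (fgen (x, s)) |c x s. True}"

definition tensor_rels ::
  "('k::field \<Rightarrow> 'a::ab_group_add \<Rightarrow> 'a) \<Rightarrow> ('k \<Rightarrow> 'b::ab_group_add \<Rightarrow> 'b) \<Rightarrow> ('a \<times> 'b \<Rightarrow>\<^sub>0 'k) set"
  where "tensor_rels scA scB = free.span (tensor_gens scA scB)"

definition tensor_space ::
  "('k::field \<Rightarrow> 'a::ab_group_add \<Rightarrow> 'a) \<Rightarrow> ('k \<Rightarrow> 'b::ab_group_add \<Rightarrow> 'b) \<Rightarrow>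
   ('a \<times> 'b \<Rightarrow>\<^sub>0 'k) set set"
  where "tensor_space scA scB = (\<lambda>p. p +o tensor_rels scA scB) ` free_on UNIV"

definition tensor_scale ::
  "('k::field \<Rightarrow> 'a::ab_group_add \<Rightarrow> 'a) \<Rightarrow> ('k \<Rightarrow> 'b::ab_group_add \<Rightarrow> 'b) \<Rightarrow>
   'k \<Rightarrow> ('a \<times> 'b \<Rightarrow>\<^sub>0 'k) set \<Rightarrow> ('a \<times> 'b \<Rightarrow>\<^sub>0 'k) set"
  where "tensor_scale scA scB = qscale (tensor_rels scA scB)"

definition pure_tensor ::
  "('k::field \<Rightarrow> 'a::ab_group_add \<Rightarrow> 'a) \<Rightarrow> ('k \<Rightarrow> 'b::ab_group_add \<Rightarrow> 'b) \<Rightarrow>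
   'a \<Rightarrow> 'b \<Rightarrow> ('a \<times> 'b \<Rightarrow>\<^sub>0 'k) set"
  where "pure_tensor scA scB x s = fgen (x, s) +o tensor_rels scA scB"

definition tensor_bracket ::
  "('k::field \<Rightarrow> 'g::ab_group_add \<Rightarrow> 'g) \<Rightarrow> ('g \<Rightarrow> 'g \<Rightarrow> 'g) \<Rightarrow>
   ('k \<Rightarrow> 's::{comm_ring, comm_monoid_mult} \<Rightarrow> 's) \<Rightarrow>
   ('g \<times> 's \<Rightarrow>\<^sub>0 'k) set \<Rightarrow> ('g \<times> 's \<Rightarrow>\<^sub>0 'k) set \<Rightarrow> ('g \<times> 's \<Rightarrow>\<^sub>0 'k) set"
  where "tensor_bracket scg br scS =
    qbilinear (tensor_rels scg scS) (\<lambda>(x, r) (y, s). fgen (br x y, r * s))"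


section \<open>Weight modules\<close>

text \<open>A linear functional on \<open>H\<close> is represented by its extension by zero to the whole type.\<close>

definition dual_space :: "('k::field \<Rightarrow> 'g::ab_group_add \<Rightarrow> 'g) \<Rightarrow> 'g set \<Rightarrow> ('g \<Rightarrow> 'k) set"
  where "dual_space scg H = {\<mu>. (\<forall>x\<in>H. \<forall>y\<in>H. \<mu> (x + y) = \<mu> x + \<mu> y) \<and>
    (\<forall>c. \<forall>x\<in>H. \<mu> (scg c x) = c * \<mu> x) \<and> (\<forall>x. x \<notin> H \<longrightarrow> \<mu> x = 0)}"

definition weight_space ::
  "('k::field \<Rightarrow> 'g::ab_group_add \<Rightarrow> 'g) \<Rightarrow> 'g set \<Rightarrow>
   ('k \<Rightarrow> 's::{comm_ring, comm_monoid_mult} \<Rightarrow> 's) \<Rightarrow> ('k \<Rightarrow> 'v::ab_group_add \<Rightarrow> 'v) \<Rightarrow>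
   (('g \<times> 's \<Rightarrow>\<^sub>0 'k) set \<Rightarrow> 'v \<Rightarrow> 'v) \<Rightarrow> ('g \<Rightarrow> 'k) \<Rightarrow> 'v set"
  where "weight_space scg H scS scV \<phi> \<mu> =
    {v. \<forall>h\<in>H. \<phi> (pure_tensor scg scS h 1) v = scV (\<mu> h) v}"

definition weight_module ::
  "('k::field \<Rightarrow> 'g::ab_group_add \<Rightarrow> 'g) \<Rightarrow> 'g set \<Rightarrow>
   ('k \<Rightarrow> 's::{comm_ring, comm_monoid_mult} \<Rightarrow> 's) \<Rightarrow> ('k \<Rightarrow> 'v::ab_group_add \<Rightarrow> 'v) \<Rightarrow>
   (('g \<times> 's \<Rightarrow>\<^sub>0 'k) set \<Rightarrow> 'v \<Rightarrow> 'v) \<Rightarrow> bool"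
  where "weight_module scg H scS scV \<phi> \<longleftrightarrow>
    (\<forall>v. \<exists>!d :: ('g \<Rightarrow> 'k) \<Rightarrow>\<^sub>0 'v.
      Poly_Mapping.keys d \<subseteq> dual_space scg H \<and>
      (\<forall>\<mu>\<in>Poly_Mapping.keys d. Poly_Mapping.lookup d \<mu> \<in> weight_space scg H scS scV \<phi> \<mu>) \<and>
      v = (\<Sum>\<mu>\<in>Poly_Mapping.keys d. Poly_Mapping.lookup d \<mu>)) \<and>
    (\<forall>\<mu>\<in>dual_space scg H. \<exists>B. finite B \<and>
      module.span scV B = weight_space scg H scS scV \<phi> \<mu>)"

definition admissible ::
  "('k::field \<Rightarrow> 'g::ab_group_add \<Rightarrow> 'g) \<Rightarrow> 'g set \<Rightarrow>
   ('k \<Rightarrow> 's::{comm_ring, comm_monoid_mult} \<Rightarrow> 's) \<Rightarrow> ('k \<Rightarrow> 'v::ab_group_add \<Rightarrow> 'v) \<Rightarrow>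
   (('g \<times> 's \<Rightarrow>\<^sub>0 'k) set \<Rightarrow> 'v \<Rightarrow> 'v) \<Rightarrow> bool"
  where "admissible scg H scS scV \<phi> \<longleftrightarrow> weight_module scg H scS scV \<phi> \<and>
    (\<exists>B>0. \<forall>\<mu>\<in>dual_space scg H.
      vector_space.dim scV (weight_space scg H scS scV \<phi> \<mu>) \<le> B)"


section \<open>Evaluation modules\<close>

text \<open>
  The tensor product \<open>W 0 \<otimes> \<dots> \<otimes> W (r - 1)\<close> of subspaces of one ambient space.  For \<open>r = 0\<close> it is
  the free vector space on one generator.
\<close>

definition multi_gens ::
  "('k::field \<Rightarrow> 'w::ab_group_add \<Rightarrow> 'w) \<Rightarrow> nat \<Rightarrow> (nat \<Rightarrow> 'w set) \<Rightarrow> ((nat \<Rightarrow> 'w) \<Rightarrow>\<^sub>0 'k) set"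
  where "multi_gens scW r W =
    {fgen (w(i := a + b)) - fgen (w(i := a)) - fgen (w(i := b)) |w i a b.
       w \<in> (\<Pi>\<^sub>E i\<in>{..<r}. W i) \<and> i < r \<and> a \<in> W i \<and> b \<in> W i} \<union>
    {fgen (w(i := scW c a)) - fscale c (fgen (w(i := a))) |w i c a.
       w \<in> (\<Pi>\<^sub>E i\<in>{..<r}. W i) \<and> i < r \<and> a \<in> W i}"

definition multi_rels ::
  "('k::field \<Rightarrow> 'w::ab_group_add \<Rightarrow> 'w) \<Rightarrow> nat \<Rightarrow> (nat \<Rightarrow> 'w set) \<Rightarrow> ((nat \<Rightarrow> 'w) \<Rightarrow>\<^sub>0 'k) set"
  where "multi_rels scW r W = free.span (multi_gens scW r W)"

definition multi_space ::
  "('k::field \<Rightarrow> 'w::ab_group_add \<Rightarrow> 'w) \<Rightarrow> nat \<Rightarrow> (nat \<Rightarrow> 'w set) \<Rightarrow>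
   ((nat \<Rightarrow> 'w) \<Rightarrow>\<^sub>0 'k) set set"
  where "multi_space scW r W =
    (\<lambda>p. p +o multi_rels scW r W) ` free_on (\<Pi>\<^sub>E i\<in>{..<r}. W i)"

definition multi_scale ::
  "('k::field \<Rightarrow> 'w::ab_group_add \<Rightarrow> 'w) \<Rightarrow> nat \<Rightarrow> (nat \<Rightarrow> 'w set) \<Rightarrow>
   'k \<Rightarrow> ((nat \<Rightarrow> 'w) \<Rightarrow>\<^sub>0 'k) set \<Rightarrow> ((nat \<Rightarrow> 'w) \<Rightarrow>\<^sub>0 'k) set"
  where "multi_scale scW r W = qscale (multi_rels scW r W)"

definition eval_action ::
  "('k::field \<Rightarrow> 's::{comm_ring, comm_monoid_mult} \<Rightarrow> 's) \<Rightarrow> ('k \<Rightarrow> 'w::ab_group_add \<Rightarrow> 'w) \<Rightarrow>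
   nat \<Rightarrow> (nat \<Rightarrow> 's set) \<Rightarrow> (nat \<Rightarrow> 'w set) \<Rightarrow> (nat \<Rightarrow> 'g \<Rightarrow> 'w \<Rightarrow> 'w) \<Rightarrow>
   ('g \<times> 's \<Rightarrow>\<^sub>0 'k) set \<Rightarrow> ((nat \<Rightarrow> 'w) \<Rightarrow>\<^sub>0 'k) set \<Rightarrow> ((nat \<Rightarrow> 'w) \<Rightarrow>\<^sub>0 'k) set"
  where "eval_action scS scW r M W \<rho> =
    qbilinear (multi_rels scW r W)
      (\<lambda>(x, s) w. \<Sum>i<r. fscale (residue scS (M i) s) (fgen (w(i := \<rho> i x (w i)))))"


section \<open>The operations on cosets are the expected ones\<close>

lemma span_UNIV_fgen: "p \<in> free.span (range fgen)"
  by (rule free_on_span) (simp add: free_on_def)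

lemma tensor_gens_intros:
  "fgen (x + y, s) - fgen (x, s) - fgen (y, s) \<in> tensor_gens scA scB"
  "fgen (x, s + t) - fgen (x, s) - fgen (x, t) \<in> tensor_gens scA scB"
  "fgen (scA c x, s) - fscale c (fgen (x, s)) \<in> tensor_gens scA scB"
  "fgen (x, scB c s) - fscale c (fgen (x, s)) \<in> tensor_gens scA scB"
  unfolding tensor_gens_def by blast+

lemma tensor_gens_cases [consumes 1]:
  assumes "a \<in> tensor_gens scA scB"
  obtains
      (1) x y s where "a = fgen (x + y, s) - fgen (x, s) - fgen (y, s)"
    | (2) x s t where "a = fgen (x, s + t) - fgen (x, s) - fgen (x, t)"
    | (3) c x s where "a = fgen (scA c x, s) - fscale c (fgen (x, s))"
    | (4) c x s where "a = fgen (x, scB c s) - fscale c (fgen (x, s))"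
  using assms unfolding tensor_gens_def by blast

lemma pure_tensor_bilinear:
  "pure_tensor scA scB (x + y) s = pure_tensor scA scB x s + pure_tensor scA scB y s"
  "pure_tensor scA scB x (s + t) = pure_tensor scA scB x s + pure_tensor scA scB x t"
  "pure_tensor scA scB (scA c x) s = tensor_scale scA scB c (pure_tensor scA scB x s)"
  "pure_tensor scA scB x (scB c s) = tensor_scale scA scB c (pure_tensor scA scB x s)"
  unfolding pure_tensor_def tensor_rels_def tensor_scale_def coset_add coset_scale
  by (rule coset_eqI, rule free.span_base, (unfold diff_diff_eq[symmetric])?,
      rule tensor_gens_intros)+

lemma tensor_bracket_pure:
  fixes scg :: "'k::field \<Rightarrow> 'g::ab_group_add \<Rightarrow> 'g"
    and scS :: "'k \<Rightarrow> 's::{comm_ring, comm_monoid_mult} \<Rightarrow> 's"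
  assumes "lie_algebra scg br" "comm_algebra scS"
  shows "tensor_bracket scg br scS (pure_tensor scg scS x r) (pure_tensor scg scS y s) =
    pure_tensor scg scS (br x y) (r * s)"
proof -
  interpret lie_algebra scg br by fact
  interpret S: comm_algebra scS by fact
  let ?f = "\<lambda>(x, r) (y, s). fgen (br x y, r * s) :: 'g \<times> 's \<Rightarrow>\<^sub>0 'k"
  let ?C = "tensor_gens scg scS"
  have br_simps: "br (u + v) w = br u w + br v w" "br w (u + v) = br w u + br w v"
    "br (scg c u) w = scg c (br u w)" "br w (scg c u) = scg c (br w u)" for u v w c
    using linear_bracket_left linear_bracket_right
    by (simp_all add: Vector_Spaces.linear_iff)
  have scr: "a * scS c b = scS c (a * b)" "scS c a * b = scS c (a * b)" for a b c
    using S.scale_mult by (metis mult.commute)+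
  have l: "bilinear_ext ?f a q \<in> free.span ?C" if "a \<in> free.span ?C" for a q
  proof (rule bilinear_ext_in_span[OF _ that span_UNIV_fgen])
    fix a b :: "'g \<times> 's \<Rightarrow>\<^sub>0 'k" assume "a \<in> ?C" "b \<in> range fgen"
    then show "bilinear_ext ?f a b \<in> free.span ?C"
      by (cases rule: tensor_gens_cases) (auto simp: bilinear_ext_diff_left bilinear_ext_scale_left br_simps scr distrib_right
          intro!: free.span_base tensor_gens_intros)
  qed
  have r: "bilinear_ext ?f p a \<in> free.span ?C" if "a \<in> free.span ?C" for a p
  proof (rule bilinear_ext_in_span[OF _ span_UNIV_fgen that])
    fix b a :: "'g \<times> 's \<Rightarrow>\<^sub>0 'k" assume "a \<in> ?C" "b \<in> range fgen"
    then show "bilinear_ext ?f b a \<in> free.span ?C"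
      by (cases rule: tensor_gens_cases) (auto simp: bilinear_ext_diff_right bilinear_ext_scale_right br_simps scr distrib_left
          intro!: free.span_base tensor_gens_intros)
  qed
  show ?thesis
    unfolding tensor_bracket_def pure_tensor_def tensor_rels_def
    by (subst qbilinear_coset[OF refl]) (auto intro: l r free.span_zero)
qed

lemma multi_gens_intros:
  "w \<in> (\<Pi>\<^sub>E i\<in>{..<r}. W i) \<Longrightarrow> i < r \<Longrightarrow> a \<in> W i \<Longrightarrow> b \<in> W i \<Longrightarrow>
    fgen (w(i := a + b)) - fgen (w(i := a)) - fgen (w(i := b)) \<in> multi_gens scW r W"
  "w \<in> (\<Pi>\<^sub>E i\<in>{..<r}. W i) \<Longrightarrow> i < r \<Longrightarrow> a \<in> W i \<Longrightarrow>
    fgen (w(i := scW c a)) - fscale c (fgen (w(i := a))) \<in> multi_gens scW r W"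
  unfolding multi_gens_def by blast+

lemma PiE_upd: "w \<in> (\<Pi>\<^sub>E i\<in>{..<r}. W i) \<Longrightarrow> i < r \<Longrightarrow> a \<in> W i \<Longrightarrow> w(i := a) \<in> (\<Pi>\<^sub>E i\<in>{..<r}. W i)"
  for r :: nat
  by (auto simp: PiE_iff extensional_def)

lemma eval_action_pure:
  fixes scg :: "'k::field \<Rightarrow> 'g::ab_group_add \<Rightarrow> 'g"
    and scS :: "'k \<Rightarrow> 's::{comm_ring, comm_monoid_mult} \<Rightarrow> 's"
    and scW :: "'k \<Rightarrow> 'w::ab_group_add \<Rightarrow> 'w"
  assumes "comm_algebra scS" "vector_space scW"
    and M: "\<And>i. i < r \<Longrightarrow> maximal_ideal (M i)"
    and res: "\<And>i s. i < r \<Longrightarrow> \<exists>c. s - scS c 1 \<in> M i"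
    and rep: "\<And>i. i < r \<Longrightarrow> lie_rep scg br UNIV scW (W i) (\<rho> i)"
    and w: "w \<in> (\<Pi>\<^sub>E i\<in>{..<r}. W i)"
  shows "eval_action scS scW r M W \<rho> (pure_tensor scg scS x s) (fgen w +o multi_rels scW r W) =
    (\<Sum>i<r. fscale (residue scS (M i) s) (fgen (w(i := \<rho> i x (w i))))) +o multi_rels scW r W"
proof -
  interpret S: comm_algebra scS by fact
  interpret W: vector_space scW by fact
  let ?X = "\<Pi>\<^sub>E i\<in>{..<r}. W i"
  let ?C = "multi_gens scW r W" and ?D = "tensor_gens scg scS"
  let ?c = "\<lambda>i s. residue scS (M i) s"
  let ?f = "\<lambda>(x, s) w. \<Sum>i<r. fscale (?c i s) (fgen (w(i := \<rho> i x (w i))))"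
  have I: "a + b \<in> M i" "t * a \<in> M i" if "i < r" "a \<in> M i" "b \<in> M i" for i a b t
  proof -
    have "ring_ideal (M i)" using M[OF that(1)] by (simp add: maximal_ideal_def)
    then show "a + b \<in> M i" "t * a \<in> M i" using that by (simp_all add: ring_ideal_def)
  qed
  have resD: "t - scS (?c i t) 1 \<in> M i" if i: "i < r" for i t
  proof -
    obtain c where c: "t - scS c 1 \<in> M i" using res[OF i] by blast
    with S.residue_eqI[OF M[OF i] c] show ?thesis by simp
  qed
  have res_add: "?c i (t + u) = ?c i t + ?c i u" if i: "i < r" for i t u
  proof (rule S.residue_eqI[OF M[OF i]])
    have "(t - scS (?c i t) 1) + (u - scS (?c i u) 1) \<in> M i"
      by (rule I(1)[OF i resD[OF i] resD[OF i]])
    then show "t + u - scS (?c i t + ?c i u) 1 \<in> M i"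
      by (simp add: S.scale_left_distrib algebra_simps)
  qed
  have res_scale: "?c i (scS c t) = c * ?c i t" if i: "i < r" for i c t
  proof (rule S.residue_eqI[OF M[OF i]])
    have "scS c 1 * (t - scS (?c i t) 1) \<in> M i"
      by (rule I(2)[OF i resD[OF i] resD[OF i]])
    then show "scS c t - scS (c * ?c i t) 1 \<in> M i"
      by (simp add: S.scale_mult[symmetric] S.scale_right_diff_distrib)
  qed
  have \<rho>: "\<rho> i x v \<in> W i" "\<rho> i x (v + u) = \<rho> i x v + \<rho> i x u"
    "\<rho> i x (scW c v) = scW c (\<rho> i x v)" "\<rho> i (x + y) v = \<rho> i x v + \<rho> i y v"
    "\<rho> i (scg c x) v = scW c (\<rho> i x v)"
    "v + u \<in> W i" "scW c v \<in> W i"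
    if "i < r" "v \<in> W i" "u \<in> W i" for i x y v u c
    using rep[OF that(1)] that W.subspace_add W.subspace_scale
    unfolding lie_rep_def by auto
  have C_X: "?C \<subseteq> free.span (fgen ` ?X)"
  proof -
    have "fgen (v(i := u)) \<in> free.span (fgen ` ?X)" if "v \<in> ?X" "i < r" "u \<in> W i" for v i u
      by (intro free.span_base imageI PiE_upd that)
    then show ?thesis
      unfolding multi_gens_def by (auto intro!: free.span_diff free.span_scale intro: \<rho>)
  qed
  have X_i: "v i \<in> W i" if "v \<in> ?X" "i < r" for v i
    using that by (auto simp: PiE_iff)
  have l: "bilinear_ext ?f a q \<in> free.span ?C"
    if a: "a \<in> tensor_rels scg scS" and q: "q \<in> fgen w +o multi_rels scW r W" for a q
  proof (rule bilinear_ext_in_span)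
    show "a \<in> free.span ?D" using a by (simp add: tensor_rels_def)
    have "free.span ?C \<subseteq> free.span (fgen ` ?X)" by (rule free.span_minimal[OF C_X free.subspace_span])
    then show "q \<in> free.span (fgen ` ?X)"
      using q w unfolding elt_set_plus_def multi_rels_def
      by (auto intro!: free.span_add intro: free.span_base)
  next
    fix a and b :: "(nat \<Rightarrow> 'w) \<Rightarrow>\<^sub>0 'k" assume a: "a \<in> ?D" and "b \<in> fgen ` ?X"
    then obtain v where v: "v \<in> ?X" and b: "b = fgen v" by blast
    note vi = X_i[OF v]
    from a show "bilinear_ext ?f a b \<in> free.span ?C"
    proof (cases rule: tensor_gens_cases)
      case (1 x y s)
      have "bilinear_ext ?f a b = (\<Sum>i<r. fscale (?c i s)
          (fgen (v(i := \<rho> i x (v i) + \<rho> i y (v i))) - fgen (v(i := \<rho> i x (v i)))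
            - fgen (v(i := \<rho> i y (v i)))))"
        unfolding 1 b bilinear_ext_diff_left bilinear_ext_fgen
        by (simp add: \<rho>(4)[OF _ vi vi] free.scale_right_diff_distrib sum_subtractf)
      also have "\<dots> \<in> free.span ?C"
        by (intro free.span_sum free.span_scale free.span_base multi_gens_intros v)
          (auto intro: \<rho> vi)
      finally show ?thesis .
    next
      case (2 x s t)
      have "bilinear_ext ?f a b = 0"
        unfolding 2 b bilinear_ext_diff_left bilinear_ext_fgen
        by (simp add: res_add free.scale_left_distrib sum.distrib)
      then show ?thesis by (simp add: free.span_zero)
    next
      case (3 c x s)
      have "bilinear_ext ?f a b = (\<Sum>i<r. fscale (?c i s)
          (fgen (v(i := scW c (\<rho> i x (v i)))) - fscale c (fgen (v(i := \<rho> i x (v i))))))"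
        unfolding 3 b bilinear_ext_diff_left bilinear_ext_scale_left bilinear_ext_fgen
        by (simp add: \<rho>(5)[OF _ vi vi] free.scale_right_diff_distrib sum_subtractf
            free.scale_sum_right mult.commute)
      also have "\<dots> \<in> free.span ?C"
        by (intro free.span_sum free.span_scale free.span_base multi_gens_intros v)
          (auto intro: \<rho> vi)
      finally show ?thesis .
    next
      case (4 c x s)
      have "bilinear_ext ?f a b = 0"
        unfolding 4 b bilinear_ext_diff_left bilinear_ext_scale_left bilinear_ext_fgen
        by (simp add: res_scale free.scale_sum_right)
      then show ?thesis by (simp add: free.span_zero)
    qed
  qed
  have r: "bilinear_ext ?f (fgen (x, s)) q \<in> free.span ?C" if q: "q \<in> multi_rels scW r W" for q
  proof (rule bilinear_ext_in_span)
    show "q \<in> free.span ?C" using q by (simp add: multi_rels_def)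
    show "fgen (x, s) \<in> free.span {fgen (x, s)}" by (simp add: free.span_base)
  next
    fix p b assume p: "p \<in> {fgen (x, s) :: 'g \<times> 's \<Rightarrow>\<^sub>0 'k}" and "b \<in> ?C"
    then consider
        (1) v i y z where "v \<in> ?X" "i < r" "y \<in> W i" "z \<in> W i"
          "b = fgen (v(i := y + z)) - fgen (v(i := y)) - fgen (v(i := z))"
      | (2) v i c y where "v \<in> ?X" "i < r" "y \<in> W i"
          "b = fgen (v(i := scW c y)) - fscale c (fgen (v(i := y)))"
      unfolding multi_gens_def by blast
    then show "bilinear_ext ?f p b \<in> free.span ?C"
    proof cases
      case 1
      let ?g = "\<lambda>j u. fgen ((v(i := u))(j := \<rho> j x ((v(i := u)) j)))"
      have "bilinear_ext ?f p b = (\<Sum>j<r. fscale (?c j s) (?g j (y + z) - ?g j y - ?g j z))"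
        using p unfolding 1 by (simp add: bilinear_ext_diff_right
            free.scale_right_diff_distrib sum_subtractf)
      also have "\<dots> \<in> free.span ?C"
      proof (intro free.span_sum free.span_scale free.span_base)
        fix j assume "j \<in> {..<r}"
        then have j: "j < r" by simp
        show "?g j (y + z) - ?g j y - ?g j z \<in> ?C"
        proof (cases "j = i")
          case True
          then show ?thesis using 1 \<rho>[OF 1(2) 1(3) 1(4)] \<rho>(1)[OF 1(2) 1(4) 1(4)]
            by (auto intro: multi_gens_intros)
        next
          case False
          then have *: "?g j u = fgen ((v(j := \<rho> j x (v j)))(i := u))" for u
            by (simp add: fun_upd_twist)
          have "v(j := \<rho> j x (v j)) \<in> ?X"
            using \<rho>(1)[OF j X_i[OF 1(1) j] X_i[OF 1(1) j]] by (intro PiE_upd 1 j)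
          then show ?thesis unfolding * using 1 by (intro multi_gens_intros)
        qed
      qed
      finally show ?thesis .
    next
      case 2
      let ?g = "\<lambda>j u. fgen ((v(i := u))(j := \<rho> j x ((v(i := u)) j)))"
      have "bilinear_ext ?f p b = (\<Sum>j<r. fscale (?c j s) (?g j (scW c y) - fscale c (?g j y)))"
        using p unfolding 2 by (simp add: bilinear_ext_diff_right bilinear_ext_scale_right
            free.scale_right_diff_distrib sum_subtractf free.scale_sum_right mult.commute)
      also have "\<dots> \<in> free.span ?C"
      proof (intro free.span_sum free.span_scale free.span_base)
        fix j assume "j \<in> {..<r}"
        then have j: "j < r" by simp
        show "?g j (scW c y) - fscale c (?g j y) \<in> ?C"
        proof (cases "j = i")
          case True
          then show ?thesis using 2 \<rho>[OF 2(2) 2(3) 2(3)]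
            by (auto intro: multi_gens_intros)
        next
          case False
          then have *: "?g j u = fgen ((v(j := \<rho> j x (v j)))(i := u))" for u
            by (simp add: fun_upd_twist)
          have "v(j := \<rho> j x (v j)) \<in> ?X"
            using \<rho>(1)[OF j X_i[OF 2(1) j] X_i[OF 2(1) j]] by (intro PiE_upd 2 j)
          then show ?thesis unfolding * using 2 by (intro multi_gens_intros)
        qed
      qed
      finally show ?thesis .
    qed
  qed
  have z: "0 \<in> tensor_rels scg scS" "0 \<in> multi_rels scW r W"
    by (simp_all add: tensor_rels_def multi_rels_def free.span_zero)
  show ?thesis
    unfolding eval_action_def pure_tensor_def
    by (subst qbilinear_coset[OF multi_rels_def])
      (use l r z in \<open>auto simp: multi_rels_def\<close>)
qed

end

theory Submission
  imports Defs
begin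

text \<open>
  Let \<open>K\<close> be the ideal of all \<open>s\<close> with \<open>\<gg> \<otimes> s\<close> acting by zero, and assume the action is nontrivial.
  Since \<open>\<gg> \<otimes> 1\<close> then acts faithfully and \<open>\<hh>\<close> acts diagonalizably on \<open>V\<close>, \<open>\<hh>\<close> is abelian and \<open>\<gg>\<close> is the
  sum of \<open>\<hh>\<close> and its root spaces.  The \<open>s\<close> for which all \<open>x\<^sub>\<alpha> \<otimes> s\<close> kill a fixed weight space form an
  ideal \<open>I\<close> of finite codimension with \<open>I\<^sup>2 \<subseteq> K\<close>.  Boundedness of the weight multiplicities makes \<open>K\<close>
  radical: if \<open>s\<^sup>2 \<in> K\<close> and \<open>v\<close> is an eigenvector of \<open>h \<otimes> s\<close>, then \<open>(x\<^sub>\<alpha> \<otimes> 1)\<^sup>n v\<close> generates under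
  \<open>h \<otimes> s\<close> a Jordan chain of length \<open>n + 1\<close> inside one weight space unless \<open>(x\<^sub>\<alpha> \<otimes> s)\<^sup>n v = 0\<close>.  So
  \<open>I \<subseteq> K\<close>, and \<open>S/K\<close> is a finite product of copies of \<open>k\<close>; its idempotents \<open>e\<^sub>i\<close> give commuting
  actions of \<open>\<gg>\<close> on \<open>V\<close>.  Minimality in a finite-dimensional joint weight space produces a vector \<open>v\<close>
  generating a simple module \<open>W\<^sub>i\<close> under each of them, and \<open>u\<^sub>1 v \<otimes> \<dots> \<otimes> u\<^sub>r v \<mapsto> u\<^sub>1 \<dots> u\<^sub>r v\<close> is the
  isomorphism; it is injective by the density theorem.
\<close>

section \<open>Eigenvectors in finite-dimensional subspaces\<close>

text \<open>A bound on all multiplicities at once, not just finiteness of each, drives the radical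
  step: the chain of length n + 1 lives in a weight space that moves with n. The bound is spent
  twice, first to make root vectors nilpotent, then, on a vector killed by all of them, to make the
  eigenvalue c of [x, y] \<otimes> st vanish through (y \<otimes> st)^n (x \<otimes> 1)^n w = (-1)^n
  n! c^n w. The inclusion of I^2 in K rests on the fact that root vectors and their pairwise
  brackets span g.

  The obstacle in the last part is that V and the factors may be infinite dimensional. The weight
  spaces of a single copy of h may be so too, hence neither a simple submodule nor Schur's lemma is
  at hand for one copy of g by itself. Submodules are therefore compared by their traces on a joint
  weight space of all copies, which is finite dimensional; no nonzero submodule for one copy escapes
  its weight, because the other copies commute with it and together they reach every vector.\<close>

definition endo_on :: "('k \<Rightarrow> 'v::ab_group_add \<Rightarrow> 'v) \<Rightarrow> 'v set \<Rightarrow> ('v \<Rightarrow> 'v) \<Rightarrow> bool"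
  where "endo_on scale N T \<longleftrightarrow> (\<forall>u\<in>N. \<forall>v\<in>N. T (u + v) = T u + T v) \<and>
    (\<forall>c. \<forall>v\<in>N. T (scale c v) = scale c (T v)) \<and> T ` N \<subseteq> N"

definition poly_act :: "('k::zero \<Rightarrow> 'v::ab_group_add \<Rightarrow> 'v) \<Rightarrow> ('v \<Rightarrow> 'v) \<Rightarrow> 'k poly \<Rightarrow> 'v \<Rightarrow> 'v"
  where "poly_act scale T p v = (\<Sum>i\<le>degree p. scale (coeff p i) ((T ^^ i) v))"

section \<open>Linear algebra inside finite-dimensional subspaces\<close>

context vector_space
begin

text \<open>For families instead of sets, because the applications are iterates of an operator and
  representatives modulo an ideal, which may repeat. A repetition is itself a relation, with
  coefficients 1 and -1.\<close>

lemma dependent_sequence: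
  assumes "finite C" and u: "\<And>i. i \<le> card C \<Longrightarrow> u i \<in> span C"
  shows "\<exists>c. (\<exists>i\<le>card C. c i \<noteq> 0) \<and> (\<Sum>i\<le>card C. scale (c i) (u i)) = 0"
proof (cases "inj_on u {..card C}")
  case True
  have "dependent (u ` {..card C})"
  proof (rule ccontr)
    assume "independent (u ` {..card C})"
    then have "card (u ` {..card C}) \<le> card C"
      using independent_span_bound[OF \<open>finite C\<close>] u by blast
    with True show False by (simp add: card_image)
  qed
  then obtain d where "\<exists>v\<in>u ` {..card C}. d v \<noteq> 0" "(\<Sum>v\<in>u ` {..card C}. scale (d v) v) = 0"
    by (auto simp: dependent_finite)
  then show ?thesis
    by (intro exI[of _ "d \<circ> u"]) (auto simp: sum.reindex[OF True])
next
  case False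
  then obtain i j where ij: "i \<le> card C" "j \<le> card C" "i \<noteq> j" "u i = u j"
    by (auto simp: inj_on_def)
  let ?c = "\<lambda>n. if n = i then 1 else if n = j then - 1 else 0"
  have "(\<Sum>n\<le>card C. scale (?c n) (u n)) = (\<Sum>n\<in>{i, j}. scale (?c n) (u n))"
    by (intro sum.mono_neutral_right) (use ij in auto)
  also have "\<dots> = 0" using ij by simp
  finally show ?thesis using ij by (intro exI[of _ ?c]) (auto intro: exI[of _ i])
qed

lemma subspace_basis:
  assumes "finite C" "A \<subseteq> span C" "subspace A"
  obtains D where "finite D" "D \<subseteq> A" "independent D" "span D = A" "card D = dim A"
proof -
  obtain D where D: "D \<subseteq> A" "independent D" "A \<subseteq> span D" "card D = dim A"
    using basis_exists by blast
  then have "finite D" using independent_span_bound assms by blast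
  moreover have "span D = A" using D assms span_minimal by blast
  ultimately show thesis using that D by blast
qed

lemma subspace_eqI_dim:
  assumes "finite C" "A \<subseteq> span C" "subspace A" "A' \<subseteq> A" "subspace A'" "dim A \<le> dim A'"
  shows "A' = A"
proof -
  obtain D' where D': "finite D'" "D' \<subseteq> A'" "independent D'" "span D' = A'" "card D' = dim A'"
    using subspace_basis[of C A'] assms by blast
  obtain D where D: "D' \<subseteq> D" "D \<subseteq> A" "independent D" "A \<subseteq> span D"
    using maximal_independent_subset_extend[of D' A] D' assms(4) by blast
  have "finite D" using independent_span_bound assms D by blast
  moreover have "card D \<le> card D'" using basis_card_eq_dim[OF D(2,4,3)] D' assms by simp
  ultimately have "D = D'" using D(1) card_seteq by metis
  with D D' assms show ?thesis by simp
qed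

lemma minimal_subspace:
  assumes "finite C" "\<A> \<noteq> {}" and \<A>: "\<And>A. A \<in> \<A> \<Longrightarrow> subspace A \<and> A \<subseteq> span C"
  obtains A where "A \<in> \<A>" "\<And>A'. A' \<in> \<A> \<Longrightarrow> A' \<subseteq> A \<Longrightarrow> A' = A"
proof -
  obtain A where A: "A \<in> \<A>" "\<And>A'. A' \<in> \<A> \<Longrightarrow> dim A \<le> dim A'"
    using assms(2) ex_has_least_nat[of "\<lambda>A. A \<in> \<A>" _ dim] by blast
  then show thesis using that subspace_eqI_dim[OF assms(1)] \<A> by meson
qed

lemma maximal_subspace:
  assumes "finite C" "\<A> \<noteq> {}" and \<A>: "\<And>A. A \<in> \<A> \<Longrightarrow> subspace A \<and> A \<subseteq> span C"
  obtains A where "A \<in> \<A>" "\<And>A'. A' \<in> \<A> \<Longrightarrow> A \<subseteq> A' \<Longrightarrow> A' = A"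
proof -
  obtain A0 where "A0 \<in> \<A>" using assms by blast
  moreover have "\<forall>A. A \<in> \<A> \<longrightarrow> dim A \<le> card C" using \<A> dim_le_card assms(1) by blast
  ultimately obtain A where A: "A \<in> \<A>" "\<And>A'. A' \<in> \<A> \<Longrightarrow> dim A' \<le> dim A"
    using ex_has_greatest_nat[of "\<lambda>A. A \<in> \<A>" A0 dim "Suc (card C)"] by (auto simp: less_Suc_eq_le)
  show thesis
  proof (rule that[OF A(1)])
    fix A' assume A': "A' \<in> \<A>" "A \<subseteq> A'"
    show "A' = A" using subspace_eqI_dim[of C A' A] A A' \<A> assms(1) by auto
  qed
qed

lemma endo_onD:
  fixes N :: "'b set" and T :: "'b \<Rightarrow> 'b"
  assumes "endo_on scale N T"
  shows "u \<in> N \<Longrightarrow> v \<in> N \<Longrightarrow> T (u + v) = T u + T v"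
    and "v \<in> N \<Longrightarrow> T (scale c v) = scale c (T v)"
    and "v \<in> N \<Longrightarrow> T v \<in> N"
  using assms by (auto simp: endo_on_def)

lemma endo_on_funpow: "endo_on scale N T \<Longrightarrow> v \<in> N \<Longrightarrow> (T ^^ n) v \<in> N"
  by (induction n) (auto dest: endo_onD)

lemma endo_on_sum:
  assumes T: "endo_on scale N T" "subspace N" and f: "\<And>i. i \<in> I \<Longrightarrow> f i \<in> N"
  shows "T (\<Sum>i\<in>I. f i) = (\<Sum>i\<in>I. T (f i))"
  using f
proof (induction I rule: infinite_finite_induct)
  case (insert i I)
  then have "f i \<in> N" "(\<Sum>i\<in>I. f i) \<in> N" by (auto intro: subspace_sum[OF T(2)])
  then show ?case using insert endo_onD(1)[OF T(1)] by simp
qed (use endo_onD(2)[OF T(1) subspace_0[OF T(2)], of 0] in auto)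

lemma poly_act_bound:
  "degree p \<le> n \<Longrightarrow> poly_act scale T p v = (\<Sum>i\<le>n. scale (coeff p i) ((T ^^ i) v))"
  unfolding poly_act_def by (intro sum.mono_neutral_left) (auto simp: coeff_eq_0)

text \<open>\<open>[:- a, 1:]\<close> is X - a, so a root of a polynomial splits off a factor T - a.
  Multiplication by X shifts the coefficients, hence the sums up to \<open>Suc ?n\<close>.\<close>

lemma poly_act_linear_factor:
  assumes T: "endo_on scale N T" "subspace N" and v: "v \<in> N"
  shows "poly_act scale T ([:- a, 1:] * q) v = T (poly_act scale T q v) - scale a (poly_act scale T q v)"
proof -
  let ?n = "degree q"
  have e: "[:- a, 1:] * q = pCons 0 q - smult a q" by simp
  have "degree ([:- a, 1:] * q) \<le> Suc ?n"
    using degree_mult_le[of "[:- a, 1:]" q] by simp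
  then have "poly_act scale T ([:- a, 1:] * q) v =
      (\<Sum>i\<le>Suc ?n. scale (coeff (pCons 0 q) i) ((T ^^ i) v)) -
      scale a (\<Sum>i\<le>Suc ?n. scale (coeff q i) ((T ^^ i) v))"
    unfolding e by (simp only: poly_act_bound coeff_diff coeff_smult scale_left_diff_distrib
        sum_subtractf scale_sum_right scale_scale)
  also have "(\<Sum>i\<le>Suc ?n. scale (coeff (pCons 0 q) i) ((T ^^ i) v)) =
      (\<Sum>i\<le>?n. scale (coeff q i) (T ((T ^^ i) v)))"
    by (subst sum.atMost_Suc_shift) simp
  also have "\<dots> = T (poly_act scale T q v)"
    unfolding poly_act_def
    by (subst endo_on_sum[OF T])
      (use v endo_on_funpow[OF T(1)] endo_onD[OF T(1)] subspace_scale[OF T(2)] in auto)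
  also have "(\<Sum>i\<le>Suc ?n. scale (coeff q i) ((T ^^ i) v)) = poly_act scale T q v"
    by (simp add: poly_act_bound[of q "Suc ?n"])
  finally show ?thesis .
qed

lemma poly_act_in:
  "endo_on scale N T \<Longrightarrow> subspace N \<Longrightarrow> v \<in> N \<Longrightarrow> poly_act scale T p v \<in> N"
  unfolding poly_act_def by (intro subspace_sum subspace_scale endo_on_funpow)

end

text \<open>\<open>Z = 0\<close> gives eigenvectors; \<open>Z\<close> a prime ideal of an algebra gives its residue field.\<close>

lemma exists_eigenvector_mod:
  fixes scale :: "'k::alg_closed_field \<Rightarrow> 'v::ab_group_add \<Rightarrow> 'v"
  assumes "vector_space scale"
    and N: "module.subspace scale N" and Z: "module.subspace scale Z"
    and C: "finite C" "\<And>x. x \<in> N \<Longrightarrow> \<exists>t\<in>module.span scale C. x - t \<in> Z"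
    and T: "endo_on scale N T"
    and v: "v \<in> N" "v \<notin> Z"
  obtains a w where "w \<in> N" "w \<notin> Z" "T w - scale a w \<in> Z"
proof -
  interpret vector_space scale by fact
  let ?P = "\<lambda>p. p \<noteq> 0 \<and> poly_act scale T p v \<in> Z"
  obtain p0 where "?P p0"
  proof -
    \<comment> \<open>Modulo \<open>Z\<close> the iterates of \<open>v\<close> have representatives
      in \<open>span C\<close>. Among \<open>card C + 1\<close> of them there is a relation, and its
      coefficients are those of the polynomial.\<close>
    have "\<forall>i. \<exists>t\<in>span C. (T ^^ i) v - t \<in> Z"
      using C(2) endo_on_funpow[OF T v(1)] by blast
    then obtain t where t: "\<And>i. t i \<in> span C" "\<And>i. (T ^^ i) v - t i \<in> Z" by metis
    obtain c where c: "\<exists>i\<le>card C. c i \<noteq> 0" "(\<Sum>i\<le>card C. scale (c i) (t i)) = 0"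
      using dependent_sequence[OF C(1), of t] t by blast
    define p where "p = Poly (map c [0..<Suc (card C)])"
    have coeff: "coeff p i = (if i \<le> card C then c i else 0)" for i
      by (simp add: p_def nth_default_def del: upt_Suc)
    then have "degree p \<le> card C" by (intro degree_le) auto
    then have "poly_act scale T p v = (\<Sum>i\<le>card C. scale (c i) ((T ^^ i) v))"
      by (simp add: poly_act_bound coeff)
    also have "\<dots> = (\<Sum>i\<le>card C. scale (c i) ((T ^^ i) v - t i))"
      by (simp add: scale_right_diff_distrib sum_subtractf c)
    also have "\<dots> \<in> Z" by (intro subspace_sum[OF Z] subspace_scale[OF Z] t)
    finally have "poly_act scale T p v \<in> Z" .
    moreover have "p \<noteq> 0" using c(1) coeff by (metis coeff_0)
    ultimately show thesis using that by blast
  qed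
  \<comment> \<open>Least degree plays the part of the minimal polynomial of \<open>v\<close> modulo
    \<open>Z\<close>: after division by X - a the quotient \<open>q\<close> no longer sends
    \<open>v\<close> into \<open>Z\<close>, so q(T) v is the wanted vector.\<close>
  then obtain p where p: "?P p" "\<And>q. ?P q \<Longrightarrow> degree p \<le> degree q"
    using ex_has_least_nat[of ?P p0 degree] by blast
  have "degree p > 0"
  proof (rule ccontr)
    assume "\<not> degree p > 0"
    then obtain c where c: "p = [:c:]" using degree_eq_zeroE by blast
    with p(1) have "c \<noteq> 0" "scale c v \<in> Z" by (auto simp: poly_act_def)
    then have "scale (inverse c) (scale c v) \<in> Z" by (rule_tac subspace_scale[OF Z])
    with \<open>c \<noteq> 0\<close> v show False by simp
  qed
  then obtain a where "poly p a = 0" using alg_closed_imp_poly_has_root by blast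
  then obtain q where q: "p = [:- a, 1:] * q" by (auto simp: poly_eq_0_iff_dvd)
  then have "q \<noteq> 0" using p(1) by auto
  then have "degree q < degree p" using q by (simp add: degree_mult_eq del: mult_pCons_left)
  with p(2)[of q] \<open>q \<noteq> 0\<close> have "poly_act scale T q v \<notin> Z" by auto
  moreover have "T (poly_act scale T q v) - scale a (poly_act scale T q v) \<in> Z"
    using p(1) poly_act_linear_factor[OF T N v(1)] q by simp
  ultimately show thesis using that poly_act_in[OF T N v(1)] by blast
qed

lemma exists_eigenvector:
  fixes scale :: "'k::alg_closed_field \<Rightarrow> 'v::ab_group_add \<Rightarrow> 'v"
  assumes "vector_space scale"
    and N: "module.subspace scale N" "finite C" "N \<subseteq> module.span scale C"
    and T: "endo_on scale N T"
    and v: "v \<in> N" "v \<noteq> 0"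
  obtains a w where "w \<in> N" "w \<noteq> 0" "T w = scale a w"
proof -
  interpret vector_space scale by fact
  have "\<exists>t\<in>span C. x - t \<in> {0}" if "x \<in> N" for x using that N by auto
  then obtain a w where "w \<in> N" "w \<notin> {0}" "T w - scale a w \<in> {0}"
    using exists_eigenvector_mod[OF assms(1) N(1) subspace_single_0 N(2) _ T v(1)] v(2)
    by (metis singletonD)
  then show thesis using that by simp
qed

text \<open>On a minimal nonzero \<open>F\<close>-stable subspace every \<open>T\<close> is scalar,
  because an eigenspace of \<open>T\<close> in it is again \<open>F\<close>-stable by commutativity.
  The minimal choice treats all of \<open>F\<close> at once, even if \<open>F\<close> is
  infinite.\<close>

lemma common_eigenvector:
  fixes scale :: "'k::alg_closed_field \<Rightarrow> 'v::ab_group_add \<Rightarrow> 'v"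
  assumes "vector_space scale"
    and N: "module.subspace scale N" "finite C" "N \<subseteq> module.span scale C"
    and v: "v \<in> N" "v \<noteq> 0"
    and F: "\<And>T. T \<in> F \<Longrightarrow> endo_on scale N T"
    and comm: "\<And>T T' w. T \<in> F \<Longrightarrow> T' \<in> F \<Longrightarrow> w \<in> N \<Longrightarrow> T (T' w) = T' (T w)"
  obtains w where "w \<in> N" "w \<noteq> 0" "\<And>T. T \<in> F \<Longrightarrow> \<exists>a. T w = scale a w"
proof -
  interpret vector_space scale by fact
  let ?\<A> = "{A. subspace A \<and> A \<subseteq> N \<and> A \<noteq> {0} \<and> (\<forall>T\<in>F. T ` A \<subseteq> A)}"
  have "N \<in> ?\<A>" using N F v endo_onD(3) by blast
  then have ne: "?\<A> \<noteq> {}" by blast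
  obtain A where A: "A \<in> ?\<A>" "\<And>A'. A' \<in> ?\<A> \<Longrightarrow> A' \<subseteq> A \<Longrightarrow> A' = A"
    using minimal_subspace[OF N(2) ne] N(3) by (smt (verit) mem_Collect_eq subset_trans)
  then have sA: "subspace A" "A \<subseteq> N" by auto
  obtain w where w: "w \<in> A" "w \<noteq> 0" using A(1) subspace_0 by blast
  have "\<exists>a. T w = scale a w" if T: "T \<in> F" for T
  proof -
    have eA: "endo_on scale A T"
      using F[OF T] A(1) T unfolding endo_on_def by (auto simp: subset_iff)
    obtain a u where u: "u \<in> A" "u \<noteq> 0" "T u = scale a u"
      by (rule exists_eigenvector[OF \<open>vector_space scale\<close> sA(1) N(2) order_trans[OF sA(2) N(3)] eA w])
    define A' where "A' = {x\<in>A. T x = scale a x}"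
    have "subspace A'"
      using sA(1) eA unfolding A'_def subspace_def endo_on_def
      by (auto simp: scale_right_distrib scale_left_commute)
        (metis scale_zero_left scale_zero_right)
    moreover have "T' x \<in> A'" if "T' \<in> F" "x \<in> A'" for T' x
    proof -
      have x: "x \<in> A" "x \<in> N" "T x = scale a x" using that sA by (auto simp: A'_def)
      then have "T (T' x) = scale a (T' x)"
        using comm[OF T that(1) x(2)] endo_onD(2)[OF F[OF that(1)] x(2)] by simp
      then show ?thesis using that x A(1) by (auto simp: A'_def)
    qed
    moreover have "u \<in> A'" using u by (simp add: A'_def)
    ultimately have "A' = A" using A(2)[of A'] u sA by (auto simp: A'_def)
    with w show ?thesis unfolding A'_def by blast
  qed
  then show thesis using that w sA by blast
qed

text \<open>
  A commuting family splits off the kernel and the image of \<open>T - a\<close>, which meet trivially by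
  semisimplicity.
\<close>

lemma span_common_eigenvectors:
  fixes scale :: "'k::alg_closed_field \<Rightarrow> 'v::ab_group_add \<Rightarrow> 'v"
  assumes "vector_space scale"
    and N: "finite C" "N \<subseteq> module.span scale C" "module.subspace scale N"
    and F: "\<And>T. T \<in> F \<Longrightarrow> endo_on scale N T"
    and comm: "\<And>T T' w. T \<in> F \<Longrightarrow> T' \<in> F \<Longrightarrow> w \<in> N \<Longrightarrow> T (T' w) = T' (T w)"
    and ss: "\<And>T a x y. T \<in> F \<Longrightarrow> x \<in> N \<Longrightarrow> T x = scale a x + y \<Longrightarrow> T y = scale a y \<Longrightarrow> y = 0"
  shows "N \<subseteq> module.span scale {w\<in>N. \<forall>T\<in>F. \<exists>a. T w = scale a w}"
proof -
  interpret vector_space scale by fact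
  let ?E = "{w\<in>N. \<forall>T\<in>F. \<exists>a. T w = scale a w}"
  let ?ok = "\<lambda>A. subspace A \<and> A \<subseteq> N \<and> (\<forall>T\<in>F. T ` A \<subseteq> A)"
  have "A \<subseteq> span ?E" if "?ok A" for A
    using that
  proof (induction "dim A" arbitrary: A rule: less_induct)
    case less
    then have A: "subspace A" "A \<subseteq> N" "\<And>T x. T \<in> F \<Longrightarrow> x \<in> A \<Longrightarrow> T x \<in> A" by blast+
    have eA: "endo_on scale A T" if "T \<in> F" for T
      using F[OF that] A that unfolding endo_on_def by (auto simp: subset_iff)
    show ?case
    proof (cases "\<forall>T\<in>F. \<exists>a. \<forall>x\<in>A. T x = scale a x")
      case True
      then have "A \<subseteq> ?E" using A(2) by blast
      then show ?thesis using span_superset by blast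
    next
      case False
      then obtain T where T: "T \<in> F" "\<And>a. \<exists>x\<in>A. T x \<noteq> scale a x" by blast
      obtain v where v: "v \<in> A" "v \<noteq> 0" using T(2)[of 0] endo_onD[OF eA[OF T(1)]]
        by (metis A(1) scale_zero_left subspace_0 scale_zero_right)
      obtain a u where u: "u \<in> A" "u \<noteq> 0" "T u = scale a u"
        by (rule exists_eigenvector[OF \<open>vector_space scale\<close> A(1) N(1) order_trans[OF A(2) N(2)] eA[OF T(1)] v])
      \<comment> \<open>\<open>D\<close> is T - a for an eigenvalue \<open>a\<close> of a member of
        \<open>F\<close> that is not scalar on \<open>A\<close>. So its kernel \<open>K\<close> and
        its image \<open>I\<close> are both proper, and the induction applies to them.\<close>
      define D where "D x = T x - scale a x" for x
      have D: "D (x + y) = D x + D y" "D (scale c x) = scale c (D x)" "D x \<in> A"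
        if "x \<in> A" "y \<in> A" for x y c
        using that endo_onD[OF eA[OF T(1)]] subspace_diff[OF A(1)] subspace_scale[OF A(1)]
        by (auto simp: D_def algebra_simps)
      define K where "K = {x\<in>A. D x = 0}"
      define I where "I = D ` A"
      have D_comm: "D (T' x) = T' (D x)" if "T' \<in> F" "x \<in> A" for T' x
      proof -
        have "T' (T x - scale a x) + T' (scale a x) = T' (T x)"
          using endo_onD(1)[OF eA[OF that(1)], of "T x - scale a x" "scale a x"] D(3) that
            subspace_scale[OF A(1)] by (simp add: D_def)
        then show ?thesis
          using endo_onD(2)[OF eA[OF that(1)] that(2)] comm[OF T(1) that(1)] that A(2)
          by (auto simp: D_def algebra_simps)
      qed
      have D0: "D 0 = 0" using D(2)[of 0 0 0] subspace_0[OF A(1)] by simp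
      have sK: "subspace K"
        unfolding K_def subspace_def using D D0 A(1) by (auto simp: subspace_def)
      have sDJ: "subspace (D ` J)" if J: "subspace J" "J \<subseteq> A" for J
        unfolding subspace_def
      proof (intro conjI ballI allI)
        show "0 \<in> D ` J" using D0 subspace_0[OF J(1)] by force
        fix x y c assume "x \<in> D ` J"
        then obtain x' where x': "x' \<in> J" "x = D x'" by blast
        show "scale c x \<in> D ` J"
          using x' D(2)[of x' x' c] subsetD[OF J(2)] subspace_scale[OF J(1)] by (metis imageI)
        assume "y \<in> D ` J"
        then obtain y' where y': "y' \<in> J" "y = D y'" by blast
        show "x + y \<in> D ` J"
          using x' y' D(1)[of x' y'] subsetD[OF J(2)] subspace_add[OF J(1)] by (metis imageI)
      qed
      have sI: "subspace I" unfolding I_def using sDJ[OF A(1)] by blast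
      have IA: "I \<subseteq> A" using D(3) by (auto simp: I_def)
      have inv: "\<forall>T'\<in>F. T' ` K \<subseteq> K" "\<forall>T'\<in>F. T' ` I \<subseteq> I"
        using D_comm A(3) D0
        by (auto simp: K_def I_def)
          (metis D0 D_comm endo_onD(2) eA scale_zero_left D(3) subspace_0[OF A(1)],
            metis D_comm image_eqI)
      \<comment> \<open>If x = D y and D x = 0, then y and x form a Jordan block of
        \<open>T\<close>, which \<open>ss\<close> forbids.\<close>
      have inj: "x = 0" if "x \<in> I" "D x = 0" for x
      proof -
        obtain y where y: "y \<in> A" "x = D y" using \<open>x \<in> I\<close> by (auto simp: I_def)
        then have "T y = scale a y + x" "T x = scale a x" using that by (auto simp: D_def)
        then show ?thesis using ss[OF T(1)] y A(2) by blast
      qed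
      have AC: "A \<subseteq> span C" using A N by blast
      have "K \<noteq> A" using T(2)[of a] by (auto simp: K_def D_def)
      then have "dim K < dim A"
        using subspace_eqI_dim[OF N(1) AC A(1) _ sK] by (force simp: K_def)
      moreover have "I \<noteq> A" using inj[of u] u by (auto simp: D_def)
      then have "dim I < dim A"
        using subspace_eqI_dim[OF N(1) AC A(1) IA sI] by force
      ultimately have *: "K \<subseteq> span ?E" "I \<subseteq> span ?E"
        using less(1)[of K] less(1)[of I] sK sI IA A(2) inv by (auto simp: K_def)
      \<comment> \<open>Being injective on the finite-dimensional \<open>I\<close>, \<open>D\<close>
        is onto \<open>I\<close>. Hence D x = D y for some y in \<open>I\<close>, and x = (x - y) +
        y splits x along \<open>K\<close> and \<open>I\<close>.\<close>
      have "D ` I = I"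
      proof (rule subspace_eqI_dim[OF N(1) _ sI])
        show "I \<subseteq> span C" using IA AC by blast
        show "D ` I \<subseteq> I" using IA D by (auto simp: I_def)
        obtain B where B: "finite B" "B \<subseteq> I" "independent B" "span B = I" "card B = dim I"
          using subspace_basis[OF N(1) _ sI] IA AC by blast
        have lin: "D (\<Sum>b\<in>B. scale (c b) b) = (\<Sum>b\<in>B. scale (c b) (D b))" for c
        proof -
          have "endo_on scale I D" using IA D by (auto simp: endo_on_def I_def)
          moreover have "scale (c b) b \<in> I" if "b \<in> B" for b
            using that B(2) subspace_scale[OF sI] by blast
          ultimately show ?thesis using B(2)
            by (subst endo_on_sum[OF _ sI]) (auto intro!: sum.cong endo_onD(2))
        qed
        have injB: "inj_on D I"
        proof (rule inj_onI)
          fix x y assume xy: "x \<in> I" "y \<in> I" "D x = D y"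
          then have "D (x - y) = 0"
            using D(1)[of "x - y" y] IA A(1) by (auto simp: subset_iff subspace_diff)
          then show "x = y" using inj[of "x - y"] xy sI by (auto simp: subspace_diff)
        qed
        have "independent (D ` B)"
        proof (rule independent_if_scalars_zero)
          fix f x assume f: "(\<Sum>x\<in>D ` B. scale (f x) x) = 0" and x: "x \<in> D ` B"
          have iB: "inj_on D B" using injB B(2) inj_on_subset by blast
          have "D (\<Sum>b\<in>B. scale (f (D b)) b) = 0"
            using f unfolding lin by (simp add: sum.reindex[OF iB])
          moreover have "(\<Sum>b\<in>B. scale (f (D b)) b) \<in> I"
            by (rule subspace_sum[OF sI], rule subspace_scale[OF sI]) (use B(2) in blast)
          ultimately have "(\<Sum>b\<in>B. scale (f (D b)) b) = 0" by (rule_tac inj)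
          then show "f x = 0" using B(1,3) x independentD[of B B "\<lambda>b. f (D b)"] by auto
        qed (use B in auto)
        moreover show "subspace (D ` I)" by (rule sDJ[OF sI IA])
        moreover have "card (D ` B) = dim I"
          using B card_image inj_on_subset[OF injB] by metis
        moreover have "D ` I \<subseteq> span C" using IA D AC by blast
        ultimately show "dim I \<le> dim (D ` I)"
        proof -
          assume iD: "independent (D ` B)" and "subspace (D ` I)"
            and c: "card (D ` B) = dim I" and "D ` I \<subseteq> span C"
          then obtain B' where "finite B'" "span B' = D ` I" "card B' = dim (D ` I)"
            using subspace_basis[OF N(1)] by metis
          then show ?thesis using independent_span_bound[of B' "D ` B"] iD B(2) c by auto
        qed
      qed
      then have "x \<in> span ?E" if x: "x \<in> A" for x
      proof -
        have "D x \<in> D ` I" using \<open>D ` I = I\<close> x by (auto simp: I_def)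
        then obtain y where y: "y \<in> I" "D x = D y" by auto
        then have "x - y \<in> K"
          using x IA D(1)[of "x - y" y] A(1) by (auto simp: K_def subset_iff subspace_diff)
        with * y have "(x - y) + y \<in> span ?E" by (intro span_add) auto
        then show ?thesis by simp
      qed
      then show ?thesis by blast
    qed
  qed
  from this[of N] show ?thesis using N F endo_onD(3) by blast
qed

section \<open>Current modules and the root decomposition\<close>

text \<open>Finite codimension: finitely many vectors span everything modulo \<open>U\<close>. In
  this form no quotient space appears and monotonicity in \<open>U\<close> is immediate.\<close>

definition cofinite_subspace :: "('k::field \<Rightarrow> 'a::ab_group_add \<Rightarrow> 'a) \<Rightarrow> 'a set \<Rightarrow> bool"
  where "cofinite_subspace scale U \<longleftrightarrow>
    (\<exists>F. finite F \<and> (\<forall>s. \<exists>t\<in>module.span scale F. s - t \<in> U))"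

text \<open>Passing from \<open>U\<close> to the kernel of \<open>f\<close> on it raises the
  codimension by at most dim f(U): the new representatives \<open>G\<close> are preimages of a basis
  of f(U).\<close>

lemma cofinite_subspace_ker:
  assumes "vector_space s1" "vector_space s2"
    and U: "module.subspace s1 U" "cofinite_subspace s1 U"
    and f: "\<And>x y. f (x + y) = f x + f y" "\<And>c x. f (s1 c x) = s2 c (f x)"
    and C: "finite C" "f ` U \<subseteq> module.span s2 C"
  shows "cofinite_subspace s1 {x\<in>U. f x = 0}"
proof -
  interpret vector_space_pair s1 s2 using assms by (simp add: vector_space_pair_def)
  have lin: "Vector_Spaces.linear s1 s2 f" using assms by (simp add: Vector_Spaces.linear_iff)
  have "vs2.subspace (f ` U)" by (rule linear_subspace_image[OF lin U(1)])
  then obtain D where D: "finite D" "D \<subseteq> f ` U" "vs2.span D = f ` U"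
    using vs2.subspace_basis[OF C] by metis
  then obtain G where G: "G \<subseteq> U" "finite G" "D = f ` G" using finite_subset_image by metis
  obtain F where F: "finite F" "\<And>s. \<exists>t\<in>vs1.span F. s - t \<in> U"
    using U(2) by (auto simp: cofinite_subspace_def)
  have "\<exists>t\<in>vs1.span (F \<union> G). s - t \<in> {x\<in>U. f x = 0}" for s
  proof -
    obtain t where t: "t \<in> vs1.span F" "s - t \<in> U" using F by blast
    then have "f (s - t) \<in> f ` vs1.span G"
      using D(3) linear_span_image[OF lin] by (auto simp: G(3))
    then obtain g where g: "g \<in> vs1.span G" "f (s - t) = f g" by blast
    have "g \<in> U" using g(1) G(1) U(1) vs1.span_minimal by blast
    then have "s - (t + g) \<in> U" "f (s - (t + g)) = 0"
      using t vs1.subspace_diff[OF U(1)] g linear_diff[OF lin]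
      by (metis diff_diff_eq, metis diff_diff_eq right_minus_eq)
    moreover have "t + g \<in> vs1.span (F \<union> G)"
      using t g vs1.span_mono[of F "F \<union> G"] vs1.span_mono[of G "F \<union> G"]
      by (intro vs1.span_add) auto
    ultimately show ?thesis by blast
  qed
  then show ?thesis using F G by (auto simp: cofinite_subspace_def intro!: exI[of _ "F \<union> G"])
qed

section \<open>Jordan chains and Heisenberg relations\<close>

context vector_space
begin

text \<open>Were T^n w nonzero, then w, T w, ..., T^n w would be n + 1 independent vectors inside
  the span of at most n: in a relation with lowest nonzero coefficient at j, applying T^(n - j)
  leaves a multiple of T^n w alone.\<close>

lemma nilpotent_chain:
  assumes T: "\<And>u v. T (u + v) = T u + T v" "\<And>c v. T (scale c v) = scale c (T v)"
    and C: "finite C" "card C \<le> n" "\<And>i. (T ^^ i) w \<in> span C" and z: "(T ^^ Suc n) w = 0"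
  shows "(T ^^ n) w = 0"
proof (rule ccontr)
  assume nz: "(T ^^ n) w \<noteq> 0"
  obtain c where c: "\<exists>i\<le>card C. c i \<noteq> 0" "(\<Sum>i\<le>card C. scale (c i) ((T ^^ i) w)) = 0"
    using dependent_sequence[OF C(1), of "\<lambda>i. (T ^^ i) w"] C(3) by blast
  define j where "j = (LEAST i. i \<le> card C \<and> c i \<noteq> 0)"
  have j: "j \<le> card C" "c j \<noteq> 0"
    using LeastI_ex[of "\<lambda>i. i \<le> card C \<and> c i \<noteq> 0"] c by (auto simp: j_def)
  have lt: "c i = 0" if "i < j" for i
    using not_less_Least[of i "\<lambda>i. i \<le> card C \<and> c i \<noteq> 0"] that j by (auto simp: j_def)
  have T0: "T 0 = 0" using T(2)[of 0 0] by simp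
  have add: "(T ^^ m) (u + v) = (T ^^ m) u + (T ^^ m) v" for m u v by (induction m) (auto simp: T)
  have sc: "(T ^^ m) (scale a v) = scale a ((T ^^ m) v)" for m a v by (induction m) (auto simp: T)
  have zz: "(T ^^ m) 0 = 0" for m by (induction m) (auto simp: T0)
  have sum: "(T ^^ m) (sum f I) = (\<Sum>i\<in>I. (T ^^ m) (f i))" for m f and I :: "nat set"
    by (induction I rule: infinite_finite_induct) (auto simp: add zz)
  have gt: "(T ^^ m) w = 0" if "n < m" for m
  proof -
    have "(T ^^ (m - Suc n + Suc n)) w = (T ^^ (m - Suc n)) ((T ^^ Suc n) w)"
      by (simp only: funpow_add o_apply)
    then show ?thesis using that unfolding z zz by simp
  qed
  have "0 = (T ^^ (n - j)) (\<Sum>i\<le>card C. scale (c i) ((T ^^ i) w))" by (simp only: c(2) zz)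
  also have "\<dots> = (\<Sum>i\<le>card C. scale (c i) ((T ^^ (n - j + i)) w))"
    by (simp add: sum sc funpow_add)
  also have "\<dots> = (\<Sum>i\<in>{j}. scale (c i) ((T ^^ (n - j + i)) w))"
  proof (rule sum.mono_neutral_right)
    show "\<forall>i\<in>{..card C} - {j}. scale (c i) ((T ^^ (n - j + i)) w) = 0"
    proof
      fix i assume "i \<in> {..card C} - {j}"
      then consider "i < j" | "n < n - j + i" using j C(2) by force
      then show "scale (c i) ((T ^^ (n - j + i)) w) = 0" by cases (simp_all add: lt gt)
    qed
  qed (use j in auto)
  finally show False using j nz C(2) by auto
qed

end

text \<open>\<open>D\<close> acts on powers of \<open>e\<close> like a b d/de, because
  \<open>b\<close> commutes with both and \<open>D\<close> kills \<open>v\<close>. The constant is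
  a^i (i + m)! / m!, which is nonzero in characteristic zero.\<close>

lemma heisenberg_power:
  fixes scale :: "'k::field_char_0 \<Rightarrow> 'v::ab_group_add \<Rightarrow> 'v"
  assumes "vector_space scale"
    and e: "\<And>u v. e (u + v) = e u + e v" "\<And>c v. e (scale c v) = scale c (e v)"
    and D: "\<And>u v. D (u + v) = D u + D v" "\<And>c v. D (scale c v) = scale c (D v)"
    and De: "\<And>w. D (e w) = e (D w) + scale a (b w)"
    and Db: "\<And>w. D (b w) = b (D w)" and eb: "\<And>w. e (b w) = b (e w)" and "b 0 = 0"
    and "D v = 0" "a \<noteq> 0"
  shows "\<exists>c. c \<noteq> 0 \<and> (D ^^ i) ((e ^^ (i + m)) v) = scale c ((e ^^ m) ((b ^^ i) v))"
proof -
  interpret vector_space scale by fact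
  have eb': "(e ^^ m) (b u) = b ((e ^^ m) u)" for u m by (induction m) (auto simp: eb)
  have D1: "D ((e ^^ Suc m) u) = scale (of_nat (Suc m) * a) ((e ^^ m) (b u))" if "D u = 0" for u m
  proof (induction m)
    case 0
    have "e 0 = 0" using e(2)[of 0 0] by simp
    then show ?case using that by (simp add: De)
  next
    case (Suc m)
    have "D ((e ^^ Suc (Suc m)) u) = e (D ((e ^^ Suc m) u)) + scale a (b ((e ^^ Suc m) u))"
      by (simp add: De)
    also have "\<dots> = scale (of_nat (Suc m) * a) ((e ^^ Suc m) (b u)) + scale a ((e ^^ Suc m) (b u))"
      unfolding Suc.IH e(2) by (simp add: eb' eb)
    finally show ?case by (simp only: scale_left_distrib[symmetric]) (simp add: algebra_simps)
  qed
  have Db0: "D ((b ^^ i) v) = 0" for i by (induction i) (auto simp: Db assms)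
  show ?thesis
  proof (induction i arbitrary: m)
    case 0
    show ?case by (intro exI[of _ 1]) simp
  next
    case (Suc i)
    obtain c where c: "c \<noteq> 0" "(D ^^ i) ((e ^^ (i + Suc m)) v) = scale c ((e ^^ Suc m) ((b ^^ i) v))"
      using Suc.IH by blast
    have "(D ^^ Suc i) ((e ^^ (Suc i + m)) v) = D ((D ^^ i) ((e ^^ (i + Suc m)) v))" by simp
    also have "\<dots> = scale (c * (of_nat (Suc m) * a)) ((e ^^ m) ((b ^^ Suc i) v))"
      unfolding c(2) D(2) D1[OF Db0] by simp
    finally show ?case using c(1) \<open>a \<noteq> 0\<close> of_nat_neq_0[where 'a='k, of m]
      by (intro exI[of _ "c * (of_nat (Suc m) * a)"]) (simp del: of_nat_Suc)
  qed
qed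

text \<open>A representation of \<gg> \<otimes> S given by its values on pure tensors:
  \<open>\<psi> x s\<close> is the action of x \<otimes> s. This keeps the cosets that model the
  tensor product out of the arguments until the isomorphism is built.\<close>

locale current_module =
  g: lie_algebra scg br + S: comm_algebra scS + V: vector_space scV
  for scg :: "'k::{alg_closed_field, field_char_0} \<Rightarrow> 'g::ab_group_add \<Rightarrow> 'g"
    and br :: "'g \<Rightarrow> 'g \<Rightarrow> 'g"
    and scS :: "'k \<Rightarrow> 's::{comm_ring, comm_monoid_mult} \<Rightarrow> 's"
    and scV :: "'k \<Rightarrow> 'v::ab_group_add \<Rightarrow> 'v" +
  fixes \<psi> :: "'g \<Rightarrow> 's \<Rightarrow> 'v \<Rightarrow> 'v"
  assumes psi_add_left: "\<psi> (x + y) s v = \<psi> x s v + \<psi> y s v"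
    and psi_add_right: "\<psi> x (s + t) v = \<psi> x s v + \<psi> x t v"
    and psi_scale_left: "\<psi> (scg c x) s v = scV c (\<psi> x s v)"
    and psi_scale_right: "\<psi> x (scS c s) v = scV c (\<psi> x s v)"
    and psi_add: "\<psi> x s (v + w) = \<psi> x s v + \<psi> x s w"
    and psi_scale: "\<psi> x s (scV c v) = scV c (\<psi> x s v)"
    and psi_br: "\<psi> (br x y) (s * t) v = \<psi> x s (\<psi> y t v) - \<psi> y t (\<psi> x s v)"
    and irred: "V.subspace U \<Longrightarrow> (\<And>x s u. u \<in> U \<Longrightarrow> \<psi> x s u \<in> U) \<Longrightarrow> U = {0} \<or> U = UNIV"
    and nontriv: "\<exists>v::'v. v \<noteq> 0"
    and simple: "lie_ideal scg br I \<Longrightarrow> I = {0} \<or> I = UNIV"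
    and nonabelian: "\<exists>x y. br x y \<noteq> 0"
    and fin_dim: "\<exists>X. finite X \<and> g.span X = UNIV"
begin

lemma br_add: "br (u + v) w = br u w + br v w" "br w (u + v) = br w u + br w v"
  and br_scale: "br (scg c u) w = scg c (br u w)" "br w (scg c u) = scg c (br w u)"
  using g.linear_bracket_left g.linear_bracket_right by (simp_all add: Vector_Spaces.linear_iff)

lemma br_0 [simp]: "br 0 x = 0" "br x 0 = 0"
  using br_scale[where c = 0 and u = 0 and w = x] by simp_all

lemma br_antisym: "br x y = - br y x"
proof -
  have "br (x + y) (x + y) = 0" by (rule g.bracket_self)
  then have "br x y + br y x = 0" unfolding br_add by (simp add: g.bracket_self add.commute)
  then show ?thesis by (simp only: eq_neg_iff_add_eq_0)
qed

lemma br_minus: "br (- x) y = - br x y" "br x (- y) = - br x y"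
  using br_scale[where c = "-1" and u = x and w = y] br_scale[where c = "-1" and u = y and w = x]
  by simp_all

lemma br_deriv: "br h (br x y) = br (br h x) y + br x (br h y)"
proof -
  have "br x (br y h) = - br x (br h y)" using br_antisym[of y h] by (simp add: br_minus)
  moreover have "br y (br h x) = - br (br h x) y" by (rule br_antisym)
  ultimately show ?thesis using g.jacobi[of h x y] by (simp add: algebra_simps)
qed

lemma psi_0 [simp]: "\<psi> x s 0 = 0" "\<psi> 0 s v = 0" "\<psi> x 0 v = 0"
  using psi_scale[of x s 0 0] psi_scale_left[of 0 0 s v] psi_scale_right[of x 0 0 v] by simp_all

lemma psi_minus: "\<psi> (- x) s v = - \<psi> x s v" "\<psi> x (- s) v = - \<psi> x s v" "\<psi> x s (- v) = - \<psi> x s v"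
  using psi_scale[of x s "-1" v] psi_scale_left[of "-1" x s v] psi_scale_right[of x "-1" s v]
  by simp_all

lemma psi_diff: "\<psi> (x - y) s v = \<psi> x s v - \<psi> y s v" "\<psi> x (s - t) v = \<psi> x s v - \<psi> x t v"
    "\<psi> x s (v - w) = \<psi> x s v - \<psi> x s w"
  using psi_add_left[of x "- y"] psi_add_right[of x s "- t"] psi_add[of x s v "- w"]
  by (simp_all add: psi_minus)

lemma psi_sum: "\<psi> x s (\<Sum>i\<in>I. f i) = (\<Sum>i\<in>I. \<psi> x s (f i))"
  by (induction I rule: infinite_finite_induct) (simp_all add: psi_add)

lemma psi_sum_right: "\<psi> x (\<Sum>i\<in>I. f i) v = (\<Sum>i\<in>I. \<psi> x (f i) v)"
  by (induction I rule: infinite_finite_induct) (simp_all add: psi_add_right)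

lemma psi_comm: "\<psi> x s (\<psi> y t v) = \<psi> y t (\<psi> x s v) + \<psi> (br x y) (s * t) v"
  by (simp add: psi_br)

lemma endo_psi: "(\<And>v. v \<in> N \<Longrightarrow> \<psi> x s v \<in> N) \<Longrightarrow> endo_on scV N (\<psi> x s)"
  by (auto simp: endo_on_def psi_add psi_scale)

lemma ideal_UNIV: "lie_ideal scg br I \<Longrightarrow> x \<in> I \<Longrightarrow> x \<noteq> 0 \<Longrightarrow> I = UNIV"
  using simple by blast

definition annih :: "'s set"
  where "annih = {s. \<forall>x v. \<psi> x s v = 0}"

lemma annih_psi: "s \<in> annih \<Longrightarrow> \<psi> x s v = 0"
  by (simp add: annih_def)

lemma annihI: "(\<And>x v. \<psi> x s v = 0) \<Longrightarrow> s \<in> annih"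
  by (simp add: annih_def)

text \<open>For s in \<open>annih\<close> and any t, the x with x \<otimes> ts acting by zero form
  an ideal of g. It contains all brackets, since [x, y] \<otimes> ts is the bracket of x \<otimes> t
  and y \<otimes> s, so by simplicity it is all of g.\<close>

lemma annih_ideal: "ring_ideal annih"
proof -
  have "t * s \<in> annih" if s: "s \<in> annih" for s t
  proof -
    let ?I = "{x. \<forall>v. \<psi> x (t * s) v = 0}"
    have b: "br x y \<in> ?I" for x y using s by (simp add: psi_br annih_psi)
    have "lie_ideal scg br ?I"
      using b by (auto simp: lie_ideal_def g.subspace_def psi_add_left psi_scale_left)
    moreover obtain x y where "br x y \<noteq> 0" using nonabelian by blast
    ultimately have "?I = UNIV" using ideal_UNIV b by blast
    then show ?thesis by (intro annihI) blast
  qed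
  then show ?thesis by (auto simp: ring_ideal_def annih_def psi_add_right)
qed

lemma annih_mult: "s \<in> annih \<Longrightarrow> t * s \<in> annih" "s \<in> annih \<Longrightarrow> s * t \<in> annih"
  using annih_ideal by (auto simp: ring_ideal_def mult.commute[of s])

lemma faithful:
  assumes "1 \<notin> annih" and "\<And>v. \<psi> x 1 v = 0"
  shows "x = 0"
proof (rule ccontr)
  assume "x \<noteq> 0"
  let ?I = "{x. \<forall>v. \<psi> x 1 v = 0}"
  have "\<psi> (br y z) 1 v = 0" if "z \<in> ?I" for y z v
    using psi_br[of y z 1 1 v] that by simp
  then have "lie_ideal scg br ?I"
    by (auto simp: lie_ideal_def g.subspace_def psi_add_left psi_scale_left)
  then have "?I = UNIV" using ideal_UNIV[of ?I x] \<open>x \<noteq> 0\<close> assms(2) by blast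
  then show False using assms(1) annihI[of 1] by blast
qed

end

text \<open>\<open>weights_semisimple\<close> excludes Jordan blocks of length two for h \<otimes>
  1, the form in which \<open>span_common_eigenvectors\<close> consumes diagonalizability. The
  single number \<open>B\<close> serves all weight spaces.\<close>

locale weight_current_module = current_module scg br scS scV \<psi>
  for scg :: "'k::{alg_closed_field, field_char_0} \<Rightarrow> 'g::ab_group_add \<Rightarrow> 'g"
    and br :: "'g \<Rightarrow> 'g \<Rightarrow> 'g"
    and scS :: "'k \<Rightarrow> 's::{comm_ring, comm_monoid_mult} \<Rightarrow> 's"
    and scV :: "'k \<Rightarrow> 'v::ab_group_add \<Rightarrow> 'v"
    and \<psi> :: "'g \<Rightarrow> 's \<Rightarrow> 'v \<Rightarrow> 'v" +
  fixes H :: "'g set" and B :: nat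
  assumes H_sub: "g.subspace H"
    and H_normalizer: "(\<And>y. y \<in> H \<Longrightarrow> br x y \<in> H) \<Longrightarrow> x \<in> H"
    and weights_span:
      "V.span (\<Union>\<mu>\<in>dual_space scg H. {v. \<forall>h\<in>H. \<psi> h 1 v = scV (\<mu> h) v}) = UNIV"
    and weights_semisimple:
      "h \<in> H \<Longrightarrow> \<psi> h 1 v = scV b v + w \<Longrightarrow> \<psi> h 1 w = scV b w \<Longrightarrow> w = 0"
    and weights_bounded: "\<mu> \<in> dual_space scg H \<Longrightarrow>
      \<exists>C. finite C \<and> card C \<le> B \<and> {v. \<forall>h\<in>H. \<psi> h 1 v = scV (\<mu> h) v} \<subseteq> V.span C"
begin

abbreviation dual :: "('g \<Rightarrow> 'k) set"
  where "dual \<equiv> dual_space scg H"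

definition wsp :: "('g \<Rightarrow> 'k) \<Rightarrow> 'v set"
  where "wsp \<mu> = {v. \<forall>h\<in>H. \<psi> h 1 v = scV (\<mu> h) v}"

definition rsp :: "('g \<Rightarrow> 'k) \<Rightarrow> 'g set"
  where "rsp \<alpha> = {x. \<forall>h\<in>H. br h x = scg (\<alpha> h) x}"

definition root_vectors :: "'g set"
  where "root_vectors = {x. \<exists>\<alpha>\<in>dual. x \<in> rsp \<alpha> \<and> (\<exists>h\<in>H. \<alpha> h \<noteq> 0)}"

lemma wspD: "v \<in> wsp \<mu> \<Longrightarrow> h \<in> H \<Longrightarrow> \<psi> h 1 v = scV (\<mu> h) v"
  by (simp add: wsp_def)

lemma rspD: "x \<in> rsp \<alpha> \<Longrightarrow> h \<in> H \<Longrightarrow> br h x = scg (\<alpha> h) x"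
  by (simp add: rsp_def)

lemma wsp_span: "V.span (\<Union>\<mu>\<in>dual. wsp \<mu>) = UNIV"
  using weights_span by (simp add: wsp_def)

lemma wsp_bounded:
  assumes "\<mu> \<in> dual" obtains C where "finite C" "card C \<le> B" "wsp \<mu> \<subseteq> V.span C"
  using weights_bounded[OF assms] that by (auto simp: wsp_def)

lemma subspace_wsp: "V.subspace (wsp \<mu>)"
  by (auto simp: V.subspace_def wsp_def psi_add psi_scale V.scale_right_distrib V.scale_left_commute)

lemma dual_add: "\<mu> \<in> dual \<Longrightarrow> \<alpha> \<in> dual \<Longrightarrow> (\<lambda>h. \<mu> h + \<alpha> h) \<in> dual"
  by (auto simp: dual_space_def algebra_simps)

lemma dual_of_nat_mult: "\<alpha> \<in> dual \<Longrightarrow> (\<lambda>h. of_nat n * \<alpha> h) \<in> dual"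
  by (auto simp: dual_space_def algebra_simps)

lemma psi_root: "x \<in> rsp \<alpha> \<Longrightarrow> v \<in> wsp \<mu> \<Longrightarrow> \<psi> x s v \<in> wsp (\<lambda>h. \<mu> h + \<alpha> h)"
  by (auto simp: wsp_def rsp_def psi_comm[of _ 1 x s] psi_scale psi_scale_left V.scale_left_distrib)

lemma psi_root_pow:
  assumes "x \<in> rsp \<alpha>" "v \<in> wsp \<mu>"
  shows "(\<psi> x s ^^ n) v \<in> wsp (\<lambda>h. \<mu> h + of_nat n * \<alpha> h)"
proof (induction n)
  case 0
  show ?case using assms by simp
next
  case (Suc n)
  show ?case using psi_root[OF assms(1) Suc, of s] by (simp add: algebra_simps)
qed

lemma exists_weight_vector: obtains \<mu> v where "\<mu> \<in> dual" "v \<in> wsp \<mu>" "v \<noteq> 0"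
proof -
  have "\<not> (\<Union>\<mu>\<in>dual. wsp \<mu>) \<subseteq> {0}"
  proof
    assume "(\<Union>\<mu>\<in>dual. wsp \<mu>) \<subseteq> {0}"
    from V.span_minimal[OF this V.subspace_single_0] have "UNIV \<subseteq> {0::'v}"
      unfolding wsp_span .
    then show False using nontriv by blast
  qed
  then show thesis using that by blast
qed

lemma psi_eq_0_on_weights:
  assumes "\<And>\<mu> v. \<mu> \<in> dual \<Longrightarrow> v \<in> wsp \<mu> \<Longrightarrow> \<psi> x s v = 0"
  shows "\<psi> x s v = 0"
proof -
  have "V.subspace {v. \<psi> x s v = 0}" by (auto simp: V.subspace_def psi_add psi_scale)
  then have "V.span (\<Union>\<mu>\<in>dual. wsp \<mu>) \<subseteq> {v. \<psi> x s v = 0}"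
    using assms by (intro V.span_minimal) auto
  then show ?thesis using wsp_span by auto
qed

section \<open>Root decomposition for a nontrivial action\<close>

context
  assumes nonzero: "1 \<notin> annih"
begin

lemma H_abelian:
  assumes "h \<in> H" "h' \<in> H" shows "br h h' = 0"
proof (rule faithful[OF nonzero])
  show "\<psi> (br h h') 1 v = 0" for v
  proof (rule psi_eq_0_on_weights)
    fix \<mu> v assume "v \<in> wsp \<mu>"
    then show "\<psi> (br h h') 1 v = 0"
      using psi_br[of h h' 1 1 v] assms by (simp add: wspD psi_scale V.scale_left_commute)
  qed
qed

lemma psi_H: "h \<in> H \<Longrightarrow> v \<in> wsp \<mu> \<Longrightarrow> \<psi> h s v \<in> wsp \<mu>"
  using psi_root[of h "\<lambda>_. 0" v \<mu> s] H_abelian by (auto simp: rsp_def)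

lemma psi_H_comm: "h \<in> H \<Longrightarrow> h' \<in> H \<Longrightarrow> \<psi> h s (\<psi> h' t v) = \<psi> h' t (\<psi> h s v)"
  by (simp add: psi_comm[of h] H_abelian)

lemma rsp_0: "x \<in> rsp \<alpha> \<Longrightarrow> (\<And>h. h \<in> H \<Longrightarrow> \<alpha> h = 0) \<Longrightarrow> x \<in> H"
  by (rule H_normalizer) (simp add: br_antisym[of x] rspD g.subspace_0[OF H_sub])

lemma rsp_br: "x \<in> rsp \<alpha> \<Longrightarrow> y \<in> rsp \<beta> \<Longrightarrow> br x y \<in> rsp (\<lambda>h. \<alpha> h + \<beta> h)"
  by (auto simp: rsp_def br_deriv[of _ x] br_scale g.scale_left_distrib)

text \<open>The operators ad h commute, and a Jordan block x, y of ad h in g transfers to V: on a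
  weight vector v, the vectors (x \<otimes> 1) v and (y \<otimes> 1) v would form one for h
  \<otimes> 1. So y \<otimes> 1 acts by zero, and y = 0 by \<open>faithful\<close>.\<close>

lemma rsp_span: "g.span (\<Union>\<alpha>\<in>dual. rsp \<alpha>) = UNIV"
proof -
  obtain X where X: "finite X" "g.span X = UNIV" using fin_dim by blast
  let ?F = "br ` H"
  have "UNIV \<subseteq> g.span {w\<in>UNIV. \<forall>T\<in>?F. \<exists>a. T w = scg a w}"
  proof (rule span_common_eigenvectors[OF g.vector_space_axioms X(1)])
    show "endo_on scg UNIV T" if "T \<in> ?F" for T
      using that by (auto simp: endo_on_def br_add br_scale)
    show "T (T' w) = T' (T w)" if "T \<in> ?F" "T' \<in> ?F" for T T' w
    proof -
      obtain h h' where "h \<in> H" "h' \<in> H" "T = br h" "T' = br h'" using \<open>T \<in> ?F\<close> \<open>T' \<in> ?F\<close> by blast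
      then show ?thesis using br_deriv[of h h' w] by (simp add: H_abelian)
    qed
    show "y = 0" if "T \<in> ?F" and x: "T x = scg a x + y" and y: "T y = scg a y" for T a x y
    proof -
      obtain h where h: "h \<in> H" "T = br h" using \<open>T \<in> ?F\<close> by blast
      show ?thesis
      proof (rule faithful[OF nonzero], rule psi_eq_0_on_weights)
        fix \<mu> v assume v: "v \<in> wsp \<mu>"
        have "\<psi> h 1 (\<psi> x 1 v) = scV (\<mu> h + a) (\<psi> x 1 v) + \<psi> y 1 v"
          using psi_comm[of h 1 x 1 v] x h v
          by (simp add: wspD psi_scale psi_add_left psi_scale_left V.scale_left_distrib)
        moreover have "\<psi> h 1 (\<psi> y 1 v) = scV (\<mu> h + a) (\<psi> y 1 v)"
          using psi_comm[of h 1 y 1 v] y h v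
          by (simp add: wspD psi_scale psi_scale_left V.scale_left_distrib)
        ultimately show "\<psi> y 1 v = 0" using weights_semisimple h(1) by blast
      qed
    qed
  qed (use X in \<open>auto simp: g.subspace_UNIV\<close>)
  moreover have "{w\<in>UNIV. \<forall>T\<in>?F. \<exists>a. T w = scg a w} \<subseteq> g.span (\<Union>\<alpha>\<in>dual. rsp \<alpha>)"
  proof
    fix w assume w: "w \<in> {w\<in>UNIV. \<forall>T\<in>?F. \<exists>a. T w = scg a w}"
    show "w \<in> g.span (\<Union>\<alpha>\<in>dual. rsp \<alpha>)"
    proof (cases "w = 0")
      case False
      obtain a where a: "\<And>h. h \<in> H \<Longrightarrow> br h w = scg (a h) w" using w by simp metis
      define \<alpha> where "\<alpha> h = (if h \<in> H then a h else 0)" for h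
      have "scg (a (h + h')) w = scg (a h + a h') w" if "h \<in> H" "h' \<in> H" for h h'
        using a[of "h + h'"] a that g.subspace_add[OF H_sub]
        by (simp add: br_add g.scale_left_distrib del: g.scale_cancel_right)
      moreover have "scg (a (scg c h)) w = scg (c * a h) w" if "h \<in> H" for h c
        using a[of "scg c h"] a[OF that] that g.subspace_scale[OF H_sub]
        by (simp add: br_scale del: g.scale_cancel_right)
      ultimately have "\<alpha> \<in> dual"
        using False g.subspace_add[OF H_sub] g.subspace_scale[OF H_sub]
        by (auto simp: dual_space_def \<alpha>_def)
      moreover have "w \<in> rsp \<alpha>" using a by (simp add: rsp_def \<alpha>_def)
      ultimately show ?thesis by (auto intro: g.span_base)
    qed (simp add: g.span_zero)
  qed
  ultimately show ?thesis using g.span_minimal[OF _ g.subspace_span] by blast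
qed

lemma rsp_cases: "x \<in> rsp \<alpha> \<Longrightarrow> \<alpha> \<in> dual \<Longrightarrow> x \<in> root_vectors \<or> x \<in> H"
  unfolding root_vectors_def using rsp_0 by blast

text \<open>The induction principle from root vectors to g. Root vectors and their pairwise brackets
  span an ideal, nonzero because otherwise g would equal the abelian h, hence everything. A bracket
  of two root vectors is a root vector or lies in \<open>H\<close>, so only the second kind has to
  be checked.\<close>

lemma root_vectors_generate:
  assumes Z: "g.subspace Z" "root_vectors \<subseteq> Z"
    and br: "\<And>x y. x \<in> root_vectors \<Longrightarrow> y \<in> root_vectors \<Longrightarrow> br x y \<in> H \<Longrightarrow> br x y \<in> Z"
  shows "Z = UNIV"
proof -
  let ?G = "root_vectors \<union> {br x y |x y. x \<in> root_vectors \<and> y \<in> root_vectors}"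
  let ?R = "g.span ?G"
  have base: "br z y \<in> ?R" if z: "z \<in> root_vectors \<or> z \<in> H" and y: "y \<in> ?G" for z y
    using y
  proof
    assume y: "y \<in> root_vectors"
    from z show ?thesis
    proof
      assume "z \<in> root_vectors"
      then show ?thesis using y by (intro g.span_base) blast
    next
      assume "z \<in> H"
      moreover obtain \<gamma> where "y \<in> rsp \<gamma>" using y by (auto simp: root_vectors_def)
      ultimately have "br z y = scg (\<gamma> z) y" by (simp add: rspD)
      then show ?thesis using y by (auto intro!: g.span_scale intro: g.span_base)
    qed
  next
    assume "y \<in> {br x y |x y. x \<in> root_vectors \<and> y \<in> root_vectors}"
    then obtain a b where ab: "y = br a b" "a \<in> root_vectors" "b \<in> root_vectors" by blast
    then obtain \<alpha> \<beta> where *: "\<alpha> \<in> dual" "a \<in> rsp \<alpha>" "\<beta> \<in> dual" "b \<in> rsp \<beta>"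
      by (auto simp: root_vectors_def)
    have y: "y \<in> rsp (\<lambda>h. \<alpha> h + \<beta> h)" using rsp_br * ab by blast
    have yG: "y \<in> ?R" using ab by (intro g.span_base) blast
    from z show ?thesis
    proof
      assume "z \<in> H"
      then show ?thesis using rspD[OF y] yG by (simp add: g.span_scale)
    next
      assume z: "z \<in> root_vectors"
      from rsp_cases[OF y dual_add[OF *(1,3)]] show ?thesis
      proof
        assume "y \<in> root_vectors"
        then show ?thesis using z by (intro g.span_base) blast
      next
        assume "y \<in> H"
        moreover obtain \<gamma> where "z \<in> rsp \<gamma>" using z by (auto simp: root_vectors_def)
        ultimately have "br z y = - scg (\<gamma> y) z" by (simp add: br_antisym[of z] rspD)
        then show ?thesis using z by (auto intro!: g.span_neg g.span_scale intro: g.span_base)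
      qed
    qed
  qed
  have "br z y \<in> ?R" if "y \<in> ?R" for z y
  proof -
    have "br z y \<in> ?R" if z: "z \<in> root_vectors \<or> z \<in> H" for z
    proof -
      have "g.subspace {y. br z y \<in> ?R}"
        by (auto simp: g.subspace_def br_add br_scale intro: g.span_add g.span_scale g.span_zero)
      then show ?thesis
        using g.span_minimal[of ?G "{y. br z y \<in> ?R}"] base[OF z] \<open>y \<in> ?R\<close> by blast
    qed
    moreover have "g.subspace {z. br z y \<in> ?R}"
      by (auto simp: g.subspace_def br_add br_scale intro: g.span_add g.span_scale g.span_zero)
    ultimately have "g.span (\<Union>\<alpha>\<in>dual. rsp \<alpha>) \<subseteq> {z. br z y \<in> ?R}"
      using rsp_cases by (intro g.span_minimal) blast+
    then show ?thesis using rsp_span by blast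
  qed
  then have "lie_ideal scg br ?R" by (simp add: lie_ideal_def)
  moreover have "?R \<noteq> {0}"
  proof
    assume "?R = {0}"
    then have "root_vectors \<subseteq> {0}"
      using g.span_superset[of ?G] by (simp only: le_sup_iff)
    then have "root_vectors \<subseteq> H"
      using g.subspace_0[OF H_sub] by auto
    then have "(\<Union>\<alpha>\<in>dual. rsp \<alpha>) \<subseteq> H" using rsp_cases by blast
    from g.span_minimal[OF this H_sub] have "UNIV \<subseteq> H" unfolding rsp_span .
    then have "br x y = 0" for x y using H_abelian[of x y] by (simp add: subset_iff)
    then show False using nonabelian by blast
  qed
  ultimately have "?R = UNIV" using simple by blast
  moreover have "?G \<subseteq> Z"
  proof -
    have "br x y \<in> Z" if xy: "x \<in> root_vectors" "y \<in> root_vectors" for x y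
    proof -
      obtain \<alpha> \<beta> where *: "\<alpha> \<in> dual" "x \<in> rsp \<alpha>" "\<beta> \<in> dual" "y \<in> rsp \<beta>"
        using xy by (auto simp: root_vectors_def)
      show ?thesis using rsp_cases[OF rsp_br[OF *(2,4)] dual_add[OF *(1,3)]] br xy Z(2) by blast
    qed
    then show ?thesis using Z(2) by blast
  qed
  ultimately show ?thesis using g.span_minimal[OF _ Z(1)] by blast
qed

end

end

section \<open>The annihilator is a radical ideal of finite codimension\<close>

lemma cofinite_subspace_mono: "cofinite_subspace scale U \<Longrightarrow> U \<subseteq> U' \<Longrightarrow> cofinite_subspace scale U'"
  unfolding cofinite_subspace_def by (meson subsetD)

context current_module
begin

text \<open>The vectors killed by g \<otimes> J form a submodule, since
  [x \<otimes> s, y \<otimes> t] lies in g \<otimes> J again for s in \<open>J\<close>. One nonzero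
  such vector therefore gives all of V.\<close>

lemma subset_annih:
  assumes J: "\<And>s t. s \<in> J \<Longrightarrow> s * t \<in> J" and v: "v \<noteq> 0" "\<And>x s. s \<in> J \<Longrightarrow> \<psi> x s v = 0"
  shows "J \<subseteq> annih"
proof -
  let ?U = "{v. \<forall>x. \<forall>s\<in>J. \<psi> x s v = 0}"
  have "V.subspace ?U" by (auto simp: V.subspace_def psi_add psi_scale)
  moreover have "\<psi> y t u \<in> ?U" if "u \<in> ?U" for y t u
    using that J by (auto simp: psi_comm[of _ _ y])
  ultimately have "?U = {0} \<or> ?U = UNIV" by (rule irred)
  then have "?U = UNIV" using v by blast
  then show ?thesis by (auto simp: annih_def)
qed

end

context weight_current_module
begin

lemma root_vectors_basis:
  obtains X where "finite X" "X \<subseteq> root_vectors" "root_vectors \<subseteq> g.span X"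
proof -
  obtain X where X: "X \<subseteq> root_vectors" "g.independent X" "root_vectors \<subseteq> g.span X"
    using g.maximal_independent_subset by blast
  obtain Y where "finite Y" "g.span Y = UNIV" using fin_dim by blast
  then have "finite X" using g.independent_span_bound[of Y X] X(2) by simp
  then show thesis using that X by blast
qed

lemma psi_span_eq_0:
  assumes "x \<in> g.span X" "\<And>y. y \<in> X \<Longrightarrow> \<psi> y s v = 0"
  shows "\<psi> x s v = 0"
proof -
  have "g.subspace {x. \<psi> x s v = 0}"
    by (auto simp: g.subspace_def psi_add_left psi_scale_left)
  then show ?thesis using g.span_minimal[of X "{x. \<psi> x s v = 0}"] assms by blast
qed

text \<open>That \<open>I\<close> is an ideal comes from [h \<otimes> t, x \<otimes> s] =
  \<alpha>(h) x \<otimes> ts with \<alpha>(h) nonzero. For s and t in \<open>I\<close> both x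
  \<otimes> s and y \<otimes> t kill the weight space, hence so does [x, y] \<otimes> st, and
  \<open>root_vectors_generate\<close> extends this to all of g.\<close>

lemma exists_cofinite_ideal:
  assumes nonzero: "1 \<notin> annih"
  obtains I where "cofinite_subspace scS I" "\<And>s t. s \<in> I \<Longrightarrow> t \<in> I \<Longrightarrow> s * t \<in> annih"
proof -
  obtain \<mu> v0 where \<mu>: "\<mu> \<in> dual" "v0 \<in> wsp \<mu>" "v0 \<noteq> 0" by (rule exists_weight_vector)
  define I where "I = {s. \<forall>x\<in>root_vectors. \<forall>v\<in>wsp \<mu>. \<psi> x s v = 0}"
  have ideal: "t * s \<in> I" if s: "s \<in> I" for s t
    unfolding I_def
  proof (intro CollectI ballI)
    fix x v assume x: "x \<in> root_vectors" and v: "v \<in> wsp \<mu>"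
    obtain \<alpha> h where \<alpha>: "x \<in> rsp \<alpha>" "h \<in> H" "\<alpha> h \<noteq> 0" using x by (auto simp: root_vectors_def)
    have "\<psi> h t v \<in> wsp \<mu>" using psi_H nonzero \<alpha>(2) v by blast
    then have "\<psi> x s (\<psi> h t v) = 0" "\<psi> x s v = 0" using s x v by (auto simp: I_def)
    then have "scV (\<alpha> h) (\<psi> x (t * s) v) = 0"
      using psi_comm[of h t x s v] rspD[OF \<alpha>(1,2)] by (simp add: psi_scale_left)
    then show "\<psi> x (t * s) v = 0" using \<alpha>(3) by simp
  qed
  have "cofinite_subspace scS I"
  proof -
    obtain X where X: "finite X" "X \<subseteq> root_vectors" "root_vectors \<subseteq> g.span X"
      by (rule root_vectors_basis)
    obtain C where C: "finite C" "C \<subseteq> wsp \<mu>" "V.span C = wsp \<mu>"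
      using wsp_bounded[OF \<mu>(1)] V.subspace_basis subspace_wsp by metis
    \<comment> \<open>One pair at a time: the values (x \<otimes> s) v, for varying s, lie in a
      single finite-dimensional weight space, so each pair cuts out a kernel of finite
      codimension.\<close>
    have "cofinite_subspace scS {s. \<forall>(x, v)\<in>Z. \<psi> x s v = 0}" if "finite Z" "Z \<subseteq> X \<times> C" for Z
      using that
    proof (induction Z rule: finite_induct)
      case empty
      then show ?case by (auto simp: cofinite_subspace_def intro!: exI[of _ "{}"])
    next
      case (insert p Z)
      obtain x v where p: "p = (x, v)" by fastforce
      let ?U = "{s. \<forall>(x, v)\<in>Z. \<psi> x s v = 0}"
      have "S.subspace ?U"
        unfolding S.subspace_def by (fastforce simp: psi_add_right psi_scale_right)
      moreover have "x \<in> root_vectors" "v \<in> wsp \<mu>" using insert.prems p X C by auto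
      then obtain \<alpha> where \<alpha>: "\<alpha> \<in> dual" "x \<in> rsp \<alpha>" by (auto simp: root_vectors_def)
      obtain C' where C': "finite C'" "wsp (\<lambda>h. \<mu> h + \<alpha> h) \<subseteq> V.span C'"
        using wsp_bounded[OF dual_add[OF \<mu>(1) \<alpha>(1)]] by metis
      have "(\<lambda>s. \<psi> x s v) ` ?U \<subseteq> V.span C'"
        using psi_root[OF \<alpha>(2) \<open>v \<in> wsp \<mu>\<close>] C'(2) by blast
      ultimately have "cofinite_subspace scS {s\<in>?U. \<psi> x s v = 0}"
        using insert C'(1)
        by (intro cofinite_subspace_ker[OF S.vector_space_axioms V.vector_space_axioms])
          (auto simp: psi_add_right psi_scale_right)
      moreover have "{s\<in>?U. \<psi> x s v = 0} = {s. \<forall>(x, v)\<in>insert p Z. \<psi> x s v = 0}"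
        by (auto simp: p)
      ultimately show ?case by simp
    qed
    from this[OF finite_cartesian_product[OF X(1) C(1)] order_refl]
    have "cofinite_subspace scS {s. \<forall>(x, v)\<in>X \<times> C. \<psi> x s v = 0}" .
    moreover have "{s. \<forall>(x, v)\<in>X \<times> C. \<psi> x s v = 0} \<subseteq> I"
      unfolding I_def
    proof (intro subsetI CollectI ballI)
      fix s x v
      assume s: "s \<in> {s. \<forall>(x, v)\<in>X \<times> C. \<psi> x s v = 0}" and x: "x \<in> root_vectors" and v: "v \<in> wsp \<mu>"
      have "V.subspace {v. \<psi> x s v = 0}" by (auto simp: V.subspace_def psi_add psi_scale)
      moreover have "\<psi> x s c = 0" if "c \<in> C" for c
        using psi_span_eq_0[of x X s c] X x s that by blast
      ultimately have "V.span C \<subseteq> {v. \<psi> x s v = 0}" by (intro V.span_minimal) auto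
      then show "\<psi> x s v = 0" using C v by blast
    qed
    ultimately show ?thesis by (rule cofinite_subspace_mono)
  qed
  moreover have "s * t \<in> annih" if st: "s \<in> I" "t \<in> I" for s t
  proof -
    have "range (\<lambda>u. u * (s * t)) \<subseteq> annih"
    proof (rule subset_annih)
      show "v0 \<noteq> 0" by fact
      fix x r assume "r \<in> range (\<lambda>u. u * (s * t))"
      then obtain u where "r = u * (s * t)" by blast
      moreover have "u * s \<in> I" using ideal st by blast
      ultimately obtain s' where s': "s' \<in> I" "r = s' * t" by (metis mult.assoc)
      let ?Z = "{y. \<forall>v\<in>wsp \<mu>. \<psi> y (s' * t) v = 0}"
      have "?Z = UNIV"
      proof (rule root_vectors_generate[OF nonzero])
        show "g.subspace ?Z" by (auto simp: g.subspace_def psi_add_left psi_scale_left)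
        show "root_vectors \<subseteq> ?Z" using ideal[OF st(2), of s'] by (auto simp: I_def)
        fix x y assume xy: "x \<in> root_vectors" "y \<in> root_vectors" "br x y \<in> H"
        have "\<psi> x s' (\<psi> y t v) = 0" "\<psi> y t (\<psi> x s' v) = 0" if "v \<in> wsp \<mu>" for v
          using xy s' st that by (auto simp: I_def)
        then show "br x y \<in> ?Z" by (simp add: psi_br)
      qed
      then show "\<psi> x r v0 = 0" using \<mu>(2) s'(2) by blast
    next
      fix r u assume "r \<in> range (\<lambda>u. u * (s * t))"
      then obtain w where "r = w * (s * t)" by blast
      then have "r * u = (w * u) * (s * t)" by (simp add: ac_simps)
      then show "r * u \<in> range (\<lambda>u. u * (s * t))" by (rule range_eqI)
    qed
    then show ?thesis using rangeI[of "\<lambda>u. u * (s * t)" 1] by auto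
  qed
  ultimately show thesis using that by blast
qed

section \<open>Boundedness of multiplicities makes the annihilator radical\<close>

text \<open>
  With \<open>D = h \<otimes> st - c\<close>, the vector \<open>D\<^sup>B (x \<otimes> 1)\<^sup>B v\<close> is a nonzero multiple of \<open>(x \<otimes> st)\<^sup>B v\<close>, and
  a chain of \<open>B + 1\<close> vectors does not fit into a weight space of dimension at most \<open>B\<close>.
\<close>

lemma psi_root_nilpotent:
  assumes nonzero: "1 \<notin> annih" and s: "s * s \<in> annih"
    and x: "x \<in> rsp \<alpha>" "\<alpha> \<in> dual" and h: "h \<in> H" "\<alpha> h \<noteq> 0"
    and v: "v \<in> wsp \<mu>" "\<mu> \<in> dual" "\<psi> h (s * t) v = scV c v"
  shows "(\<psi> x (s * t) ^^ B) v = 0"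
proof -
  define D where "D w = \<psi> h (s * t) w - scV c w" for w
  have comm: "\<psi> y (s * t) (\<psi> z (s * t) w) = \<psi> z (s * t) (\<psi> y (s * t) w)" for y z w
  proof -
    have "s * t * (s * t) = s * s * (t * t)" by (simp add: ac_simps)
    then have "s * t * (s * t) \<in> annih" using annih_mult(2)[OF s] by simp
    then show ?thesis by (simp add: psi_comm[of y] annih_psi)
  qed
  have D: "D (u + w) = D u + D w" "D (scV a u) = scV a (D u)" for u w a
    by (simp_all add: D_def psi_add psi_scale algebra_simps V.scale_right_diff_distrib
        V.scale_right_distrib V.scale_left_commute)
  have Dv: "D v = 0" using v by (simp add: D_def)
  have De: "D (\<psi> x 1 w) = \<psi> x 1 (D w) + scV (\<alpha> h) (\<psi> x (s * t) w)" for w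
    using psi_comm[of h "s * t" x 1 w] rspD[OF x(1) h(1)]
    by (simp add: D_def psi_diff psi_scale psi_scale_left)
  have Db: "D (\<psi> x (s * t) w) = \<psi> x (s * t) (D w)" for w
    by (simp add: D_def psi_diff psi_scale comm[of h])
  have eb: "\<psi> x 1 (\<psi> x (s * t) w) = \<psi> x (s * t) (\<psi> x 1 w)" for w
    by (simp add: psi_comm[of x 1] g.bracket_self)
  let ?w = "(\<psi> x 1 ^^ B) v"
  obtain c' where c': "c' \<noteq> 0" "(D ^^ B) ?w = scV c' ((\<psi> x (s * t) ^^ B) v)"
    using heisenberg_power[of scV "\<psi> x 1" D "\<alpha> h" "\<psi> x (s * t)" v B 0] V.vector_space_axioms
      D De Db eb Dv h(2) by (auto simp: psi_add psi_scale)
  have "D ((\<psi> x (s * t) ^^ n) v) = 0" for n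
    by (induction n) (simp_all add: Dv Db)
  then have z: "(D ^^ Suc B) ?w = 0" by (simp add: c'(2) D)
  have "(D ^^ B) ?w = 0"
  proof -
    let ?\<nu> = "\<lambda>h. \<mu> h + of_nat B * \<alpha> h"
    have "(D ^^ i) ?w \<in> wsp ?\<nu>" for i
    proof (induction i)
      case 0
      then show ?case using psi_root_pow[OF x(1) v(1)] by simp
    next
      case (Suc i)
      then show ?case using psi_H[OF nonzero h(1) Suc.IH, of "s * t"]
        by (simp add: D_def subspace_wsp V.subspace_diff V.subspace_scale)
    qed
    moreover obtain C where "finite C" "card C \<le> B" "wsp ?\<nu> \<subseteq> V.span C"
      using wsp_bounded dual_add[OF v(2) dual_of_nat_mult[OF x(2)]] by metis
    ultimately show ?thesis using V.nilpotent_chain[of D C B ?w] D z by blast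
  qed
  then show ?thesis using c' by simp
qed

text \<open>
  The abelian ideal \<open>\<gg> \<otimes> Ss\<close> acts by commuting operators.  On a common eigenvector of \<open>\<hh> \<otimes> Ss\<close> its root
  vectors are nilpotent by boundedness, so some vector is killed by all of them; the same
  nilpotency makes the eigenvalues of \<open>\<hh> \<otimes> Ss\<close> there vanish.
\<close>

lemma annih_radical_nontrivial:
  assumes nonzero: "1 \<notin> annih" and s: "s * s \<in> annih"
  shows "s \<in> annih"
proof -
  let ?a = "\<lambda>x t. \<psi> x (s * t)"
  have comm: "?a y t (?a z t' w) = ?a z t' (?a y t w)" for y z w t t'
  proof -
    have "s * t * (s * t') = s * s * (t * t')" by (simp add: ac_simps)
    then have "s * t * (s * t') \<in> annih" using annih_mult(2)[OF s] by simp
    then show ?thesis by (simp add: psi_comm[of y] annih_psi)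
  qed
  obtain \<mu> v0 where \<mu>: "\<mu> \<in> dual" "v0 \<in> wsp \<mu>" "v0 \<noteq> 0" by (rule exists_weight_vector)
  obtain C where C: "finite C" "wsp \<mu> \<subseteq> V.span C" using wsp_bounded[OF \<mu>(1)] by metis
  let ?F = "{?a h t |h t. h \<in> H}"
  obtain v where v: "v \<in> wsp \<mu>" "v \<noteq> 0" "\<And>T. T \<in> ?F \<Longrightarrow> \<exists>a. T v = scV a v"
  proof (rule common_eigenvector[OF V.vector_space_axioms subspace_wsp C \<mu>(2,3)])
    show "endo_on scV (wsp \<mu>) T" if "T \<in> ?F" for T
      using that psi_H[OF nonzero] by (auto intro!: endo_psi)
    show "T (T' w) = T' (T w)" if "T \<in> ?F" "T' \<in> ?F" for T T' w
      using that comm by auto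
  qed (rule that; blast)
  then have "\<forall>h t. \<exists>a. h \<in> H \<longrightarrow> ?a h t v = scV a v" by blast
  then obtain \<Lambda> where \<Lambda>: "\<And>h t. h \<in> H \<Longrightarrow> ?a h t v = scV (\<Lambda> h t) v" by metis
  define good where "good w \<longleftrightarrow> w \<noteq> 0 \<and> (\<exists>\<nu>\<in>dual. w \<in> wsp \<nu>) \<and>
    (\<forall>h\<in>H. \<forall>t. ?a h t w = scV (\<Lambda> h t) w)" for w
  have nil: "(?a x t ^^ B) w = 0"
    if "x \<in> root_vectors" "(\<exists>\<nu>\<in>dual. w \<in> wsp \<nu>)" "(\<forall>h\<in>H. \<forall>t. ?a h t w = scV (\<Lambda> h t) w)" for x t w
    using psi_root_nilpotent[OF nonzero s] that unfolding root_vectors_def by blast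
  \<comment> \<open>\<open>A\<close> is to be a product of operators from g \<otimes> Ss, recorded
    by its relevant properties: linear, commuting with that ideal, A v still a nonzero weight vector
    with the eigenvalues of \<open>v\<close>, and A v killed by the pairs in
    \<open>Z\<close>.\<close>
  define R where "R Z A \<longleftrightarrow> (\<forall>x t w. A (?a x t w) = ?a x t (A w)) \<and>
     (\<forall>u w. A (u + w) = A u + A w) \<and> (\<forall>c w. A (scV c w) = scV c (A w)) \<and> good (A v) \<and>
     (\<forall>(x, t)\<in>Z. ?a x t (A v) = 0)" for Z and A :: "'v \<Rightarrow> 'v"
  have ex: "\<exists>A. R Z A" if "finite Z" "Z \<subseteq> root_vectors \<times> UNIV" for Z
    using that
  proof (induction Z rule: finite_induct)
    case empty
    have "R {} (\<lambda>w. w)" using v \<mu> \<Lambda> by (auto simp: R_def good_def)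
    then show ?case by blast
  next
    case (insert p Z)
    obtain x t where p: "p = (x, t)" by fastforce
    then have x: "x \<in> root_vectors" using insert by auto
    then obtain \<alpha> where \<alpha>: "\<alpha> \<in> dual" "x \<in> rsp \<alpha>" by (auto simp: root_vectors_def)
    obtain A where A: "R Z A" using insert by auto
    then have gA: "good (A v)" by (simp add: R_def)
    let ?b = "?a x t"
    have "(?b ^^ B) (A v) = 0" using nil[OF x] gA by (auto simp: good_def)
    \<comment> \<open>The highest power of \<open>?b\<close> that does not kill A v is multiplied
      onto \<open>A\<close>; one more application then gives zero.\<close>
    then obtain m where m: "(?b ^^ Suc m) (A v) = 0" "(?b ^^ m) (A v) \<noteq> 0"
      using gA ex_least_nat_less[of "\<lambda>n. (?b ^^ n) (A v) = 0" B]
      unfolding good_def funpow_0 by blast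
    let ?A = "\<lambda>w. (?b ^^ m) (A w)"
    have pc: "(?b ^^ n) (?a y t' w) = ?a y t' ((?b ^^ n) w)" for n y t' w
      by (induction n) (simp_all add: comm[of x t])
    have pl: "(?b ^^ n) (u + w) = (?b ^^ n) u + (?b ^^ n) w"
      "(?b ^^ n) (scV c w) = scV c ((?b ^^ n) w)" "(?b ^^ n) 0 = 0" for n u w c
      by (induction n) (simp_all add: psi_add psi_scale)
    have "good (?A v)"
      unfolding good_def
    proof (intro conjI)
      obtain \<nu> where "\<nu> \<in> dual" "A v \<in> wsp \<nu>" using gA by (auto simp: good_def)
      then show "\<exists>\<nu>\<in>dual. ?A v \<in> wsp \<nu>"
        using psi_root_pow[OF \<alpha>(2)] dual_add[OF _ dual_of_nat_mult[OF \<alpha>(1)]] by blast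
      show "\<forall>h\<in>H. \<forall>t. ?a h t (?A v) = scV (\<Lambda> h t) (?A v)"
        using gA unfolding good_def by (metis pc pl(2))
    qed (rule m)
    moreover have "?a y t' (?A v) = 0" if "(y, t') \<in> insert p Z" for y t'
    proof (cases "(y, t') = p")
      case True
      then show ?thesis using m(1) p by simp
    next
      case False
      then have "?a y t' (A v) = 0" using that A by (auto simp: R_def)
      then show ?thesis using pc[of m y t' "A v"] pl(3) by simp
    qed
    ultimately have "R (insert p Z) ?A"
      using A unfolding R_def by (auto simp: pc pl)
    then show ?case by blast
  qed
  obtain X where X: "finite X" "X \<subseteq> root_vectors" "root_vectors \<subseteq> g.span X"
    by (rule root_vectors_basis)
  have "\<forall>x\<in>X. \<exists>C. finite C \<and> (\<forall>t. ?a x t v \<in> V.span C)"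
  proof
    fix x assume "x \<in> X"
    then obtain \<alpha> where \<alpha>: "\<alpha> \<in> dual" "x \<in> rsp \<alpha>" using X by (auto simp: root_vectors_def)
    then obtain C where "finite C" "wsp (\<lambda>h. \<mu> h + \<alpha> h) \<subseteq> V.span C"
      using wsp_bounded[OF dual_add[OF \<mu>(1)]] by metis
    then show "\<exists>C. finite C \<and> (\<forall>t. ?a x t v \<in> V.span C)"
      using psi_root[OF \<alpha>(2) v(1)] by blast
  qed
  then obtain C' where C': "\<And>x. x \<in> X \<Longrightarrow> finite (C' x)" "\<And>x t. x \<in> X \<Longrightarrow> ?a x t v \<in> V.span (C' x)"
    by metis
  \<comment> \<open>Infinitely many t occur, but the vectors (x \<otimes> st) v with x in
    \<open>X\<close> lie in finitely many weight spaces. It suffices that \<open>A\<close> kills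
    finitely many of them that span the rest, because (x \<otimes> st) (A v) = A ((x \<otimes> st)
    v).\<close>
  let ?G = "(\<lambda>(x, t). ?a x t v) ` (X \<times> UNIV)"
  have "?a x t v \<in> V.span (\<Union>x\<in>X. C' x)" if "x \<in> X" for x t
    using C'(2)[OF that] V.span_mono[of "C' x" "\<Union>x\<in>X. C' x"] that by blast
  then have G: "?G \<subseteq> V.span (\<Union>x\<in>X. C' x)" by auto
  obtain D where D: "D \<subseteq> ?G" "V.independent D" "?G \<subseteq> V.span D"
    using V.maximal_independent_subset by blast
  have "finite (\<Union>x\<in>X. C' x)" using X(1) C'(1) by blast
  then have "finite D"
    using V.independent_span_bound[OF _ D(2) subset_trans[OF D(1) G]] by blast
  then obtain Z where Z: "finite Z" "Z \<subseteq> X \<times> UNIV" "D = (\<lambda>(x, t). ?a x t v) ` Z"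
    using finite_subset_image[OF _ D(1)] by blast
  have "Z \<subseteq> root_vectors \<times> UNIV" using Z(2) X(2) by blast
  then obtain A where A: "R Z A" using ex[OF Z(1)] by blast
  define w where "w = A v"
  have kill: "?a x t w = 0" if "x \<in> root_vectors" for x t
  proof -
    have "A ` V.span D \<subseteq> {0}"
    proof -
      have "V.subspace {u. A u = 0}"
      proof -
        have "A 0 = 0" using A unfolding R_def by (metis V.scale_zero_left)
        then show ?thesis using A by (auto simp: V.subspace_def R_def)
      qed
      moreover have "D \<subseteq> {u. A u = 0}" using A Z(3) unfolding R_def by auto
      ultimately show ?thesis using V.span_minimal by blast
    qed
    moreover have "?a y t v \<in> V.span D" if "y \<in> X" for y using D(3) that by blast
    moreover have "?a y t w = A (?a y t v)" for y using A by (simp add: R_def w_def)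
    ultimately have "?a y t w = 0" if "y \<in> X" for y using that by blast
    then show ?thesis using psi_span_eq_0[of x X] X(3) that by blast
  qed
  have gw: "good w" using A by (simp add: R_def w_def)
  then obtain \<nu> where \<nu>: "\<nu> \<in> dual" "w \<in> wsp \<nu>" by (auto simp: good_def)
  have "?a y t w = 0" for y t
  proof -
    let ?Z = "{y. ?a y t w = 0}"
    have "?Z = UNIV"
    proof (rule root_vectors_generate[OF nonzero])
      show "g.subspace ?Z" by (auto simp: g.subspace_def psi_add_left psi_scale_left)
      show "root_vectors \<subseteq> ?Z" using kill by blast
      fix x y assume xy: "x \<in> root_vectors" "y \<in> root_vectors" "br x y \<in> H"
      define c where "c = \<Lambda> (br x y) t"
      obtain \<alpha> where \<alpha>: "\<alpha> \<in> dual" "x \<in> rsp \<alpha>" using xy by (auto simp: root_vectors_def)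
      \<comment> \<open>[h \<otimes> st', x \<otimes> 1] is a multiple of x \<otimes> st', which
        kills every (x \<otimes> 1)^n w by \<open>k\<close>; so these vectors keep the eigenvalues
        of \<open>w\<close>.\<close>
      have h: "?a h t' ((\<psi> x 1 ^^ n) w) = scV (\<Lambda> h t') ((\<psi> x 1 ^^ n) w)"
        and k: "?a x t' ((\<psi> x 1 ^^ n) w) = 0" if "h \<in> H" for h n t'
      proof -
        show k: "?a x t' ((\<psi> x 1 ^^ n) w) = 0" for n
          by (induction n) (simp_all add: kill[OF xy(1)] psi_comm[of x "s * t'" x 1] g.bracket_self)
        show "?a h t' ((\<psi> x 1 ^^ n) w) = scV (\<Lambda> h t') ((\<psi> x 1 ^^ n) w)"
        proof (induction n)
          case 0
          then show ?case using gw that by (simp add: good_def)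
        next
          case (Suc n)
          then show ?case using k[of n]
            by (simp add: psi_comm[of h _ x 1] rspD[OF \<alpha>(2) that] psi_scale psi_scale_left)
        qed
      qed
      \<comment> \<open>[y \<otimes> st, x \<otimes> 1] = -[x, y] \<otimes> st contributes -c at
        each of the n + 1 places. Applying this n times to (x \<otimes> 1)^n w gives the factor
        (-1)^n n! c^n, which is the \<open>d\<close> below.\<close>
      have f: "?a y t ((\<psi> x 1 ^^ Suc n) w) = scV (- (of_nat (Suc n) * c)) ((\<psi> x 1 ^^ n) w)" for n
      proof (induction n)
        case 0
        have "\<psi> (br y x) (s * t) w = - \<psi> (br x y) (s * t) w"
          by (simp add: br_antisym[of y x] psi_minus)
        then show ?case using h[OF xy(3), of t 0] kill[OF xy(2)]
          by (simp add: psi_comm[of y _ x 1] c_def)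
      next
        case (Suc n)
        have "?a y t ((\<psi> x 1 ^^ Suc (Suc n)) w) =
            \<psi> x 1 (?a y t ((\<psi> x 1 ^^ Suc n) w)) + \<psi> (br y x) (s * t) ((\<psi> x 1 ^^ Suc n) w)"
          by (simp add: psi_comm[of y _ x 1])
        also have "\<psi> (br y x) (s * t) ((\<psi> x 1 ^^ Suc n) w) = - scV c ((\<psi> x 1 ^^ Suc n) w)"
          unfolding c_def h[OF xy(3), symmetric] by (simp add: br_antisym[of y x] psi_minus)
        finally have "?a y t ((\<psi> x 1 ^^ Suc (Suc n)) w) =
            scV (- (of_nat (Suc n) * c)) ((\<psi> x 1 ^^ Suc n) w) - scV c ((\<psi> x 1 ^^ Suc n) w)"
          unfolding Suc.IH psi_scale by (simp only: funpow.simps o_apply add_uminus_conv_diff)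
        moreover have "- (of_nat (Suc (Suc n)) * c) = - (of_nat (Suc n) * c) - c"
          by (simp add: algebra_simps)
        ultimately show ?case by (simp only: V.scale_left_diff_distrib)
      qed
      have "\<exists>d. (c \<noteq> 0 \<longrightarrow> d \<noteq> 0) \<and> (?a y t ^^ n) ((\<psi> x 1 ^^ n) w) = scV d w" for n
      proof (induction n)
        case 0
        show ?case by (intro exI[of _ 1]) simp
      next
        case (Suc n)
        then obtain d where d: "c \<noteq> 0 \<longrightarrow> d \<noteq> 0" "(?a y t ^^ n) ((\<psi> x 1 ^^ n) w) = scV d w"
          by blast
        have pl: "(?a y t ^^ n) (scV a u) = scV a ((?a y t ^^ n) u)" for a u
          by (induction n) (simp_all add: psi_scale)
        have "(?a y t ^^ Suc n) ((\<psi> x 1 ^^ Suc n) w) = (?a y t ^^ n) (?a y t ((\<psi> x 1 ^^ Suc n) w))"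
          by (simp only: funpow_Suc_right o_apply)
        also have "\<dots> = scV (- (of_nat (Suc n) * c) * d) w"
          unfolding f pl d(2) by simp
        finally show ?case
          using d(1) of_nat_neq_0[where 'a='k, of n]
          by (intro exI[of _ "- (of_nat (Suc n) * c) * d"]) (simp del: of_nat_Suc)
      qed
      then obtain d where d: "c \<noteq> 0 \<longrightarrow> d \<noteq> 0" "(?a y t ^^ B) ((\<psi> x 1 ^^ B) w) = scV d w"
        by blast
      have "(\<psi> x 1 ^^ B) w \<in> wsp (\<lambda>h. \<nu> h + of_nat B * \<alpha> h)"
        by (rule psi_root_pow[OF \<alpha>(2) \<nu>(2)])
      moreover have "(\<lambda>h. \<nu> h + of_nat B * \<alpha> h) \<in> dual"
        by (rule dual_add[OF \<nu>(1) dual_of_nat_mult[OF \<alpha>(1)]])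
      \<comment> \<open>(x \<otimes> 1)^B w satisfies the hypotheses of \<open>nil\<close>, so for n
        = \<open>B\<close> that factor is zero, and c with it.\<close>
      ultimately have "(?a y t ^^ B) ((\<psi> x 1 ^^ B) w) = 0"
        using nil[OF xy(2)] h by blast
      then have "c = 0" using d gw by (auto simp: good_def)
      then show "br x y \<in> ?Z" using h[OF xy(3), of t 0] by (simp add: c_def)
    qed
    then show ?thesis by blast
  qed
  then have w: "?a y t w = 0" for y t .
  have "range ((*) s) \<subseteq> annih"
  proof (rule subset_annih)
    show "w \<noteq> 0" using gw by (simp add: good_def)
    show "\<psi> x r w = 0" if "r \<in> range ((*) s)" for x r using that w by blast
    show "r * u \<in> range ((*) s)" if "r \<in> range ((*) s)" for r u
      using that by (metis mult.assoc rangeE rangeI)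
  qed
  moreover have "s = s * 1" by simp
  ultimately show ?thesis by blast
qed

lemma annih_radical: "s * s \<in> annih \<Longrightarrow> s \<in> annih"
  using annih_radical_nontrivial annih_mult(1)[of 1 s] by (metis mult_1_right)

lemma annih_cofinite: "cofinite_subspace scS annih"
proof (cases "1 \<in> annih")
  case True
  then have "annih = UNIV" using annih_mult(1)[of 1] by auto
  then show ?thesis by (auto simp: cofinite_subspace_def intro!: exI[of _ "{}"])
next
  case False
  then show ?thesis
    using exists_cofinite_ideal annih_radical cofinite_subspace_mono by (metis subsetI)
qed

end

section \<open>Radical ideals of finite codimension\<close>

lemma ring_idealD:
  assumes "ring_ideal I"
  shows "0 \<in> I" "a \<in> I \<Longrightarrow> b \<in> I \<Longrightarrow> a + b \<in> I" "a \<in> I \<Longrightarrow> s * a \<in> I" "a \<in> I \<Longrightarrow> a * s \<in> I"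
    "a \<in> I \<Longrightarrow> - a \<in> I" "a \<in> I \<Longrightarrow> b \<in> I \<Longrightarrow> a - b \<in> I"
proof -
  show *: "0 \<in> I" "\<And>a b. a \<in> I \<Longrightarrow> b \<in> I \<Longrightarrow> a + b \<in> I" "\<And>a s. a \<in> I \<Longrightarrow> s * a \<in> I"
    using assms by (auto simp: ring_ideal_def)
  show "a \<in> I \<Longrightarrow> a * s \<in> I" using *(3)[of a s] by (simp add: mult.commute)
  have n: "- a \<in> I" if "a \<in> I" for a using *(3)[OF that, of "- 1"] by simp
  then show "a \<in> I \<Longrightarrow> - a \<in> I" .
  show "a \<in> I \<Longrightarrow> b \<in> I \<Longrightarrow> a - b \<in> I" using *(2)[of a "- b"] n by simp
qed

lemma ring_ideal_one: "ring_ideal I \<Longrightarrow> 1 \<in> I \<Longrightarrow> I = UNIV"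
  using ring_idealD(3)[of I 1] by auto

lemma ring_ideal_plus_principal:
  assumes "ring_ideal P"
  shows "ring_ideal {p + u * a |p u. p \<in> P}"
  unfolding ring_ideal_def
proof (intro conjI ballI allI)
  let ?J = "{p + u * a |p u. p \<in> P}"
  have "0 = 0 + 0 * a" by simp
  then show "0 \<in> ?J" using ring_idealD(1)[OF assms] by blast
  fix x s assume "x \<in> ?J"
  then obtain p u where x: "p \<in> P" "x = p + u * a" by blast
  have "s * x = s * p + (s * u) * a" by (simp add: x algebra_simps)
  then show "s * x \<in> ?J" using ring_idealD(3)[OF assms x(1)] by blast
  fix y assume "y \<in> ?J"
  then obtain q w where y: "q \<in> P" "y = q + w * a" by blast
  have "x + y = (p + q) + (u + w) * a" by (simp add: x y algebra_simps)
  then show "x + y \<in> ?J" using ring_idealD(2)[OF assms x(1) y(1)] by blast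
qed

context comm_algebra
begin

lemma scale_mult_right: "a * scale c b = scale c (a * b)"
  using scale_mult[of c b a] by (simp add: mult.commute)

lemma scale_mult_1: "scale c 1 * a = scale c a"
  using scale_mult[of c 1 a] by simp

lemma ring_ideal_subspace: "ring_ideal I \<Longrightarrow> subspace I"
  unfolding subspace_def using ring_idealD scale_mult_1 by metis

lemma residue_diff:
  assumes "maximal_ideal M" "\<exists>c. s - scale c 1 \<in> M"
  shows "s - scale (residue scale M s) 1 \<in> M"
  using residue_eqI[OF assms(1)] assms(2) by metis

end

text \<open>Modulo \<open>P\<close>, multiplication by \<open>s\<close> acts on a nonzero
  finite-dimensional space and so has an eigenvalue a: (s - a) w lies in \<open>P\<close> for some w
  outside \<open>P\<close>, and primeness puts s - a into \<open>P\<close>.\<close>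

lemma prime_ideal_residue_field:
  fixes scale :: "'k::alg_closed_field \<Rightarrow> 's::{comm_ring, comm_monoid_mult} \<Rightarrow> 's"
  assumes "comm_algebra scale" and P: "ring_ideal P" "1 \<notin> P" "cofinite_subspace scale P"
    and prime: "\<And>a b. a * b \<in> P \<Longrightarrow> a \<in> P \<or> b \<in> P"
  shows "\<exists>c. s - scale c 1 \<in> P"
proof -
  interpret comm_algebra scale by fact
  obtain F where F: "finite F" "\<And>s. \<exists>t\<in>span F. s - t \<in> P"
    using P(3) by (auto simp: cofinite_subspace_def)
  have "endo_on scale UNIV ((*) s)"
    by (simp add: endo_on_def distrib_left scale_mult_right)
  then obtain a w where "w \<notin> P" "s * w - scale a w \<in> P"
    using exists_eigenvector_mod[OF vector_space_axioms subspace_UNIV ring_ideal_subspace[OF P(1)] F(1)]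
      F(2) P(2) by (metis UNIV_I)
  moreover have "s * w - scale a w = (s - scale a 1) * w"
    by (simp add: left_diff_distrib scale_mult_1)
  ultimately show ?thesis using prime by metis
qed

lemma maximal_idealI_residue:
  assumes "comm_algebra scale" "ring_ideal P" "1 \<notin> P" "\<And>s. \<exists>c. s - scale c 1 \<in> P"
  shows "maximal_ideal P"
  unfolding maximal_ideal_def
proof (intro conjI allI impI)
  interpret comm_algebra scale by fact
  fix J assume J: "ring_ideal J \<and> P \<subseteq> J"
  show "J = P \<or> J = UNIV"
  proof (rule ccontr)
    assume "\<not> (J = P \<or> J = UNIV)"
    then obtain s where s: "s \<in> J" "s \<notin> P" "J \<noteq> UNIV" using J by blast
    obtain c where c: "s - scale c 1 \<in> P" using assms(4) by blast
    then have "s - (s - scale c 1) \<in> J" using ring_idealD(6)[of J] J s by blast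
    then have "scale c 1 \<in> J" by simp
    moreover have "c \<noteq> 0" using c s by auto
    ultimately have "1 \<in> J"
      using subspace_scale[OF ring_ideal_subspace, of J "scale c 1" "inverse c"] J by simp
    then show False using ring_ideal_one J s by blast
  qed
qed (use assms in auto)

text \<open>An ideal above \<open>K\<close> that is maximal among those avoiding the powers of
  \<open>s\<close> is prime, hence has residue field k. A maximal one exists because an ideal
  containing \<open>K\<close> is determined by its trace on the finite-dimensional
  \<open>span F\<close>.\<close>

lemma radical_separation:
  fixes scale :: "'k::alg_closed_field \<Rightarrow> 's::{comm_ring, comm_monoid_mult} \<Rightarrow> 's"
  assumes "comm_algebra scale" and K: "ring_ideal K" "cofinite_subspace scale K"
    and rad: "\<And>s. s * s \<in> K \<Longrightarrow> s \<in> K" and s: "s \<notin> K"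
  obtains M where "maximal_ideal M" "K \<subseteq> M" "s \<notin> M" "\<forall>t. \<exists>c. t - scale c 1 \<in> M"
proof -
  interpret comm_algebra scale by fact
  obtain F where F: "finite F" "\<And>s. \<exists>t\<in>span F. s - t \<in> K"
    using K(2) by (auto simp: cofinite_subspace_def)
  let ?ok = "\<lambda>P. ring_ideal P \<and> K \<subseteq> P \<and> (\<forall>n. s ^ n \<notin> P)"
  have "s ^ (2 ^ n) \<notin> K" for n
  proof (induction n)
    case (Suc n)
    then show ?case using rad[of "s ^ 2 ^ n"] by (auto simp: mult_2 power_add)
  qed (use s in simp)
  moreover have "s ^ (2 ^ n) \<in> K" if "s ^ n \<in> K" for n
    using ring_idealD(4)[OF K(1) that, of "s ^ (2 ^ n - n)"]
    by (simp flip: power_add add: less_imp_le[OF less_exp])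
  ultimately have ok: "?ok K" using K by blast
  obtain A where A: "A \<in> (\<lambda>P. P \<inter> span F) ` Collect ?ok"
    "\<And>A'. A' \<in> (\<lambda>P. P \<inter> span F) ` Collect ?ok \<Longrightarrow> A \<subseteq> A' \<Longrightarrow> A' = A"
  proof (rule maximal_subspace[OF F(1), of "(\<lambda>P. P \<inter> span F) ` Collect ?ok"])
    show "(\<lambda>P. P \<inter> span F) ` Collect ?ok \<noteq> {}" using ok by blast
  qed (auto intro: subspace_inter ring_ideal_subspace)
  then obtain P where P: "?ok P" "A = P \<inter> span F" by blast
  have max: "P' \<subseteq> P" if "?ok P'" "P \<subseteq> P'" for P'
  proof
    fix x assume x: "x \<in> P'"
    obtain t where t: "t \<in> span F" "x - t \<in> K" using F(2) by blast
    then have "x - t \<in> P'" "ring_ideal P'" using that by auto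
    with x have "x - (x - t) \<in> P'" by (rule_tac ring_idealD(6))
    then have "t \<in> P'" by (simp add: algebra_simps)
    moreover have "P' \<inter> span F = A" using A(2)[of "P' \<inter> span F"] that P(2) by blast
    ultimately have "t \<in> P" using t P by blast
    moreover have "x - t \<in> P" using t P by blast
    ultimately have "(x - t) + t \<in> P" using P ring_idealD(2) by blast
    then show "x \<in> P" by simp
  qed
  have I: "ring_ideal P" using P by blast
  have "1 \<notin> P" using P(1) by (metis power_0)
  \<comment> \<open>By maximality the larger ideal P + Sa contains a power of \<open>s\<close>. Two
    such powers multiply into \<open>P\<close> as soon as a b lies in \<open>P\<close>, which gives
    primeness.\<close>
  have big: "\<exists>n p u. p \<in> P \<and> s ^ n = p + u * a" if "a \<notin> P" for a
  proof (rule ccontr)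
    assume *: "\<not> ?thesis"
    let ?P' = "{p + u * a |p u. p \<in> P}"
    have "p = p + 0 * a" for p by simp
    then have sub: "P \<subseteq> ?P'" by blast
    moreover have "?ok ?P'" using * sub P ring_ideal_plus_principal[OF I, of a] by blast
    ultimately have "?P' \<subseteq> P" by (rule_tac max)
    moreover have "a = 0 + 1 * a" by simp
    then have "a \<in> ?P'" using ring_idealD(1)[OF I] by blast
    ultimately show False using that by blast
  qed
  have prime: "a \<in> P \<or> b \<in> P" if ab: "a * b \<in> P" for a b
  proof (rule ccontr)
    assume "\<not> ?thesis"
    then obtain n p u m q w where *: "p \<in> P" "s ^ n = p + u * a" "q \<in> P" "s ^ m = q + w * b"
      using big by metis
    have "s ^ (n + m) = p * (q + w * b) + u * a * q + (u * w) * (a * b)"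
      unfolding power_add * by (simp add: algebra_simps)
    also have "\<dots> \<in> P"
      by (rule ring_idealD(2)[OF I ring_idealD(2)[OF I ring_idealD(4)[OF I *(1)]
            ring_idealD(3)[OF I *(3)]] ring_idealD(3)[OF I ab]])
    finally show False using P by blast
  qed
  have "cofinite_subspace scale P" using K(2) P cofinite_subspace_mono by blast
  from prime_ideal_residue_field[OF assms(1) I \<open>1 \<notin> P\<close> this prime]
  have res: "\<And>t. \<exists>c. t - scale c 1 \<in> P" .
  moreover have "s \<notin> P" using P(1) by (metis power_one_right)
  ultimately show thesis
    using that maximal_idealI_residue[OF assms(1) I \<open>1 \<notin> P\<close> res] P by blast
qed

context comm_algebra
begin

text \<open>\<open>M\<close> is prime because its residue field is k, so a product of elements, one
  from each N and all outside \<open>M\<close>, avoids \<open>M\<close>. Dividing by its residue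
  makes it 1 modulo \<open>M\<close>.\<close>

lemma separating_element:
  assumes "finite \<M>" and M: "M \<notin> \<M>" "maximal_ideal M" "\<And>s. \<exists>c. s - scale c 1 \<in> M"
    and \<M>: "\<And>N. N \<in> \<M> \<Longrightarrow> maximal_ideal N"
  shows "\<exists>e. (\<forall>N\<in>\<M>. e \<in> N) \<and> e - 1 \<in> M"
proof -
  have I: "ring_ideal M" "1 \<notin> M" using M(2) ring_ideal_one by (auto simp: maximal_ideal_def)
  have prime: "a * b \<notin> M" if "a \<notin> M" "b \<notin> M" for a b
  proof
    assume ab: "a * b \<in> M"
    obtain c where c: "a - scale c 1 \<in> M" using M(3) by blast
    then have "c \<noteq> 0" using that by auto
    have "a * b - (a - scale c 1) * b \<in> M" 
      by (rule ring_idealD(6)[OF I(1) ab ring_idealD(4)[OF I(1) c]])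
    then have "scale c b \<in> M" by (simp add: left_diff_distrib scale_mult_1)
    then have "scale (inverse c) (scale c b) \<in> M" by (rule subspace_scale[OF ring_ideal_subspace[OF I(1)]])
    then show False using \<open>c \<noteq> 0\<close> that by simp
  qed
  have "\<exists>a. (\<forall>N\<in>\<M>. a \<in> N) \<and> a \<notin> M"
    using assms(1) M(1) \<M>
  proof (induction \<M> rule: finite_induct)
    case empty
    then show ?case using I by auto
  next
    case (insert N \<M>)
    then obtain a where a: "\<forall>N\<in>\<M>. a \<in> N" "a \<notin> M" by auto
    have "\<not> N \<subseteq> M" using insert.prems M(2) unfolding maximal_ideal_def by blast
    then obtain b where b: "b \<in> N" "b \<notin> M" by blast
    have "b * a \<in> N'" if "N' \<in> insert N \<M>" for N'
    proof -
      have "ring_ideal N'" using insert.prems that by (auto simp: maximal_ideal_def)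
      then show ?thesis
        using a(1) b(1) that ring_idealD(3)[of N' a b] ring_idealD(4)[of N' b a] by auto
    qed
    then show ?case using prime[OF b(2) a(2)] by blast
  qed
  then obtain a where a: "\<forall>N\<in>\<M>. a \<in> N" "a \<notin> M" by blast
  obtain c where c: "a - scale c 1 \<in> M" using M(3) by blast
  then have "c \<noteq> 0" using a by auto
  let ?e = "scale (inverse c) a"
  have "?e - 1 = scale (inverse c) (a - scale c 1)"
    using \<open>c \<noteq> 0\<close> by (simp add: scale_right_diff_distrib)
  then have "?e - 1 \<in> M" using c subspace_scale[OF ring_ideal_subspace[OF I(1)]] by simp
  moreover have "?e \<in> N" if "N \<in> \<M>" for N
    using \<M>[OF that] a that subspace_scale[OF ring_ideal_subspace]
    by (auto simp: maximal_ideal_def)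
  ultimately show ?thesis by blast
qed

end

text \<open>S/K is the algebra of functions on the finitely many points M i, and e i represents the
  indicator of M i. Radicality enters through \<open>radical_separation\<close>: membership in
  \<open>K\<close> may be checked modulo each M i, which is \<open>memK\<close>.\<close>

lemma radical_cofinite_ideal:
  fixes scale :: "'k::alg_closed_field \<Rightarrow> 's::{comm_ring, comm_monoid_mult} \<Rightarrow> 's"
  assumes "comm_algebra scale" and K: "ring_ideal K" "cofinite_subspace scale K"
    and rad: "\<And>s. s * s \<in> K \<Longrightarrow> s \<in> K"
  obtains M r e where "inj_on M {..<r::nat}" "\<forall>i<r. maximal_ideal (M i)"
    "\<forall>i<r. \<forall>j<r. i \<noteq> j \<longrightarrow> e i * e j \<in> K" "\<forall>i<r. e i * e i - e i \<in> K"
    "\<forall>s. s - (\<Sum>i<r. scale (residue scale (M i) s) (e i)) \<in> K"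
proof -
  interpret comm_algebra scale by fact
  obtain F where F: "finite F" "\<And>s. \<exists>t\<in>span F. s - t \<in> K"
    using K(2) by (auto simp: cofinite_subspace_def)
  define \<M> where "\<M> = {M. maximal_ideal M \<and> K \<subseteq> M \<and> (\<forall>t. \<exists>c. t - scale c 1 \<in> M)}"
  have idl: "ring_ideal M" "M \<noteq> UNIV" "1 \<notin> M" if "M \<in> \<M>" for M
    using that ring_ideal_one by (auto simp: \<M>_def maximal_ideal_def)
  have sep: "\<exists>e. (\<forall>N\<in>\<N> - {M}. e \<in> N) \<and> e - 1 \<in> M" if "finite \<N>" "\<N> \<subseteq> \<M>" "M \<in> \<M>" for \<N> M
    using that by (intro separating_element) (auto simp: \<M>_def)
  \<comment> \<open>Separating elements are independent modulo \<open>K\<close>, since reading a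
    relation modulo \<open>f j\<close> isolates the coefficient c j. As they have representatives in
    \<open>span F\<close>, the size of \<open>F\<close> bounds the number of points.\<close>
  have "card \<N> \<le> card F" if \<N>: "finite \<N>" "\<N> \<subseteq> \<M>" for \<N>
  proof (rule ccontr)
    assume less: "\<not> card \<N> \<le> card F"
    obtain f where f: "bij_betw f {..<card \<N>} \<N>"
      using ex_bij_betw_nat_finite[OF \<N>(1)] by (auto simp: atLeast0LessThan)
    have "\<forall>i. \<exists>e. i < card \<N> \<longrightarrow> (\<forall>N\<in>\<N> - {f i}. e \<in> N) \<and> e - 1 \<in> f i"
      using sep[OF \<N>] f \<N>(2) by (meson bij_betwE lessThan_iff subsetD)
    then obtain e where e: "\<And>i. i < card \<N> \<Longrightarrow> (\<forall>N\<in>\<N> - {f i}. e i \<in> N) \<and> e i - 1 \<in> f i"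
      by metis
    have "\<forall>i. \<exists>t. t \<in> span F \<and> e i - t \<in> K" using F(2) by blast
    then obtain t where t: "\<And>i. t i \<in> span F" "\<And>i. e i - t i \<in> K" by metis
    obtain c where c: "\<exists>i\<le>card F. c i \<noteq> 0" "(\<Sum>i\<le>card F. scale (c i) (t i)) = 0"
      using dependent_sequence[OF F(1), of t] t by blast
    obtain j where j: "j \<le> card F" "c j \<noteq> 0" using c(1) by blast
    have jn: "i < card \<N>" if "i \<le> card F" for i using that less by simp
    have fj: "f j \<in> \<N>" using bij_betwE[OF f] jn[OF j(1)] by simp
    then have fM: "f j \<in> \<M>" using \<N> by blast
    note I = idl[OF fM] and sub = ring_ideal_subspace[OF idl(1)[OF fM]]
    have "t i - (if i = j then 1 else 0) \<in> f j" if i: "i \<le> card F" for i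
    proof -
      have "e i - (if i = j then 1 else 0) \<in> f j"
      proof (cases "i = j")
        case False
        then have "f i \<noteq> f j"
          using bij_betw_imp_inj_on[OF f] jn[OF i] jn[OF j(1)] by (auto simp: inj_on_def)
        then show ?thesis using e[OF jn[OF i]] fj False by auto
      qed (use e jn[OF i] in auto)
      moreover have "e i - t i \<in> f j" using t(2) fM by (auto simp: \<M>_def)
      ultimately have "(e i - (if i = j then 1 else 0)) - (e i - t i) \<in> f j"
        by (rule ring_idealD(6)[OF I(1)])
      then show ?thesis by simp
    qed
    then have "(\<Sum>i\<le>card F. scale (c i) (t i - (if i = j then 1 else 0))) \<in> f j"
      by (intro subspace_sum[OF sub] subspace_scale[OF sub]) auto
    moreover have "(\<Sum>i\<le>card F. scale (c i) (t i - (if i = j then 1 else 0))) =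
        (\<Sum>i\<le>card F. scale (c i) (t i)) - (\<Sum>i\<le>card F. if i = j then scale (c i) 1 else 0)"
      unfolding sum_subtractf[symmetric] by (intro sum.cong) (auto simp: scale_right_diff_distrib)
    ultimately have "- scale (c j) 1 \<in> f j" using c(2) j(1) by simp
    then have "scale (- inverse (c j)) (- scale (c j) 1) \<in> f j" by (rule_tac subspace_scale[OF sub]) simp
    then show False using j(2) I(3) by simp
  qed
  then have fin: "finite \<M>" using infinite_arbitrarily_large[of \<M> "Suc (card F)"] by fastforce
  define r where "r = card \<M>"
  obtain M where M: "bij_betw M {..<r} \<M>"
    using ex_bij_betw_nat_finite[OF fin] by (auto simp: atLeast0LessThan r_def)
  have Mi: "M i \<in> \<M>" if "i < r" for i using that bij_betwE[OF M] by blast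
  have inj: "inj_on M {..<r}" using M by (rule bij_betw_imp_inj_on)
  have "\<forall>i. \<exists>e. i < r \<longrightarrow> (\<forall>N\<in>\<M> - {M i}. e \<in> N) \<and> e - 1 \<in> M i"
    using sep[OF fin order_refl] Mi by blast
  then obtain e where e: "\<And>i. i < r \<Longrightarrow> (\<forall>N\<in>\<M> - {M i}. e i \<in> N) \<and> e i - 1 \<in> M i" by metis
  have e_in: "e i \<in> M j" if "i < r" "j < r" "i \<noteq> j" for i j
    using e[OF that(1)] Mi[OF that(2)] inj that by (auto simp: inj_on_def)
  have memK: "s \<in> K" if "\<And>j. j < r \<Longrightarrow> s \<in> M j" for s
  proof (rule ccontr)
    assume "s \<notin> K"
    obtain N where "maximal_ideal N" "K \<subseteq> N" "s \<notin> N" "\<forall>t. \<exists>c. t - scale c 1 \<in> N"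
      by (rule radical_separation[OF assms(1) K rad \<open>s \<notin> K\<close>])
    then have N: "N \<in> \<M>" "s \<notin> N" by (auto simp: \<M>_def)
    then have "N \<in> M ` {..<r}" using bij_betw_imp_surj_on[OF M] by simp
    then show False using that N(2) by auto
  qed
  have max: "maximal_ideal (M i)" if "i < r" for i using Mi[OF that] by (simp add: \<M>_def)
  have res: "s - scale (residue scale (M i) s) 1 \<in> M i" if "i < r" for i s
    using residue_diff[OF max[OF that]] Mi[OF that] by (simp add: \<M>_def)
  show thesis
  proof (rule that[OF inj]; intro allI impI)
    show "maximal_ideal (M i)" if "i < r" for i using that by (rule max)
  next
    fix i j assume ij: "i < r" "j < r" "i \<noteq> j"
    have "e i * e j \<in> M l" if "l < r" for l
    proof (cases "l = i")
      case True
      then show ?thesis using e_in[of j l] ij ring_idealD(3)[OF idl(1)[OF Mi[OF that]]] by simp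
    next
      case False
      then show ?thesis using e_in[of i l] ij ring_idealD(4)[OF idl(1)[OF Mi[OF that]]] that by simp
    qed
    then show "e i * e j \<in> K" by (rule memK)
  next
    fix i assume i: "i < r"
    have "(e i - 1) * e i \<in> M l" if "l < r" for l
    proof (cases "l = i")
      case True
      then show ?thesis using e[OF i] ring_idealD(4)[OF idl(1)[OF Mi[OF that]]] by simp
    next
      case False
      then show ?thesis using e_in[of i l] i ring_idealD(3)[OF idl(1)[OF Mi[OF that]]] that by simp
    qed
    then have "(e i - 1) * e i \<in> K" by (rule memK)
    then show "e i * e i - e i \<in> K" by (simp add: left_diff_distrib)
  next
    fix s
    let ?c = "\<lambda>i. residue scale (M i) s"
    have "s - (\<Sum>i<r. scale (?c i) (e i)) \<in> M l" if l: "l < r" for l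
    proof -
      note I = idl(1)[OF Mi[OF l]] and sub = ring_ideal_subspace[OF idl(1)[OF Mi[OF l]]]
      have "scale (?c i) (e i - (if i = l then 1 else 0)) \<in> M l" if "i < r" for i
        using e[OF l] e_in[OF that l] by (intro subspace_scale[OF sub]) auto
      then have "(\<Sum>i<r. scale (?c i) (e i - (if i = l then 1 else 0))) \<in> M l"
        by (intro subspace_sum[OF sub]) auto
      with res[OF l, of s] have "(s - scale (?c l) 1) -
          (\<Sum>i<r. scale (?c i) (e i - (if i = l then 1 else 0))) \<in> M l"
        by (rule_tac ring_idealD(6)[OF I])
      moreover have "(\<Sum>i<r. scale (?c i) (e i - (if i = l then 1 else 0))) =
          (\<Sum>i<r. scale (?c i) (e i)) - (\<Sum>i<r. if i = l then scale (?c i) 1 else 0)"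
        unfolding sum_subtractf[symmetric] by (intro sum.cong) (auto simp: scale_right_diff_distrib)
      ultimately show ?thesis using l by simp
    qed
    then show "s - (\<Sum>i<r. scale (?c i) (e i)) \<in> K" by (rule memK)
  qed
qed

section \<open>Commuting operator algebras and the density theorem\<close>

definition operator_algebra :: "('k \<Rightarrow> 'v::ab_group_add \<Rightarrow> 'v) \<Rightarrow> ('v \<Rightarrow> 'v) set \<Rightarrow> bool"
  where "operator_algebra scale E \<longleftrightarrow> id \<in> E \<and> (\<forall>f\<in>E. \<forall>g\<in>E. f \<circ> g \<in> E) \<and>
    (\<forall>f\<in>E. \<forall>g\<in>E. (\<lambda>v. f v + g v) \<in> E) \<and> (\<forall>c. \<forall>f\<in>E. (\<lambda>v. scale c (f v)) \<in> E) \<and>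
    (\<forall>f\<in>E. endo_on scale UNIV f)"

lemma operator_algebraD:
  assumes "operator_algebra scale E"
  shows "id \<in> E" "f \<in> E \<Longrightarrow> g \<in> E \<Longrightarrow> f \<circ> g \<in> E"
    "f \<in> E \<Longrightarrow> g \<in> E \<Longrightarrow> (\<lambda>v. f v + g v) \<in> E" "f \<in> E \<Longrightarrow> (\<lambda>v. scale c (f v)) \<in> E"
    "f \<in> E \<Longrightarrow> f (u + v) = f u + f v" "f \<in> E \<Longrightarrow> f (scale c v) = scale c (f v)"
  using assms by (auto simp: operator_algebra_def endo_on_def)

inductive_set op_gen :: "('k \<Rightarrow> 'v::ab_group_add \<Rightarrow> 'v) \<Rightarrow> ('v \<Rightarrow> 'v) set \<Rightarrow> ('v \<Rightarrow> 'v) set"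
  for scale R
  where
    base: "f \<in> R \<Longrightarrow> f \<in> op_gen scale R"
  | id: "id \<in> op_gen scale R"
  | comp: "f \<in> op_gen scale R \<Longrightarrow> g \<in> op_gen scale R \<Longrightarrow> f \<circ> g \<in> op_gen scale R"
  | add: "f \<in> op_gen scale R \<Longrightarrow> g \<in> op_gen scale R \<Longrightarrow> (\<lambda>v. f v + g v) \<in> op_gen scale R"
  | scale: "f \<in> op_gen scale R \<Longrightarrow> (\<lambda>v. scale c (f v)) \<in> op_gen scale R"

lemma op_gen_commute:
  assumes "f \<in> op_gen scale R" and T: "\<And>g v. g \<in> R \<Longrightarrow> T (g v) = g (T v)"
    "\<And>u v. T (u + v) = T u + T v" "\<And>c v. T (scale c v) = scale c (T v)"
  shows "T (f v) = f (T v)"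
  using assms(1) by (induction arbitrary: v) (auto simp: T)

context vector_space
begin

lemma operator_algebra_op_gen:
  assumes "\<And>f. f \<in> R \<Longrightarrow> endo_on scale UNIV f"
  shows "operator_algebra scale (op_gen scale R)"
proof -
  have "endo_on scale UNIV f" if "f \<in> op_gen scale R" for f
    using that assms
    by induction (auto simp: endo_on_def scale_right_distrib scale_left_commute ac_simps)
  then show ?thesis by (auto simp: operator_algebra_def intro: op_gen.intros)
qed

lemma op_gen_subspace:
  assumes "f \<in> op_gen scale R" "subspace U" "\<And>g v. g \<in> R \<Longrightarrow> v \<in> U \<Longrightarrow> g v \<in> U" "v \<in> U"
  shows "f v \<in> U"
  using assms(1,4)
  by (induction arbitrary: v) (auto intro: subspace_add[OF assms(2)] subspace_scale[OF assms(2)] assms(3))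

lemma operator_algebra_0:
  assumes "operator_algebra scale E" "f \<in> E" shows "f 0 = 0"
  using operator_algebraD(6)[OF assms, of 0 0] by simp

lemma operator_algebra_diff:
  assumes "operator_algebra scale E" "f \<in> E" "g \<in> E" shows "(\<lambda>v. f v - g v) \<in> E"
  using operator_algebraD(3)[OF assms(1,2) operator_algebraD(4)[OF assms(1,3), of "- 1"]] by simp

lemma operator_algebra_sum:
  assumes "operator_algebra scale E" "f \<in> E"
  shows "f (\<Sum>i\<in>I. g i) = (\<Sum>i\<in>I. f (g i))"
  by (induction I rule: infinite_finite_induct)
    (auto simp: operator_algebra_0[OF assms] operator_algebraD(5)[OF assms])

lemma operator_algebra_span_eq_0:
  assumes "operator_algebra scale E" "f \<in> E" "\<And>x. x \<in> B \<Longrightarrow> f x = 0" "y \<in> span B"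
  shows "f y = 0"
proof -
  have "subspace {y. f y = 0}"
    by (auto simp: subspace_def operator_algebra_0[OF assms(1,2)] operator_algebraD[OF assms(1)] assms(2))
  then show ?thesis using span_minimal[of B "{y. f y = 0}"] assms(3,4) by blast
qed

lemma subspace_orbit:
  assumes "operator_algebra scale E" shows "subspace {u v |u. u \<in> E}"
  unfolding subspace_def
proof (intro conjI ballI allI)
  have "(\<lambda>w. scale 0 (id w)) \<in> E" by (intro operator_algebraD[OF assms])
  moreover have "0 = (\<lambda>w. scale 0 (id w)) v" by simp
  ultimately show "0 \<in> {u v |u. u \<in> E}" by (intro CollectI exI conjI)
  fix x y c assume "x \<in> {u v |u. u \<in> E}"
  then obtain u where u: "u \<in> E" "x = u v" by blast
  then show "scale c x \<in> {u v |u. u \<in> E}" using operator_algebraD(4)[OF assms u(1), of c] by auto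
  assume "y \<in> {u v |u. u \<in> E}"
  then obtain u' where "u' \<in> E" "y = u' v" by blast
  then show "x + y \<in> {u v |u. u \<in> E}" using operator_algebraD(3)[OF assms u(1)] u by auto
qed

text \<open>
  Jacobson density: were every operator killing \<open>B\<close> and \<open>a\<close> to kill \<open>b\<close>, then \<open>u a \<mapsto> u b\<close> (for \<open>u\<close>
  killing \<open>B\<close>) would be an endomorphism, hence a scalar \<open>c\<close>, and \<open>b - c a\<close> would lie in the span of \<open>B\<close>.
\<close>

lemma density:
  assumes E: "operator_algebra scale E" and W: "W = {u v0 |u. u \<in> E}"
    and simple: "\<And>u. u \<in> E \<Longrightarrow> u v0 \<noteq> 0 \<Longrightarrow> \<exists>u'\<in>E. u' (u v0) = v0"
    and schur: "\<And>\<theta>. endo_on scale W \<theta> \<Longrightarrow> (\<And>u w. u \<in> E \<Longrightarrow> w \<in> W \<Longrightarrow> \<theta> (u w) = u (\<theta> w)) \<Longrightarrow>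
      \<exists>c. \<forall>w\<in>W. \<theta> w = scale c w"
    and "finite B" "B \<subseteq> W" "b \<in> W" "b \<notin> span B"
  shows "\<exists>u\<in>E. (\<forall>x\<in>B. u x = 0) \<and> u b = v0"
  using assms(5-)
proof (induction B arbitrary: b rule: finite_induct)
  case empty
  then show ?case using simple W by auto
next
  case (insert a B)
  have aW: "a \<in> W" and BW: "B \<subseteq> W" using insert by auto
  have bB: "b \<notin> span B" using insert.prems span_mono[of B "insert a B"] by blast
  show ?case
  proof (cases "a \<in> span B")
    case True
    obtain u where "u \<in> E" "\<forall>x\<in>B. u x = 0" "u b = v0" using insert.IH[OF BW insert.prems(2) bB] by blast
    then show ?thesis using operator_algebra_span_eq_0[OF E _ _ True] by blast
  next
    case False
    obtain ua where ua: "ua \<in> E" "\<forall>x\<in>B. ua x = 0" "ua a = v0" using insert.IH[OF BW aW False] by blast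
    show ?thesis
    proof (rule ccontr)
      assume *: "\<not> ?thesis"
      define L where "L = {u\<in>E. \<forall>x\<in>B. u x = 0}"
      have zero: "u b = 0" if "u \<in> L" "u a = 0" for u
      proof (rule ccontr)
        assume nz: "u b \<noteq> 0"
        obtain t where t: "t \<in> E" "b = t v0" using insert.prems W by blast
        have "u \<circ> t \<in> E" using that t operator_algebraD(2)[OF E] by (simp add: L_def)
        then obtain u' where u': "u' \<in> E" "u' (u b) = v0" using simple[of "u \<circ> t"] nz t by auto
        have "u' \<circ> u \<in> E" using u' that operator_algebraD(2)[OF E] by (simp add: L_def)
        moreover have "\<forall>x\<in>insert a B. (u' \<circ> u) x = 0"
          using that operator_algebra_0[OF E u'(1)] by (simp add: L_def)
        ultimately show False using * u'(2) by (metis o_apply)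
      qed
      \<comment> \<open>The map from u a to u b. By \<open>zero\<close> it does not depend on the
        choice of u, and products t ua with t in \<open>E\<close> show that it is defined on all of
        \<open>W\<close>.\<close>
      define \<theta> where "\<theta> w = (SOME u. u \<in> L \<and> u a = w) b" for w
      have \<theta>: "\<theta> (u a) = u b" if u: "u \<in> L" for u
      proof -
        define u' where "u' = (SOME u'. u' \<in> L \<and> u' a = u a)"
        have u': "u' \<in> L" "u' a = u a"
          using someI[of "\<lambda>u'. u' \<in> L \<and> u' a = u a" u] u by (simp_all add: u'_def)
        have "(\<lambda>v. u v - u' v) \<in> L" using u u' operator_algebra_diff[OF E] by (simp add: L_def)
        from zero[OF this] u'(2) have "u b = u' b" by simp
        then show ?thesis by (simp add: \<theta>_def u'_def)
      qed
      have ex: "\<exists>u\<in>L. u a = w" if w: "w \<in> W" for w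
      proof -
        obtain t where t: "t \<in> E" "w = t v0" using w W by blast
        have "t \<circ> ua \<in> L"
          using operator_algebraD(2)[OF E t(1) ua(1)] operator_algebra_0[OF E t(1)] ua by (simp add: L_def)
        then show ?thesis using t ua by (auto intro: bexI[of _ "t \<circ> ua"])
      qed
      have stable: "u w \<in> W" if "u \<in> E" and w: "w \<in> W" for u w
      proof -
        obtain t where "t \<in> E" "w = t v0" using w W by blast
        then show ?thesis using operator_algebraD(2)[OF E \<open>u \<in> E\<close>, of t] W by auto
      qed
      have "endo_on scale W \<theta>"
        unfolding endo_on_def
      proof (intro conjI ballI allI)
        fix x y c assume "x \<in> W"
        then obtain u where u: "u \<in> L" "u a = x" using ex by blast
        have "(\<lambda>v. scale c (u v)) \<in> L" using u operator_algebraD(4)[OF E] by (simp add: L_def)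
        from \<theta>[OF this] show "\<theta> (scale c x) = scale c (\<theta> x)" using \<theta>[OF u(1)] u(2) by simp
        assume "y \<in> W"
        then obtain u' where u': "u' \<in> L" "u' a = y" using ex by blast
        have "(\<lambda>v. u v + u' v) \<in> L" using u u' operator_algebraD(3)[OF E] by (simp add: L_def)
        from \<theta>[OF this] show "\<theta> (x + y) = \<theta> x + \<theta> y" using \<theta>[OF u(1)] \<theta>[OF u'(1)] u u' by simp
      next
        show "\<theta> ` W \<subseteq> W"
        proof
          fix y assume "y \<in> \<theta> ` W"
          then obtain u where "u \<in> L" "y = u b" using ex \<theta> by (metis imageE)
          then show "y \<in> W" using stable insert.prems by (simp add: L_def)
        qed
      qed
      moreover have "\<theta> (t w) = t (\<theta> w)" if t: "t \<in> E" and w: "w \<in> W" for t w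
      proof -
        obtain u where u: "u \<in> L" "u a = w" using ex[OF w] by blast
        have "t \<circ> u \<in> L"
          using operator_algebraD(2)[OF E t] operator_algebra_0[OF E t] u by (simp add: L_def)
        from \<theta>[OF this] show ?thesis using \<theta>[OF u(1)] u(2) by simp
      qed
      ultimately obtain c where c: "\<And>w. w \<in> W \<Longrightarrow> \<theta> w = scale c w" using schur by metis
      have kill: "u (b - scale c a) = 0" if u: "u \<in> L" for u
      proof -
        have uE: "u \<in> E" using u by (simp add: L_def)
        have "u b = scale c (u a)" using \<theta>[OF u] c stable[OF uE aW] by simp
        moreover have "u ((b - scale c a) + scale c a) = u (b - scale c a) + scale c (u a)"
          by (simp only: operator_algebraD(5,6)[OF E uE])
        ultimately show ?thesis by simp
      qed
      have "b - scale c a \<in> span B"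
      proof (rule ccontr)
        assume n: "b - scale c a \<notin> span B"
        have "b - scale c a \<in> W"
          unfolding W by (intro subspace_diff subspace_scale subspace_orbit[OF E])
            (use aW insert.prems W in auto)
        from insert.IH[OF BW this n] obtain u where "u \<in> L" "u (b - scale c a) = v0"
          by (auto simp: L_def)
        then have "v0 = 0" using kill[of u] by simp
        then have "b = 0" using insert.prems W operator_algebra_0[OF E] by auto
        then show False using insert.prems span_zero by blast
      qed
      then have "b \<in> span (insert a B)" unfolding span_insert by blast
      then show False using insert.prems by blast
    qed
  qed
qed

end

section \<open>Products of commuting operators and the map from the tensor product\<close>

primrec iterate_ops :: "nat \<Rightarrow> (nat \<Rightarrow> 'v \<Rightarrow> 'v) \<Rightarrow> 'v \<Rightarrow> 'v"
  where
    "iterate_ops 0 us v = v"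
  | "iterate_ops (Suc n) us v = us n (iterate_ops n us v)"

lemma iterate_ops_cong: "(\<And>i. i < n \<Longrightarrow> us i = us' i) \<Longrightarrow> iterate_ops n us v = iterate_ops n us' v"
  by (induction n) auto

lemma iterate_ops_commute:
  "(\<And>i v. i < n \<Longrightarrow> T (us i v) = us i (T v)) \<Longrightarrow> T (iterate_ops n us v) = iterate_ops n us (T v)"
  by (induction n) auto

lemma iterate_ops_id: "iterate_ops n (\<lambda>_. id) v = v"
  by (induction n) auto

text \<open>
  The tensor product of the cyclic modules \<open>E i v0\<close> maps to the ambient space by
  \<open>u_0 v0 \<otimes> \<dots> \<otimes> u_(r-1) v0 \<mapsto> u_0 \<dots> u_(r-1) v0\<close>; commutativity makes this independent of the
  choice of the \<open>u_i\<close>.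
\<close>

locale commuting_algebras = vector_space scale
  for scale :: "'k::field \<Rightarrow> 'v::ab_group_add \<Rightarrow> 'v" +
  fixes r :: nat and E :: "nat \<Rightarrow> ('v \<Rightarrow> 'v) set" and v0 :: 'v
  assumes algebra: "i < r \<Longrightarrow> operator_algebra scale (E i)"
    and commute: "i < r \<Longrightarrow> j < r \<Longrightarrow> i \<noteq> j \<Longrightarrow> f \<in> E i \<Longrightarrow> g \<in> E j \<Longrightarrow> f (g v) = g (f v)"
begin

definition cyclic :: "nat \<Rightarrow> 'v set"
  where "cyclic i = {u v0 |u. u \<in> E i}"

definition tensor_map :: "(nat \<Rightarrow> 'v) \<Rightarrow> 'v"
  where "tensor_map w = iterate_ops r (\<lambda>i. SOME u. u \<in> E i \<and> u v0 = w i) v0"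

lemma commute_iterate:
  assumes "m < r" "n \<le> m" "u \<in> E m" "\<And>j. j < n \<Longrightarrow> us j \<in> E j"
  shows "u (iterate_ops n us v) = iterate_ops n us (u v)"
proof (rule iterate_ops_commute)
  fix i v assume "i < n"
  then show "u (us i v) = us i (u v)" using assms commute[of m i u "us i"] by simp
qed

text \<open>Commutation lets the i-th factor act first and leaves the identity in its place, so that
  whatever depends on slot i is isolated as the argument of the rest.\<close>

lemma iterate_extract:
  assumes "n \<le> r" "\<And>j. j < n \<Longrightarrow> us j \<in> E j" "i < n"
  shows "iterate_ops n us v = iterate_ops n (us(i := id)) (us i v)"
  using assms
proof (induction n)
  case (Suc n)
  show ?case
  proof (cases "i = n")
    case True
    have "iterate_ops (Suc n) us v = us n (iterate_ops n us v)" by simp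
    also have "\<dots> = iterate_ops n us (us n v)"
      using Suc.prems by (intro commute_iterate[of n]) auto
    also have "\<dots> = iterate_ops n (us(n := id)) (us n v)" by (rule iterate_ops_cong) simp
    also have "\<dots> = iterate_ops (Suc n) (us(n := id)) (us n v)"
      by (metis iterate_ops.simps(2) fun_upd_same id_apply)
    finally show ?thesis unfolding True .
  next
    case False
    then show ?thesis using Suc by simp
  qed
qed simp

text \<open>Each factor can be moved next to \<open>v0\<close>, where only its value on
  \<open>v0\<close> matters. This is the independence of choices behind
  \<open>tensor_map\<close>.\<close>

lemma iterate_determined:
  assumes "n \<le> r" "\<And>j. j < n \<Longrightarrow> us j \<in> E j" "\<And>j. j < n \<Longrightarrow> us' j \<in> E j"
    "\<And>j. j < n \<Longrightarrow> us j v0 = us' j v0"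
  shows "iterate_ops n us v0 = iterate_ops n us' v0"
  using assms
proof (induction n)
  case (Suc n)
  have "us n (iterate_ops n us v0) = iterate_ops n us (us n v0)"
    using Suc.prems by (intro commute_iterate[of n]) auto
  also have "\<dots> = iterate_ops n us (us' n v0)" using Suc.prems by simp
  also have "\<dots> = us' n (iterate_ops n us v0)"
    using Suc.prems by (intro commute_iterate[of n, symmetric]) auto
  finally show ?case using Suc by simp
qed simp

lemma iterate_comp:
  assumes "n \<le> r" "\<And>j. j < n \<Longrightarrow> us j \<in> E j" "\<And>j. j < n \<Longrightarrow> us' j \<in> E j"
  shows "iterate_ops n us (iterate_ops n us' v) = iterate_ops n (\<lambda>i. us i \<circ> us' i) v"
  using assms
proof (induction n)
  case (Suc n)
  have "us' n (iterate_ops n us (iterate_ops n us' v)) = iterate_ops n us (us' n (iterate_ops n us' v))"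
    using Suc.prems by (intro commute_iterate[of n]) auto
  then show ?case using Suc by simp
qed simp

lemma iterate_linear:
  assumes "n \<le> r" "\<And>j. j < n \<Longrightarrow> us j \<in> E j"
  shows "iterate_ops n us (u + v) = iterate_ops n us u + iterate_ops n us v"
    "iterate_ops n us (scale c v) = scale c (iterate_ops n us v)"
    "iterate_ops n us 0 = 0"
proof -
  have *: "us j (u + v) = us j u + us j v" "us j (scale c v) = scale c (us j v)" "us j 0 = 0"
    if "j < n" for j u v c
  proof -
    have "operator_algebra scale (E j)" "us j \<in> E j" using algebra assms that by auto
    then show "us j (u + v) = us j u + us j v" "us j (scale c v) = scale c (us j v)" "us j 0 = 0"
      by (auto simp: operator_algebraD operator_algebra_0)
  qed
  have "iterate_ops m us (u + v) = iterate_ops m us u + iterate_ops m us v \<and>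
    iterate_ops m us (scale c v) = scale c (iterate_ops m us v) \<and> iterate_ops m us 0 = 0" if "m \<le> n" for m
    using that by (induction m) (auto simp: *)
  then show "iterate_ops n us (u + v) = iterate_ops n us u + iterate_ops n us v"
    "iterate_ops n us (scale c v) = scale c (iterate_ops n us v)"
    "iterate_ops n us 0 = 0" by blast+
qed

lemma iterate_sum:
  assumes "n \<le> r" "\<And>j. j < n \<Longrightarrow> us j \<in> E j"
  shows "iterate_ops n us (\<Sum>i\<in>I. f i) = (\<Sum>i\<in>I. iterate_ops n us (f i))"
  by (induction I rule: infinite_finite_induct) (auto simp: iterate_linear[OF assms])

lemma tensor_map_eq:
  assumes "\<And>i. i < r \<Longrightarrow> us i \<in> E i" "\<And>i. i < r \<Longrightarrow> us i v0 = w i"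
  shows "tensor_map w = iterate_ops r us v0"
proof -
  let ?u = "\<lambda>i. SOME u. u \<in> E i \<and> u v0 = w i"
  have *: "?u i \<in> E i \<and> ?u i v0 = w i" if "i < r" for i
    using someI[of "\<lambda>u. u \<in> E i \<and> u v0 = w i" "us i"] assms that by simp
  show ?thesis unfolding tensor_map_def using * assms by (intro iterate_determined) auto
qed

lemma choose_ops:
  assumes "\<And>i. i < r \<Longrightarrow> w i \<in> cyclic i"
  obtains us where "\<And>i. i < r \<Longrightarrow> us i \<in> E i" "\<And>i. i < r \<Longrightarrow> us i v0 = w i"
proof -
  have "\<forall>i. \<exists>u. i < r \<longrightarrow> u \<in> E i \<and> u v0 = w i" using assms by (fastforce simp: cyclic_def)
  then show thesis using that by metis
qed

text \<open>The operator is the product of the u_j with j other than i, so it is linear on the whole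
  space and commutes with \<open>E i\<close>. Multilinearity and equivariance of
  \<open>tensor_map\<close> both follow.\<close>

lemma tensor_map_slot:
  assumes w: "\<And>i. i < r \<Longrightarrow> w i \<in> cyclic i" and i: "i < r"
  obtains T where "\<And>u v. T (u + v) = T u + T v" "\<And>c v. T (scale c v) = scale c (T v)"
    "\<And>a. a \<in> cyclic i \<Longrightarrow> tensor_map (w(i := a)) = T a" "\<And>u v. u \<in> E i \<Longrightarrow> u (T v) = T (u v)"
proof -
  obtain us where us: "\<And>i. i < r \<Longrightarrow> us i \<in> E i" "\<And>i. i < r \<Longrightarrow> us i v0 = w i"
    using choose_ops[of w] w by blast
  let ?us = "us(i := id)"
  have E': "?us j \<in> E j" if "j < r" for j
    using us that operator_algebraD(1)[OF algebra] by simp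
  show thesis
  proof (rule that[of "iterate_ops r ?us"])
    show "tensor_map (w(i := a)) = iterate_ops r ?us a" if a: "a \<in> cyclic i" for a
    proof -
      obtain u where u: "u \<in> E i" "u v0 = a" using a by (auto simp: cyclic_def)
      have "tensor_map (w(i := a)) = iterate_ops r (us(i := u)) v0"
        using us u by (intro tensor_map_eq) auto
      also have "\<dots> = iterate_ops r ((us(i := u))(i := id)) ((us(i := u)) i v0)"
        using us u i by (intro iterate_extract) auto
      finally show ?thesis using u by simp
    qed
    show "u (iterate_ops r ?us v) = iterate_ops r ?us (u v)" if "u \<in> E i" for u v
      using that us i commute by (intro iterate_ops_commute) auto
  qed (use E' in \<open>auto simp: iterate_linear\<close>)
qed

lemma tensor_map_act:
  assumes "\<And>i. i < r \<Longrightarrow> w i \<in> cyclic i" "i < r" "u \<in> E i"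
  shows "u (tensor_map w) = tensor_map (w(i := u (w i)))"
proof -
  obtain T where T: "\<And>a. a \<in> cyclic i \<Longrightarrow> tensor_map (w(i := a)) = T a"
    "\<And>u v. u \<in> E i \<Longrightarrow> u (T v) = T (u v)"
    using tensor_map_slot[of w i] assms by metis
  have "u (w i) \<in> cyclic i"
  proof -
    obtain t where "t \<in> E i" "w i = t v0" using assms(1,2) by (auto simp: cyclic_def)
    then show ?thesis
      using operator_algebraD(2)[OF algebra[OF assms(2)] assms(3), of t]
      by (auto simp: cyclic_def intro!: exI[of _ "u \<circ> t"])
  qed
  then show ?thesis using T(1)[of "w i"] T(1)[of "u (w i)"] T(2)[OF assms(3)] assms by simp
qed

lemma tensor_map_const: "(\<And>i. i < r \<Longrightarrow> w i = v0) \<Longrightarrow> tensor_map w = v0"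
  using tensor_map_eq[of "\<lambda>_. id" w] operator_algebraD(1)[OF algebra] by (simp add: iterate_ops_id)

text \<open>Density gives, for each i, an operator in \<open>E i\<close> that sends w0 i to
  \<open>v0\<close> and kills the other i-th entries occurring in \<open>Q\<close>. The product of
  these maps the tensor of w0 to \<open>v0\<close> and every other tensor in \<open>Q\<close> to
  0.\<close>

lemma tensor_map_independent:
  assumes "v0 \<noteq> 0"
    and density: "\<And>i B b. i < r \<Longrightarrow> finite B \<Longrightarrow> B \<subseteq> cyclic i \<Longrightarrow> b \<in> cyclic i \<Longrightarrow> b \<notin> span B \<Longrightarrow>
      \<exists>u\<in>E i. (\<forall>x\<in>B. u x = 0) \<and> u b = v0"
    and B: "\<And>i. i < r \<Longrightarrow> independent (B i)" "\<And>i. i < r \<Longrightarrow> B i \<subseteq> cyclic i"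
    and Q: "finite Q" "Q \<subseteq> (\<Pi>\<^sub>E i\<in>{..<r}. B i)" and sum: "(\<Sum>w\<in>Q. scale (c w) (tensor_map w)) = 0"
    and w0: "w0 \<in> Q"
  shows "c w0 = 0"
proof -
  have QB: "w i \<in> B i" if "w \<in> Q" "i < r" for w i using Q(2) that by (auto simp: PiE_iff)
  have "\<exists>u\<in>E i. (\<forall>x\<in>(\<lambda>w. w i) ` Q - {w0 i}. u x = 0) \<and> u (w0 i) = v0" if i: "i < r" for i
  proof (rule density[OF i])
    have "w0 i \<notin> span (B i - {w0 i})" using B(1)[OF i] QB[OF w0 i] by (auto simp: dependent_def)
    then show "w0 i \<notin> span ((\<lambda>w. w i) ` Q - {w0 i})"
      using span_mono[of "(\<lambda>w. w i) ` Q - {w0 i}" "B i - {w0 i}"] QB i by blast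
  qed (use Q(1) QB B(2) w0 i in auto)
  then have "\<forall>i. \<exists>u. i < r \<longrightarrow> u \<in> E i \<and> (\<forall>x\<in>(\<lambda>w. w i) ` Q - {w0 i}. u x = 0) \<and> u (w0 i) = v0"
    by blast
  then obtain u where u: "\<And>i. i < r \<Longrightarrow> u i \<in> E i"
    "\<And>i w. i < r \<Longrightarrow> w \<in> Q \<Longrightarrow> w i \<noteq> w0 i \<Longrightarrow> u i (w i) = 0" "\<And>i. i < r \<Longrightarrow> u i (w0 i) = v0"
    by (metis (no_types, lifting) DiffI image_eqI singletonD)
  have val: "iterate_ops r u (tensor_map w) = (if w = w0 then v0 else 0)" if w: "w \<in> Q" for w
  proof -
    have "w i \<in> cyclic i" if "i < r" for i using QB[OF w that] B(2)[OF that] by blast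
    then obtain us where us: "\<And>i. i < r \<Longrightarrow> us i \<in> E i" "\<And>i. i < r \<Longrightarrow> us i v0 = w i"
      using choose_ops[of w] by blast
    let ?c = "\<lambda>i. u i \<circ> us i"
    have cE: "?c i \<in> E i" if "i < r" for i using operator_algebraD(2)[OF algebra u(1) us(1)] that by blast
    have "iterate_ops r u (tensor_map w) = iterate_ops r u (iterate_ops r us v0)"
      using tensor_map_eq[of us w] us by simp
    also have "\<dots> = iterate_ops r ?c v0" by (rule iterate_comp) (use u us in auto)
    finally have *: "iterate_ops r u (tensor_map w) = iterate_ops r ?c v0" .
    show ?thesis
    proof (cases "w = w0")
      case True
      have "iterate_ops r ?c v0 = iterate_ops r (\<lambda>_. id) v0"
        using cE us(2) u(3) True operator_algebraD(1)[OF algebra] by (intro iterate_determined) auto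
      then show ?thesis using * True by (simp add: iterate_ops_id)
    next
      case False
      have "w \<in> (\<Pi>\<^sub>E i\<in>{..<r}. B i)" "w0 \<in> (\<Pi>\<^sub>E i\<in>{..<r}. B i)" using Q(2) w w0 by auto
      then obtain i where i: "i < r" "w i \<noteq> w0 i" using False PiE_ext by (metis lessThan_iff)
      have "iterate_ops r ?c v0 = iterate_ops r (?c(i := id)) (?c i v0)"
        using cE i by (intro iterate_extract) auto
      also have "?c i v0 = 0" using us(2) u(2)[OF i(1) w i(2)] i by simp
      also have "iterate_ops r (?c(i := id)) 0 = 0"
        using cE operator_algebraD(1)[OF algebra] by (intro iterate_linear) auto
      finally show ?thesis by (simp only: * False if_False)
    qed
  qed
  have "0 = iterate_ops r u (\<Sum>w\<in>Q. scale (c w) (tensor_map w))"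
    using iterate_linear(3)[of r u] u(1) by (simp add: sum)
  also have "\<dots> = (\<Sum>w\<in>Q. scale (c w) (if w = w0 then v0 else 0))"
    using u(1) by (simp add: iterate_sum iterate_linear(2) val)
  also have "\<dots> = (\<Sum>w\<in>Q. if w = w0 then scale (c w) v0 else 0)" by (rule sum.cong) auto
  also have "\<dots> = scale (c w0) v0" using Q(1) w0 by simp
  finally show ?thesis using assms(1) by simp
qed

end

section \<open>A vector generating a simple module for every factor\<close>

text \<open>The copies g \<otimes> e i are recorded through their operators, because the e i are
  orthogonal idempotents only modulo the annihilator. In the application \<chi> i s is the residue
  of s at M i.\<close>

locale split_current_module = current_module scg br scS scV \<psi>
  for scg :: "'k::{alg_closed_field, field_char_0} \<Rightarrow> 'g::ab_group_add \<Rightarrow> 'g"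
    and br :: "'g \<Rightarrow> 'g \<Rightarrow> 'g"
    and scS :: "'k \<Rightarrow> 's::{comm_ring, comm_monoid_mult} \<Rightarrow> 's"
    and scV :: "'k \<Rightarrow> 'v::ab_group_add \<Rightarrow> 'v"
    and \<psi> :: "'g \<Rightarrow> 's \<Rightarrow> 'v \<Rightarrow> 'v" +
  fixes r :: nat and e :: "nat \<Rightarrow> 's" and \<chi> :: "nat \<Rightarrow> 's \<Rightarrow> 'k"
  assumes psi_orthogonal: "i < r \<Longrightarrow> j < r \<Longrightarrow> i \<noteq> j \<Longrightarrow> \<psi> x (e i * e j) v = 0"
    and psi_idempotent: "i < r \<Longrightarrow> \<psi> x (e i * e i) v = \<psi> x (e i) v"
    and psi_decomp: "\<psi> x s v = (\<Sum>i<r. scV (\<chi> i s) (\<psi> x (e i) v))"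
begin

text \<open>The image in End V of the enveloping algebra of the i-th copy g \<otimes> e i.\<close>

definition opE :: "nat \<Rightarrow> ('v \<Rightarrow> 'v) set"
  where "opE i = op_gen scV (range (\<lambda>x. \<psi> x (e i)))"

lemma psi_opE: "\<psi> x (e i) \<in> opE i"
  by (auto simp: opE_def intro: op_gen.base)

lemma opE_algebra: "operator_algebra scV (opE i)"
  unfolding opE_def by (rule V.operator_algebra_op_gen) (auto simp: endo_on_def psi_add psi_scale)

lemma psi_opE_commute:
  assumes "i < r" "j < r" "i \<noteq> j" "f \<in> opE j"
  shows "\<psi> x (e i) (f v) = f (\<psi> x (e i) v)"
  using assms(4) unfolding opE_def
proof (rule op_gen_commute)
  fix g v assume "g \<in> range (\<lambda>x. \<psi> x (e j))"
  then show "\<psi> x (e i) (g v) = g (\<psi> x (e i) v)"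
    using psi_comm[of x "e i"] psi_orthogonal[OF assms(1-3)] by auto
qed (auto simp: psi_add psi_scale)

lemma opE_commute:
  assumes "i < r" "j < r" "i \<noteq> j" "f \<in> opE i" "g \<in> opE j"
  shows "f (g v) = g (f v)"
  using assms(4) unfolding opE_def
  by (rule op_gen_commute[symmetric])
    (use psi_opE_commute[OF assms(1,2,3,5)] operator_algebraD(5,6)[OF opE_algebra assms(5)] in auto)

lemma commuting_algebras_opE: "commuting_algebras scV r opE"
  using opE_algebra opE_commute by unfold_locales

lemma split_irred:
  assumes "V.subspace U" "\<And>i x u. i < r \<Longrightarrow> u \<in> U \<Longrightarrow> \<psi> x (e i) u \<in> U"
  shows "U = {0} \<or> U = UNIV"
proof (rule irred[OF assms(1)])
  fix x s u assume "u \<in> U"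
  then show "\<psi> x s u \<in> U"
    unfolding psi_decomp[of x s] using assms by (auto intro!: V.subspace_sum V.subspace_scale)
qed

text \<open>For nonzero v the cyclic module of v is then simple, since each of its nonzero elements
  regenerates v. This form passes directly from v to d v when d commutes with
  \<open>opE i\<close>.\<close>

definition simple_at :: "nat \<Rightarrow> 'v \<Rightarrow> bool"
  where "simple_at i v \<longleftrightarrow> (\<forall>u\<in>opE i. u v \<noteq> 0 \<longrightarrow> (\<exists>u'\<in>opE i. u' (u v) = v))"

definition schur_at :: "nat \<Rightarrow> 'v \<Rightarrow> bool"
  where "schur_at i v \<longleftrightarrow> (\<forall>\<theta>. endo_on scV {u v |u. u \<in> opE i} \<theta> \<longrightarrow>
    (\<forall>u\<in>opE i. \<forall>w\<in>{u v |u. u \<in> opE i}. \<theta> (u w) = u (\<theta> w)) \<longrightarrow>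
    (\<exists>c. \<forall>w\<in>{u v |u. u \<in> opE i}. \<theta> w = scV c w))"

end

section \<open>Weights for the separate copies of the Cartan subalgebra\<close>

locale split_weight_module =
  split_current_module scg br scS scV \<psi> r e \<chi> + weight_current_module scg br scS scV \<psi> H B
  for scg :: "'k::{alg_closed_field, field_char_0} \<Rightarrow> 'g::ab_group_add \<Rightarrow> 'g"
    and br :: "'g \<Rightarrow> 'g \<Rightarrow> 'g"
    and scS :: "'k \<Rightarrow> 's::{comm_ring, comm_monoid_mult} \<Rightarrow> 's"
    and scV :: "'k \<Rightarrow> 'v::ab_group_add \<Rightarrow> 'v"
    and \<psi> :: "'g \<Rightarrow> 's \<Rightarrow> 'v \<Rightarrow> 'v"
    and r e \<chi> H B +
  assumes nonzero: "1 \<notin> annih"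
begin

text \<open>Weight spaces of the i-th copy of h. They may be infinite dimensional; finiteness is
  recovered when the conditions for all i are imposed together.\<close>

definition partial_wsp :: "nat \<Rightarrow> ('g \<Rightarrow> 'k) \<Rightarrow> 'v set"
  where "partial_wsp i \<nu> = {w. \<forall>h\<in>H. \<psi> h (e i) w = scV (\<nu> h) w}"

lemma subspace_partial_wsp: "V.subspace (partial_wsp i \<nu>)"
  by (auto simp: V.subspace_def partial_wsp_def psi_add psi_scale V.scale_right_distrib V.scale_left_commute)

lemma psi_partial_wsp:
  assumes "i < r" "j < r" "x \<in> rsp \<alpha>" "w \<in> partial_wsp j \<nu>"
  shows "\<psi> x (e i) w \<in> partial_wsp j (\<lambda>h. \<nu> h + (if i = j then \<alpha> h else 0))"
proof -
  have "\<psi> h (e j) (\<psi> x (e i) w) = scV (\<nu> h + (if i = j then \<alpha> h else 0)) (\<psi> x (e i) w)"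
    if "h \<in> H" for h
    using assms that psi_orthogonal[of j i] psi_idempotent[of j]
    by (auto simp: psi_comm[of h _ x] partial_wsp_def psi_scale rspD psi_scale_left V.scale_left_distrib)
  then show ?thesis by (simp add: partial_wsp_def)
qed

lemma span_partial_wsp:
  assumes j: "j < r" and v: "v \<in> partial_wsp j \<nu>" "v \<noteq> 0"
  shows "V.span (\<Union>\<nu>. partial_wsp j \<nu>) = UNIV"
proof -
  let ?U = "V.span (\<Union>\<nu>. partial_wsp j \<nu>)"
  have stable: "\<psi> x (e i) u \<in> ?U" if i: "i < r" and u: "u \<in> ?U" for i x u
  proof -
    have "?U \<subseteq> {w. \<psi> x (e i) w \<in> ?U}" if x: "x \<in> rsp \<alpha>" for x \<alpha>
    proof (rule V.span_minimal)
      show "(\<Union>\<nu>. partial_wsp j \<nu>) \<subseteq> {w. \<psi> x (e i) w \<in> ?U}"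
        using psi_partial_wsp[OF i j x] by (blast intro: V.span_base)
      show "V.subspace {w. \<psi> x (e i) w \<in> ?U}"
        by (auto simp: V.subspace_def psi_add psi_scale intro: V.span_add V.span_scale V.span_zero)
    qed
    then have "(\<Union>\<alpha>\<in>dual. rsp \<alpha>) \<subseteq> {x. \<psi> x (e i) u \<in> ?U}" using u by blast
    moreover have "g.subspace {x. \<psi> x (e i) u \<in> ?U}"
      by (auto simp: g.subspace_def psi_add_left psi_scale_left
          intro: V.span_add V.span_scale V.span_zero)
    ultimately have "g.span (\<Union>\<alpha>\<in>dual. rsp \<alpha>) \<subseteq> {x. \<psi> x (e i) u \<in> ?U}"
      by (rule g.span_minimal)
    then show ?thesis using rsp_span[OF nonzero] by blast
  qed
  have "?U = {0} \<or> ?U = UNIV" by (rule split_irred[OF V.subspace_span stable])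
  moreover have "v \<in> ?U" using v by (blast intro: V.span_base)
  ultimately show ?thesis using v(2) by blast
qed

text \<open>Lagrange interpolation: t is the product of the factors (h \<otimes> e j - \<nu>(h)) /
  (\<mu>(h) - \<nu>(h)) over \<nu> in \<Phi>, with h chosen for each \<nu> to tell it from
  \<mu>.\<close>

lemma weight_projection:
  assumes j: "j < r" and \<Phi>: "finite \<Phi>" "\<And>\<nu>. \<nu> \<in> \<Phi> \<Longrightarrow> \<exists>h\<in>H. \<nu> h \<noteq> \<mu> h"
  shows "\<exists>t\<in>opE j. (\<forall>w\<in>partial_wsp j \<mu>. t w = w) \<and> (\<forall>\<nu>\<in>\<Phi>. \<forall>w\<in>partial_wsp j \<nu>. t w = 0)"
proof -
  \<comment> \<open>The added conjunct, that t is scalar on each weight space, lets the next factor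
    act on t w by a known scalar.\<close>
  have "\<exists>t\<in>opE j. (\<forall>w\<in>partial_wsp j \<mu>. t w = w) \<and> (\<forall>\<nu>\<in>\<Phi>. \<forall>w\<in>partial_wsp j \<nu>. t w = 0) \<and>
      (\<forall>\<nu>. \<forall>w\<in>partial_wsp j \<nu>. \<exists>c. t w = scV c w)"
    using \<Phi>
  proof (induction \<Phi> rule: finite_induct)
    case empty
    show ?case
      by (rule bexI[of _ id]) (auto simp: operator_algebraD(1)[OF opE_algebra] intro: exI[of _ 1])
  next
    case (insert \<nu>0 \<Phi>)
    then obtain t where t: "t \<in> opE j" "\<And>w. w \<in> partial_wsp j \<mu> \<Longrightarrow> t w = w"
      "\<And>\<nu> w. \<nu> \<in> \<Phi> \<Longrightarrow> w \<in> partial_wsp j \<nu> \<Longrightarrow> t w = 0"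
      "\<And>\<nu> w. w \<in> partial_wsp j \<nu> \<Longrightarrow> \<exists>c. t w = scV c w" by auto
    obtain h where h: "h \<in> H" "\<nu>0 h \<noteq> \<mu> h" using insert.prems by auto
    let ?d = "inverse (\<mu> h - \<nu>0 h)"
    define t' where "t' w = scV ?d (\<psi> h (e j) (t w) + scV (- \<nu>0 h) (t w))" for w
    have "(\<lambda>w. scV ?d ((\<psi> h (e j) \<circ> t) w + scV (- \<nu>0 h) (t w))) \<in> opE j"
      by (intro operator_algebraD(2-4)[OF opE_algebra] psi_opE t(1))
    then have t'E: "t' \<in> opE j" by (simp only: t'_def[abs_def] o_apply)
    have val: "t' w = scV (?d * (\<nu> h - \<nu>0 h)) (t w)" if w: "w \<in> partial_wsp j \<nu>" for w \<nu>
    proof -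
      obtain c where "t w = scV c w" using t(4) w by blast
      then have "\<psi> h (e j) (t w) = scV (\<nu> h) (t w)"
        using w h(1) by (simp add: partial_wsp_def psi_scale V.scale_left_commute)
      then show ?thesis by (simp only: t'_def V.scale_left_distrib[symmetric] V.scale_scale) simp
    qed
    have "t' w = w" if "w \<in> partial_wsp j \<mu>" for w
      using val[OF that] t(2)[OF that] h(2) by simp
    moreover have "t' w = 0" if "\<nu> \<in> insert \<nu>0 \<Phi>" "w \<in> partial_wsp j \<nu>" for \<nu> w
      using val[OF that(2)] t(3)[of \<nu> w] that by auto
    moreover have "\<exists>c. t' w = scV c w" if "w \<in> partial_wsp j \<nu>" for w \<nu>
      using val[OF that] t(4)[OF that] by (metis V.scale_scale)
    ultimately show ?case using t'E by blast
  qed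
  then show ?thesis by blast
qed

text \<open>
  Every nonzero \<open>\<gg>\<^sub>j\<close>-submodule meets every weight space of the \<open>j\<close>-th copy of the Cartan subalgebra,
  because the other copies of \<open>\<gg>\<close> commute with it and sweep out the whole module.
\<close>

lemma partial_weight_vector:
  assumes j: "j < r" and v: "v \<in> partial_wsp j \<mu>" "v \<noteq> 0" and w: "w \<noteq> 0"
  obtains t where "t \<in> opE j" "t w \<noteq> 0" "t w \<in> partial_wsp j \<mu>"
proof -
  define R where "R = {\<psi> x (e i) |x i. i < r \<and> i \<noteq> j}"
  let ?D = "op_gen scV R"
  have D: "operator_algebra scV ?D"
    by (rule V.operator_algebra_op_gen) (auto simp: R_def endo_on_def psi_add psi_scale)
  have comm: "d (f u) = f (d u)" if "d \<in> ?D" and f: "f \<in> opE j" for d f u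
    using \<open>d \<in> ?D\<close>
  proof (rule op_gen_commute[symmetric])
    fix g u assume "g \<in> R"
    then show "f (g u) = g (f u)" using psi_opE_commute[OF _ j _ f] by (auto simp: R_def)
  qed (use operator_algebraD(5,6)[OF opE_algebra f] in auto)
  \<comment> \<open>The vectors reached from \<open>w\<close> by the j-th copy and then by the
    others. As the two commute, the span of \<open>S\<close> is stable, hence all of V.\<close>
  define S where "S = {d (u w) |d u. d \<in> ?D \<and> u \<in> opE j}"
  have stable: "\<psi> x (e i) y \<in> V.span S" if i: "i < r" and y: "y \<in> V.span S" for i x y
  proof -
    have "V.span S \<subseteq> {y. \<psi> x (e i) y \<in> V.span S}"
    proof (rule V.span_minimal)
      show "V.subspace {y. \<psi> x (e i) y \<in> V.span S}"
        by (auto simp: V.subspace_def psi_add psi_scale intro: V.span_add V.span_scale V.span_zero)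
      show "S \<subseteq> {y. \<psi> x (e i) y \<in> V.span S}"
      proof
        fix y assume "y \<in> S"
        then obtain d u where du: "d \<in> ?D" "u \<in> opE j" "y = d (u w)" by (auto simp: S_def)
        have "\<psi> x (e i) y \<in> S"
        proof (cases "i = j")
          case True
          have "\<psi> x (e i) y = d ((\<psi> x (e j) \<circ> u) w)"
            using comm[OF du(1) psi_opE] True du by simp
          then show ?thesis using operator_algebraD(2)[OF opE_algebra psi_opE du(2)] du(1) unfolding S_def by blast
        next
          case False
          then have "\<psi> x (e i) \<in> ?D" using i by (auto simp: R_def intro: op_gen.base)
          from operator_algebraD(2)[OF D this du(1)]
          have "\<psi> x (e i) \<circ> d \<in> ?D" .
          moreover have "\<psi> x (e i) y = (\<psi> x (e i) \<circ> d) (u w)" by (simp add: du)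
          ultimately show ?thesis using du(2) unfolding S_def by blast
        qed
        then show "y \<in> {y. \<psi> x (e i) y \<in> V.span S}" by (simp add: V.span_base)
      qed
    qed
    then show ?thesis using y by blast
  qed
  have "V.span S = {0} \<or> V.span S = UNIV" by (rule split_irred[OF V.subspace_span stable])
  moreover have "w = id (id w)" by simp
  then have "w \<in> S"
    using operator_algebraD(1)[OF D] operator_algebraD(1)[OF opE_algebra] unfolding S_def by blast
  then have "w \<in> V.span S" by (rule V.span_base)
  ultimately have "V.span S = UNIV" using w by blast
  then have "v \<in> V.span S" by simp
  then obtain T c where T: "finite T" "T \<subseteq> S" "v = (\<Sum>a\<in>T. scV (c a) a)"
    unfolding V.span_explicit by blast
  have "\<forall>a. \<exists>d u. a \<in> T \<longrightarrow> d \<in> ?D \<and> u \<in> opE j \<and> a = d (u w)"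
    using T(2) unfolding S_def by blast
  then obtain d u where du: "\<And>a. a \<in> T \<Longrightarrow> d a \<in> ?D \<and> u a \<in> opE j \<and> a = d a (u a w)" by metis
  have "\<forall>a. \<exists>Q. finite Q \<and> Q \<subseteq> (\<Union>\<nu>. partial_wsp j \<nu>) \<and> u a w \<in> V.span Q"
  proof
    fix a
    have "u a w \<in> V.span (\<Union>\<nu>. partial_wsp j \<nu>)" using span_partial_wsp[OF j v] by simp
    then obtain Q c where Q: "finite Q" "Q \<subseteq> (\<Union>\<nu>. partial_wsp j \<nu>)"
      "u a w = (\<Sum>b\<in>Q. scV (c b) b)"
      unfolding V.span_explicit by blast
    have "u a w \<in> V.span Q" unfolding Q(3) by (intro V.span_sum V.span_scale V.span_base)
    then show "\<exists>Q. finite Q \<and> Q \<subseteq> (\<Union>\<nu>. partial_wsp j \<nu>) \<and> u a w \<in> V.span Q"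
      using Q(1,2) by blast
  qed
  then obtain Q where Q: "\<And>a. finite (Q a)" "\<And>a. Q a \<subseteq> (\<Union>\<nu>. partial_wsp j \<nu>)" "\<And>a. u a w \<in> V.span (Q a)"
    by metis
  have "\<forall>b\<in>(\<Union>a\<in>T. Q a). \<exists>\<nu>. b \<in> partial_wsp j \<nu>" using Q(2) by blast
  then obtain wt where wt: "\<And>b. b \<in> (\<Union>a\<in>T. Q a) \<Longrightarrow> b \<in> partial_wsp j (wt b)" by metis
  \<comment> \<open>The weights differing from \<mu> on \<open>H\<close> among the finitely many
    that occur in the vectors u a w. Once they are projected away, only the \<mu>-part is
    left.\<close>
  let ?\<Phi> = "{\<nu>\<in>wt ` (\<Union>a\<in>T. Q a). \<exists>h\<in>H. \<nu> h \<noteq> \<mu> h}"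
  have "\<exists>t\<in>opE j. (\<forall>w\<in>partial_wsp j \<mu>. t w = w) \<and> (\<forall>\<nu>\<in>?\<Phi>. \<forall>w\<in>partial_wsp j \<nu>. t w = 0)"
    by (rule weight_projection[OF j]) (use T(1) Q(1) in auto)
  then obtain t where t: "t \<in> opE j" "\<forall>w\<in>partial_wsp j \<mu>. t w = w"
    "\<forall>\<nu>\<in>?\<Phi>. \<forall>w\<in>partial_wsp j \<nu>. t w = 0"
    by (elim bexE conjE)
  have lin: "t (x + y) = t x + t y" "t (scV k x) = scV k (t x)" "t 0 = 0" for x y k
    using operator_algebraD(5,6)[OF opE_algebra t(1)] V.operator_algebra_0[OF opE_algebra t(1)] by auto
  have tb: "t b \<in> partial_wsp j \<mu>" if b: "b \<in> (\<Union>a\<in>T. Q a)" for b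
  proof (cases "\<exists>h\<in>H. wt b h \<noteq> \<mu> h")
    case True
    then have "wt b \<in> ?\<Phi>" using b by blast
    then have "t b = 0" using t(3) wt[OF b] by blast
    then show ?thesis by (simp add: V.subspace_0[OF subspace_partial_wsp])
  next
    case False
    then have "b \<in> partial_wsp j \<mu>" using wt[OF b] by (simp add: partial_wsp_def)
    then show ?thesis using t(2) by simp
  qed
  have in_wsp: "t (u a w) \<in> partial_wsp j \<mu>" if a: "a \<in> T" for a
  proof -
    have "V.span (Q a) \<subseteq> {y. t y \<in> partial_wsp j \<mu>}"
    proof (rule V.span_minimal)
      show "V.subspace {y. t y \<in> partial_wsp j \<mu>}"
        using subspace_partial_wsp[of j \<mu>] by (auto simp: V.subspace_def lin)
    qed (use tb a in blast)
    then show ?thesis using Q(3) by blast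
  qed
  \<comment> \<open>v is a combination of the vectors d a (u a w), while t fixes v and commutes with
    each d a. If t killed every u a w, it would kill v.\<close>
  have "\<exists>a\<in>T. t (u a w) \<noteq> 0"
  proof (rule ccontr)
    assume *: "\<not> ?thesis"
    have "t a = 0" if a: "a \<in> T" for a
    proof -
      have "t a = d a (t (u a w))" using du[OF a] comm[of "d a" t "u a w"] t(1) by metis
      also have "\<dots> = 0" using * a V.operator_algebra_0[OF D] du[OF a] by simp
      finally show ?thesis .
    qed
    then have "t v = 0" unfolding T(3) V.operator_algebra_sum[OF opE_algebra t(1)] by (simp add: lin)
    then show False using t(2) v by auto
  qed
  then obtain a where a: "a \<in> T" "t (u a w) \<noteq> 0" by blast
  show thesis
  proof (rule that[of "t \<circ> u a"])
    show "t \<circ> u a \<in> opE j" using operator_algebraD(2)[OF opE_algebra t(1)] du[OF a(1)] by blast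
  qed (use a in_wsp in auto)
qed

text \<open>The copies are treated one after another. Replacing v by d v with d in
  \<open>opE n\<close> keeps simplicity for the earlier copies, which commute with d, so each round
  has to arrange minimality for the n-th copy only.\<close>

lemma exists_simple_vector:
  obtains v where "v \<noteq> 0" "\<And>i. i < r \<Longrightarrow> simple_at i v" "\<And>i. i < r \<Longrightarrow> schur_at i v"
proof -
  obtain \<mu> v0 where \<mu>: "\<mu> \<in> dual" "v0 \<in> wsp \<mu>" "v0 \<noteq> 0" by (rule exists_weight_vector)
  obtain C where C: "finite C" "wsp \<mu> \<subseteq> V.span C" using wsp_bounded[OF \<mu>(1)] by metis
  let ?F = "{\<psi> h s |h s. h \<in> H}"
  have endoF: "endo_on scV (wsp \<mu>) T" if "T \<in> ?F" for T
    using that psi_H[OF nonzero] by (auto intro!: endo_psi)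
  have commF: "T (T' w) = T' (T w)" if "T \<in> ?F" "T' \<in> ?F" for T T' w
    using that psi_H_comm[OF nonzero] by auto
  obtain v1 where v1: "v1 \<in> wsp \<mu>" "v1 \<noteq> 0" "\<And>T. T \<in> ?F \<Longrightarrow> \<exists>a. T v1 = scV a v1"
    by (rule common_eigenvector[OF V.vector_space_axioms subspace_wsp C \<mu>(2,3), of ?F])
      (use endoF commF in blast)+
  then have "\<forall>h s. \<exists>a. h \<in> H \<longrightarrow> \<psi> h s v1 = scV a v1" by blast
  then obtain L where L: "\<And>h s. h \<in> H \<Longrightarrow> \<psi> h s v1 = scV (L h s) v1" by metis
  define \<kappa> where "\<kappa> i h = L h (e i)" for i h
  define N where "N = {w. \<forall>i<r. w \<in> partial_wsp i (\<kappa> i)}"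
  have v1N: "v1 \<in> N" using L by (simp add: N_def partial_wsp_def \<kappa>_def)
  have sN: "V.subspace N"
    using subspace_partial_wsp by (auto simp: N_def V.subspace_def)
  \<comment> \<open>h \<otimes> 1 acts as the combination of the h \<otimes> e i with coefficients
    \<chi> i 1, so the joint eigenvalues determine the weight. This is where finite dimension comes
    from.\<close>
  have "N \<subseteq> wsp \<mu>"
  proof
    fix w assume w: "w \<in> N"
    have sum: "\<psi> h 1 w = scV (\<Sum>i<r. \<chi> i 1 * \<kappa> i h) w" if "w \<in> N" "h \<in> H" for h w
      using that unfolding psi_decomp[of h 1]
      by (simp add: N_def partial_wsp_def V.scale_sum_left)
    have "(\<Sum>i<r. \<chi> i 1 * \<kappa> i h) = \<mu> h" if "h \<in> H" for h
      using sum[OF v1N that] wspD[OF v1(1) that] v1(2) by simp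
    then show "w \<in> wsp \<mu>" using sum[OF w] by (simp add: wsp_def)
  qed
  then have NC: "N \<subseteq> V.span C" using C by blast
  have orbit_trans: "u w \<in> {f v |f. f \<in> opE i}" if u: "u \<in> opE i" and w: "w \<in> {f v |f. f \<in> opE i}" for u w v i
  proof -
    obtain f where "f \<in> opE i" "w = f v" using w by blast
    then show ?thesis
      using operator_algebraD(2)[OF opE_algebra u, of f] by (auto intro!: exI[of _ "u \<circ> f"])
  qed
  have other: "u v \<in> partial_wsp i (\<kappa> i)" if "i < r" "j < r" "i \<noteq> j" "u \<in> opE j" "v \<in> N" for i j u v
    using that psi_opE_commute[OF that(1-4)] operator_algebraD(6)[OF opE_algebra that(4)]
    by (auto simp: N_def partial_wsp_def)
  have "n \<le> r \<Longrightarrow> \<exists>v\<in>N. v \<noteq> 0 \<and> (\<forall>i<n. simple_at i v)" for n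
  proof (induction n)
    case 0
    then show ?case using v1N v1(2) by blast
  next
    case (Suc n)
    then obtain v where v: "v \<in> N" "v \<noteq> 0" "\<And>i. i < n \<Longrightarrow> simple_at i v" by auto
    have n: "n < r" using Suc by simp
    define Orb where "Orb v = {u v |u. u \<in> opE n}" for v
    have self: "w \<in> Orb w" for w
      using operator_algebraD(1)[OF opE_algebra] by (force simp: Orb_def intro: exI[of _ id])
    have Orb_trans: "u w \<in> Orb v" if "u \<in> opE n" "w \<in> Orb v" for u v w
      using orbit_trans that unfolding Orb_def by blast
    have sO: "V.subspace (Orb v)" for v unfolding Orb_def by (rule V.subspace_orbit[OF opE_algebra])
    \<comment> \<open>The submodules generated by nonzero vectors of \<open>N\<close> in the orbit
      of v, replaced by their traces on the finite-dimensional \<open>N\<close>, where a minimal one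
      exists.\<close>
    define \<A> where "\<A> = (\<lambda>v'. N \<inter> Orb v') ` {v' \<in> N \<inter> Orb v. v' \<noteq> 0}"
    have "\<A> \<noteq> {}" using v self by (auto simp: \<A>_def)
    moreover have "V.subspace A \<and> A \<subseteq> V.span C" if "A \<in> \<A>" for A
      using that V.subspace_inter[OF sN sO] NC by (auto simp: \<A>_def)
    ultimately have "\<exists>A\<in>\<A>. \<forall>A'\<in>\<A>. A' \<subseteq> A \<longrightarrow> A' = A"
      using V.minimal_subspace[OF C(1), of \<A>] by metis
    then obtain A where A: "A \<in> \<A>" "\<And>A'. A' \<in> \<A> \<Longrightarrow> A' \<subseteq> A \<Longrightarrow> A' = A" by blast
    then obtain v' where v': "v' \<in> N" "v' \<in> Orb v" "v' \<noteq> 0" "A = N \<inter> Orb v'" by (auto simp: \<A>_def)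
    obtain d where d: "d \<in> opE n" "v' = d v" using v'(2) by (auto simp: Orb_def)
    have "simple_at i v'" if i: "i < n" for i
      unfolding simple_at_def
    proof (intro ballI impI)
      fix u assume u: "u \<in> opE i" "u v' \<noteq> 0"
      have comm: "f (d x) = d (f x)" if "f \<in> opE i" for f x
        using opE_commute[of i n f d x] that d i n by simp
      have "u v \<noteq> 0" using u comm[OF u(1)] d V.operator_algebra_0[OF opE_algebra d(1)] by auto
      then obtain u' where "u' \<in> opE i" "u' (u v) = v" using v(3)[OF i] u by (auto simp: simple_at_def)
      then show "\<exists>u'\<in>opE i. u' (u v') = v'" using comm u d by (metis)
    qed
    moreover have "simple_at n v'"
      unfolding simple_at_def
    proof (intro ballI impI)
      fix u assume u: "u \<in> opE n" "u v' \<noteq> 0"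
      have "v' \<in> partial_wsp n (\<kappa> n)" using v'(1) n by (simp add: N_def)
      \<comment> \<open>An arbitrary nonzero u v' is first carried back into \<open>N\<close>. By
        minimality its orbit then has the same trace on \<open>N\<close> as that of v', so it
        contains v'.\<close>
      then obtain t where t: "t \<in> opE n" "t (u v') \<noteq> 0" "t (u v') \<in> partial_wsp n (\<kappa> n)"
        using partial_weight_vector[OF n _ v'(3) u(2)] by metis
      have tu: "t \<circ> u \<in> opE n" using operator_algebraD(2)[OF opE_algebra t(1) u(1)] .
      have "t (u v') \<in> N"
      proof -
        have "t (u v') \<in> partial_wsp i (\<kappa> i)" if "i < r" for i
          using other[OF that n _ tu v'(1)] t(3) by (cases "i = n") auto
        then show ?thesis by (simp add: N_def)
      qed
      moreover have "t (u v') \<in> Orb v" using Orb_trans[OF tu v'(2)] by simp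
      ultimately have "N \<inter> Orb (t (u v')) \<in> \<A>" using t(2) by (simp add: \<A>_def)
      moreover have "Orb (t (u v')) \<subseteq> Orb v'"
      proof
        fix y assume "y \<in> Orb (t (u v'))"
        then obtain f where "f \<in> opE n" "y = f ((t \<circ> u) v')" by (auto simp: Orb_def)
        then show "y \<in> Orb v'" using Orb_trans[OF _ Orb_trans[OF tu self]] by blast
      qed
      ultimately have "N \<inter> Orb (t (u v')) = A" using A(2) v'(4) by blast
      then have "v' \<in> Orb (t (u v'))" using v' self by blast
      then obtain f where f: "f \<in> opE n" "f (t (u v')) = v'" by (auto simp: Orb_def)
      have "f \<circ> t \<in> opE n" using operator_algebraD(2)[OF opE_algebra f(1) t(1)] .
      then show "\<exists>u'\<in>opE n. u' (u v') = v'" using f(2) by (intro bexI[of _ "f \<circ> t"]) auto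
    qed
    ultimately show ?case using v' by (metis less_Suc_eq)
  qed
  then obtain v where v: "v \<in> N" "v \<noteq> 0" "\<And>i. i < r \<Longrightarrow> simple_at i v" by blast
  have "schur_at i v" if i: "i < r" for i
    unfolding schur_at_def
  proof (intro allI impI)
    define W where "W = {u v |u. u \<in> opE i}"
    fix \<theta> assume \<theta>0: "endo_on scV {u v |u. u \<in> opE i} \<theta>"
      and comm0: "\<forall>u\<in>opE i. \<forall>w\<in>{u v |u. u \<in> opE i}. \<theta> (u w) = u (\<theta> w)"
    have \<theta>: "endo_on scV W \<theta>" using \<theta>0 by (simp only: W_def)
    have comm: "\<theta> (u w) = u (\<theta> w)" if "u \<in> opE i" "w \<in> W" for u w
      using comm0 that unfolding W_def by blast
    have sW: "V.subspace W" unfolding W_def by (rule V.subspace_orbit[OF opE_algebra])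
    \<comment> \<open>Schur's lemma through weights: \<theta> preserves \<open>N'\<close>, which
      contains v and lies in the finite-dimensional \<open>N\<close>, so \<theta> has an eigenvector
      there. Simplicity spreads its eigenvalue over \<open>W\<close>.\<close>
    define N' where "N' = W \<inter> partial_wsp i (\<kappa> i)"
    have sN': "V.subspace N'"
      unfolding N'_def by (rule V.subspace_inter[OF sW subspace_partial_wsp])
    have "N' \<subseteq> N"
    proof
      fix w assume w: "w \<in> N'"
      then obtain u where "u \<in> opE i" "w = u v" by (auto simp: N'_def W_def)
      then have "w \<in> partial_wsp l (\<kappa> l)" if "l < r" for l
        using other[OF that i _ _ v(1)] w by (cases "l = i") (auto simp: N'_def)
      then show "w \<in> N" by (simp add: N_def)
    qed
    then have N'C: "N' \<subseteq> V.span C" using NC by blast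
    have "\<theta> w \<in> N'" if w: "w \<in> N'" for w
    proof -
      have wW: "w \<in> W" using w by (simp add: N'_def)
      have "\<psi> h (e i) (\<theta> w) = scV (\<kappa> i h) (\<theta> w)" if "h \<in> H" for h
      proof -
        have "\<psi> h (e i) (\<theta> w) = \<theta> (\<psi> h (e i) w)" by (rule comm[OF psi_opE wW, symmetric])
        also have "\<psi> h (e i) w = scV (\<kappa> i h) w" using w that by (simp add: N'_def partial_wsp_def)
        finally show ?thesis using V.endo_onD(2)[OF \<theta> wW] by simp
      qed
      then show ?thesis using V.endo_onD(3)[OF \<theta> wW] by (simp add: N'_def partial_wsp_def)
    qed
    then have "\<theta> ` N' \<subseteq> N'" by blast
    moreover have "N' \<subseteq> W" by (simp add: N'_def)
    ultimately have eN': "endo_on scV N' \<theta>" using \<theta> unfolding endo_on_def by (simp add: subset_iff)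
    have "id v \<in> W" using operator_algebraD(1)[OF opE_algebra] unfolding W_def by blast
    then have vN': "v \<in> N'" using v(1) i by (simp add: N'_def N_def)
    obtain c w where w: "w \<in> N'" "w \<noteq> 0" "\<theta> w = scV c w"
      by (rule exists_eigenvector[OF V.vector_space_axioms sN' C(1) N'C eN' vN' v(2)])
    obtain u1 where u1: "u1 \<in> opE i" "w = u1 v" using w(1) by (auto simp: N'_def W_def)
    then obtain u' where u': "u' \<in> opE i" "u' w = v"
      using v(3)[OF i] w(2) by (auto simp: simple_at_def)
    have "\<theta> x = scV c x" if x: "x \<in> W" for x
    proof -
      obtain u where u: "u \<in> opE i" "x = u v" using x by (auto simp: W_def)
      have uu: "u \<circ> u' \<in> opE i" using operator_algebraD(2)[OF opE_algebra u(1) u'(1)] .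
      have "w \<in> W" using w(1) by (simp add: N'_def)
      then have "\<theta> ((u \<circ> u') w) = (u \<circ> u') (\<theta> w)" by (rule comm[OF uu])
      then show ?thesis
        using operator_algebraD(6)[OF opE_algebra uu] w(3) u(2) u'(2) by simp
    qed
    then show "\<exists>c. \<forall>w\<in>{u v |u. u \<in> opE i}. \<theta> w = scV c w" unfolding W_def by blast
  qed
  then show thesis using that v by blast
qed

end

section \<open>The isomorphism with the evaluation module\<close>

definition free_lift :: "('k::field \<Rightarrow> 'v::ab_group_add \<Rightarrow> 'v) \<Rightarrow> ('x \<Rightarrow> 'v) \<Rightarrow> ('x \<Rightarrow>\<^sub>0 'k) \<Rightarrow> 'v"
  where "free_lift scale \<Phi> p = (\<Sum>x\<in>Poly_Mapping.keys p. scale (Poly_Mapping.lookup p x) (\<Phi> x))"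

context vector_space
begin

lemma free_lift_superset:
  assumes "finite P" "Poly_Mapping.keys p \<subseteq> P"
  shows "free_lift scale \<Phi> p = (\<Sum>x\<in>P. scale (Poly_Mapping.lookup p x) (\<Phi> x))"
  unfolding free_lift_def by (intro sum.mono_neutral_left) (use assms in \<open>auto simp: in_keys_iff\<close>)

lemma free_lift_add: "free_lift scale \<Phi> (p + q) = free_lift scale \<Phi> p + free_lift scale \<Phi> q"
proof -
  let ?P = "Poly_Mapping.keys p \<union> Poly_Mapping.keys q"
  have "Poly_Mapping.keys (p + q) \<subseteq> ?P" by (rule keys_add)
  then show ?thesis
    by (simp add: free_lift_superset[of ?P] lookup_add scale_left_distrib sum.distrib)
qed

lemma free_lift_scale: "free_lift scale \<Phi> (fscale c p) = scale c (free_lift scale \<Phi> p)"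
  by (simp add: free_lift_superset[of "Poly_Mapping.keys p"] keys_fscale lookup_fscale scale_sum_right)

lemma free_lift_fgen [simp]: "free_lift scale \<Phi> (fgen x) = \<Phi> x"
  by (simp add: free_lift_def fgen_def)

lemma free_lift_0 [simp]: "free_lift scale \<Phi> 0 = 0"
  by (simp add: free_lift_def)

lemma free_lift_diff: "free_lift scale \<Phi> (p - q) = free_lift scale \<Phi> p - free_lift scale \<Phi> q"
  using free_lift_add[of \<Phi> "p - q" q] by simp

lemma free_lift_sum: "free_lift scale \<Phi> (\<Sum>i\<in>I. p i) = (\<Sum>i\<in>I. free_lift scale \<Phi> (p i))"
  by (induction I rule: infinite_finite_induct) (auto simp: free_lift_add)

lemma free_lift_span_eq_0:
  assumes "p \<in> free.span C" "\<And>q. q \<in> C \<Longrightarrow> free_lift scale \<Phi> q = 0"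
  shows "free_lift scale \<Phi> p = 0"
proof -
  have "free.subspace {p. free_lift scale \<Phi> p = 0}"
    by (auto simp: free.subspace_def free_lift_add free_lift_scale)
  then show ?thesis using free.span_minimal[of C "{p. free_lift scale \<Phi> p = 0}"] assms by blast
qed

end

lemma subspace_free_on: "free.subspace (free_on X :: ('x \<Rightarrow>\<^sub>0 'k::field) set)"
proof -
  have "(free_on X :: ('x \<Rightarrow>\<^sub>0 'k) set) = {p. \<forall>x. x \<notin> X \<longrightarrow> Poly_Mapping.lookup p x = 0}"
    by (auto simp: free_on_def in_keys_iff)
  then show ?thesis by (simp add: free.subspace_def lookup_add lookup_fscale)
qed

lemma fgen_free_on: "fgen x \<in> free_on X \<longleftrightarrow> x \<in> X"
  by (simp add: free_on_def fgen_def)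

context split_current_module
begin

context
  fixes v0 :: 'v
  assumes v0: "v0 \<noteq> 0" "\<And>i. i < r \<Longrightarrow> simple_at i v0" "\<And>i. i < r \<Longrightarrow> schur_at i v0"
begin

interpretation T: commuting_algebras scV r opE v0
  by (rule commuting_algebras_opE)

lemma subspace_cyclic: "V.subspace (T.cyclic i)"
  unfolding T.cyclic_def by (rule V.subspace_orbit[OF opE_algebra])

lemma opE_cyclic:
  assumes "u \<in> opE i" "w \<in> T.cyclic i"
  shows "u w \<in> T.cyclic i"
proof -
  obtain t where "t \<in> opE i" "w = t v0" using assms by (auto simp: T.cyclic_def)
  then show ?thesis
    using operator_algebraD(2)[OF opE_algebra assms(1), of t]
    by (auto simp: T.cyclic_def intro!: exI[of _ "u \<circ> t"])
qed

lemma v0_cyclic: "v0 \<in> T.cyclic i"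
  using operator_algebraD(1)[OF opE_algebra] by (force simp: T.cyclic_def intro: exI[of _ id])

lemma cyclic_density:
  assumes "i < r" "finite B" "B \<subseteq> T.cyclic i" "b \<in> T.cyclic i" "b \<notin> V.span B"
  shows "\<exists>u\<in>opE i. (\<forall>x\<in>B. u x = 0) \<and> u b = v0"
proof (rule V.density[OF opE_algebra T.cyclic_def _ _ assms(2-5)])
  show "\<exists>u'\<in>opE i. u' (u v0) = v0" if "u \<in> opE i" "u v0 \<noteq> 0" for u
    using v0(2)[OF assms(1)] that by (auto simp: simple_at_def)
  show "\<exists>c. \<forall>w\<in>T.cyclic i. \<theta> w = scV c w"
    if "endo_on scV (T.cyclic i) \<theta>" "\<And>u w. u \<in> opE i \<Longrightarrow> w \<in> T.cyclic i \<Longrightarrow> \<theta> (u w) = u (\<theta> w)" for \<theta>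
    using v0(3)[OF assms(1)] that unfolding schur_at_def T.cyclic_def by blast
qed

lemma irreducible_cyclic:
  assumes i: "i < r"
  shows "irreducible_rep scg br UNIV scV (T.cyclic i) (\<lambda>x. \<psi> x (e i))"
proof -
  have br: "\<psi> (br x y) (e i) v = \<psi> x (e i) (\<psi> y (e i) v) - \<psi> y (e i) (\<psi> x (e i) v)" for x y v
    using psi_br[of x y "e i" "e i" v] psi_idempotent[OF i] by simp
  have "lie_rep scg br UNIV scV (T.cyclic i) (\<lambda>x. \<psi> x (e i))"
    unfolding lie_rep_def
    using subspace_cyclic opE_cyclic[OF psi_opE] br
    by (simp add: psi_add psi_scale psi_add_left psi_scale_left)
  moreover have "T.cyclic i \<noteq> {0}" using v0_cyclic[of i] v0(1) by blast
  moreover have "U = {0} \<or> U = T.cyclic i"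
    if U: "V.subspace U" "U \<subseteq> T.cyclic i" "\<And>x u. u \<in> U \<Longrightarrow> \<psi> x (e i) u \<in> U" for U
  proof (cases "U = {0}")
    case False
    have stable: "f u \<in> U" if "f \<in> opE i" "u \<in> U" for f u
      by (rule V.op_gen_subspace[OF that(1)[unfolded opE_def] U(1) _ that(2)]) (use U(3) in blast)
    obtain w where w: "w \<in> U" "w \<noteq> 0" using False V.subspace_0[OF U(1)] by blast
    then obtain u where u: "u \<in> opE i" "w = u v0" using U(2) by (auto simp: T.cyclic_def)
    then obtain u' where "u' \<in> opE i" "u' w = v0"
      using v0(2)[OF i] w(2) by (auto simp: simple_at_def)
    then have "v0 \<in> U" using stable w(1) by metis
    then have "T.cyclic i \<subseteq> U" using stable by (auto simp: T.cyclic_def)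
    then show ?thesis using U(2) by blast
  qed simp
  ultimately show ?thesis unfolding irreducible_rep_def by simp
qed

abbreviation (input) "tuples \<equiv> (\<Pi>\<^sub>E i\<in>{..<r}. T.cyclic i)"
abbreviation (input) "rels \<equiv> multi_rels scV r T.cyclic"
abbreviation (input) "lift \<equiv> free_lift scV T.tensor_map"

lemma tuples_cyclic: "w \<in> tuples \<Longrightarrow> i < r \<Longrightarrow> w i \<in> T.cyclic i"
  by (auto simp: PiE_iff)

lemma lift_multi_gens: "q \<in> multi_gens scV r T.cyclic \<Longrightarrow> lift q = 0"
proof -
  assume "q \<in> multi_gens scV r T.cyclic"
  then consider
      (1) w i a b where "w \<in> tuples" "i < r" "a \<in> T.cyclic i" "b \<in> T.cyclic i"
        "q = fgen (w(i := a + b)) - fgen (w(i := a)) - fgen (w(i := b))"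
    | (2) w i c a where "w \<in> tuples" "i < r" "a \<in> T.cyclic i"
        "q = fgen (w(i := scV c a)) - fscale c (fgen (w(i := a)))"
    unfolding multi_gens_def by blast
  then show "lift q = 0"
  proof cases
    case 1
    obtain S where S: "\<And>u v. S (u + v) = S u + S v"
      "\<And>a. a \<in> T.cyclic i \<Longrightarrow> T.tensor_map (w(i := a)) = S a"
      using T.tensor_map_slot[of w i] tuples_cyclic[OF 1(1)] 1(2) by metis
    show ?thesis using 1 S V.subspace_add[OF subspace_cyclic 1(3,4)] by (simp add: V.free_lift_diff)
  next
    case 2
    obtain S where S: "\<And>c v. S (scV c v) = scV c (S v)"
      "\<And>a. a \<in> T.cyclic i \<Longrightarrow> T.tensor_map (w(i := a)) = S a"
      using T.tensor_map_slot[of w i] tuples_cyclic[OF 2(1)] 2(2) by metis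
    show ?thesis using 2 S V.subspace_scale[OF subspace_cyclic 2(3)]
      by (simp add: V.free_lift_diff V.free_lift_scale)
  qed
qed

lemma lift_rels: "q \<in> rels \<Longrightarrow> lift q = 0"
  unfolding multi_rels_def using V.free_lift_span_eq_0 lift_multi_gens by blast

lemma rels_free_on: "rels \<subseteq> free_on tuples"
  unfolding multi_rels_def
proof (rule free.span_minimal[OF _ subspace_free_on])
  have *: "fgen (w(i := a)) \<in> free_on tuples" if "w \<in> tuples" "i < r" "a \<in> T.cyclic i" for w i a
    using PiE_upd[OF that] by (simp add: fgen_free_on)
  show "multi_gens scV r T.cyclic \<subseteq> free_on tuples"
    unfolding multi_gens_def
    using * subspace_cyclic V.subspace_add V.subspace_scale
    by (auto intro!: free.subspace_diff[OF subspace_free_on] free.subspace_scale[OF subspace_free_on])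
qed

text \<open>Slots are expanded one at a time: in the induction the slots from k on already have
  entries in \<open>B\<close>, and the entries allowed in the slot just below them form a subspace
  containing its \<open>B\<close>.\<close>

lemma tensors_span:
  assumes B: "\<And>i. B i \<subseteq> T.cyclic i" "\<And>i. T.cyclic i \<subseteq> V.span (B i)" and w: "w \<in> tuples"
  shows "fgen w \<in> free.span (fgen ` (\<Pi>\<^sub>E i\<in>{..<r}. B i) \<union> multi_gens scV r T.cyclic)"
    (is "_ \<in> ?Z")
proof -
  have "k \<le> r \<Longrightarrow> w \<in> tuples \<Longrightarrow> (\<And>i. k \<le> i \<Longrightarrow> i < r \<Longrightarrow> w i \<in> B i) \<Longrightarrow> fgen w \<in> ?Z" for k w
  proof (induction k arbitrary: w)
    case 0
    then have "w \<in> (\<Pi>\<^sub>E i\<in>{..<r}. B i)" by (auto simp: PiE_iff)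
    then show ?case by (blast intro: free.span_base)
  next
    case (Suc k)
    have k: "k < r" using Suc.prems by simp
    let ?A = "{a \<in> T.cyclic k. fgen (w(k := a)) \<in> ?Z}"
    have gens: "q \<in> ?Z" if "q \<in> multi_gens scV r T.cyclic" for q
      using that by (blast intro: free.span_base)
    have "V.subspace ?A"
      unfolding V.subspace_def
    proof (intro conjI ballI allI)
      have z: "0 \<in> T.cyclic k" by (rule V.subspace_0[OF subspace_cyclic])
      have "fgen (w(k := scV 0 0)) - fscale 0 (fgen (w(k := 0))) \<in> ?Z"
        by (intro gens multi_gens_intros Suc.prems k z)
      then show "0 \<in> ?A" using z by simp
      fix a c assume a: "a \<in> ?A"
      have "fgen (w(k := scV c a)) - fscale c (fgen (w(k := a))) \<in> ?Z"
        using a by (intro gens multi_gens_intros Suc.prems k) auto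
      moreover have "fscale c (fgen (w(k := a))) \<in> ?Z" using a by (auto intro: free.span_scale)
      ultimately have "fgen (w(k := scV c a)) - fscale c (fgen (w(k := a))) + fscale c (fgen (w(k := a))) \<in> ?Z"
        by (rule free.span_add)
      then show "scV c a \<in> ?A" using a V.subspace_scale[OF subspace_cyclic] by simp
      fix b assume b: "b \<in> ?A"
      have "fgen (w(k := a + b)) - fgen (w(k := a)) - fgen (w(k := b)) \<in> ?Z"
        using a b by (intro gens multi_gens_intros Suc.prems k) auto
      moreover have "fgen (w(k := a)) + fgen (w(k := b)) \<in> ?Z" using a b by (auto intro: free.span_add)
      ultimately have "fgen (w(k := a + b)) - fgen (w(k := a)) - fgen (w(k := b)) +
          (fgen (w(k := a)) + fgen (w(k := b))) \<in> ?Z"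
        by (rule free.span_add)
      then show "a + b \<in> ?A" using a b V.subspace_add[OF subspace_cyclic] by simp
    qed
    moreover have "B k \<subseteq> ?A"
    proof
      fix b assume b: "b \<in> B k"
      have "fgen (w(k := b)) \<in> ?Z"
      proof (rule Suc.IH)
        show "w(k := b) \<in> tuples" using b B(1) k by (intro PiE_upd Suc.prems) auto
        show "(w(k := b)) i \<in> B i" if "k \<le> i" "i < r" for i
          using that b Suc.prems(3)[of i] by (cases "i = k") auto
      qed (use k in simp)
      then show "b \<in> ?A" using b B(1) by blast
    qed
    ultimately have "V.span (B k) \<subseteq> ?A" by (rule_tac V.span_minimal)
    moreover have "w k \<in> V.span (B k)" using tuples_cyclic[OF Suc.prems(2) k] B(2) by blast
    ultimately show ?case by auto
  qed
  from this[of r] w show ?thesis by simp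
qed

text \<open>Modulo the relations p becomes a combination q of tensors of basis vectors. These have
  independent images by \<open>tensor_map_independent\<close>, so q = 0 and p is a relation.\<close>

lemma lift_kernel:
  assumes p: "p \<in> free_on tuples" "lift p = 0"
  shows "p \<in> rels"
proof -
  have "\<forall>i. \<exists>B. B \<subseteq> T.cyclic i \<and> V.independent B \<and> T.cyclic i \<subseteq> V.span B"
    using V.maximal_independent_subset by metis
  then obtain B where B: "\<And>i. B i \<subseteq> T.cyclic i" "\<And>i. V.independent (B i)"
    "\<And>i. T.cyclic i \<subseteq> V.span (B i)" by metis
  let ?P = "\<Pi>\<^sub>E i\<in>{..<r}. B i"
  have "fgen ` tuples \<subseteq> free.span (fgen ` ?P \<union> multi_gens scV r T.cyclic)"
    using tensors_span[OF B(1,3)] by blast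
  then have "free.span (fgen ` tuples) \<subseteq> free.span (fgen ` ?P \<union> multi_gens scV r T.cyclic)"
    by (rule free.span_minimal[OF _ free.subspace_span])
  then have "p \<in> free.span (fgen ` ?P \<union> multi_gens scV r T.cyclic)"
    using free_on_span[OF p(1)] by blast
  then obtain q q' where q: "p = q + q'" "q \<in> free.span (fgen ` ?P)" "q' \<in> rels"
    unfolding free.span_Un multi_rels_def by (elim CollectE exE conjE)
  have "fgen ` ?P \<subseteq> free_on ?P" by (simp only: image_subset_iff fgen_free_on) simp
  from subsetD[OF free.span_minimal[OF this subspace_free_on] q(2)] have "q \<in> free_on ?P" .
  then have keys: "Poly_Mapping.keys q \<subseteq> ?P" by (simp add: free_on_def)
  have "lift q = 0" using p(2) lift_rels[OF q(3)] by (simp add: q(1) V.free_lift_add)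
  then have sum: "(\<Sum>w\<in>Poly_Mapping.keys q. scV (Poly_Mapping.lookup q w) (T.tensor_map w)) = 0"
    by (simp add: free_lift_def)
  have zero: "Poly_Mapping.lookup q w = 0" if "w \<in> Poly_Mapping.keys q" for w
    by (rule T.tensor_map_independent[OF v0(1) cyclic_density B(2) B(1) finite_keys keys sum that])
  have "q = 0"
  proof (rule poly_mapping_eqI)
    show "Poly_Mapping.lookup q w = Poly_Mapping.lookup 0 w" for w
      using zero[of w] by (cases "w \<in> Poly_Mapping.keys q") (simp_all add: in_keys_iff)
  qed
  then show ?thesis using q by simp
qed

text \<open>x \<otimes> s acts as the sum of \<chi> i s times x \<otimes> e i, and x \<otimes> e i
  reaches slot i by commuting past the other factors. With \<chi> i s read as s(M i), this is the
  evaluation formula.\<close>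

lemma psi_lift:
  assumes "w \<in> tuples"
  shows "\<psi> x s (T.tensor_map w) =
    (\<Sum>i<r. scV (\<chi> i s) (T.tensor_map (w(i := \<psi> x (e i) (w i)))))"
  unfolding psi_decomp[of x s]
  by (rule sum.cong)
    (use T.tensor_map_act[OF tuples_cyclic[OF assms] _ psi_opE] in auto)

lemma lift_surj: "lift ` free_on tuples = UNIV"
proof -
  let ?U = "lift ` free_on tuples"
  have sub: "V.subspace ?U"
    unfolding V.subspace_def
  proof (intro conjI ballI allI)
    have "0 \<in> free_on tuples" by (rule free.subspace_0[OF subspace_free_on])
    then show "0 \<in> ?U" by force
    fix x c assume "x \<in> ?U"
    then obtain p where p: "p \<in> free_on tuples" "x = lift p" by blast
    then show "scV c x \<in> ?U"
      using free.subspace_scale[OF subspace_free_on p(1), of c] by (force simp: V.free_lift_scale)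
    fix y assume "y \<in> ?U"
    then obtain q where "q \<in> free_on tuples" "y = lift q" by blast
    then show "x + y \<in> ?U"
      using free.subspace_add[OF subspace_free_on p(1), of q] p by (force simp: V.free_lift_add)
  qed
  have gen: "T.tensor_map w \<in> ?U" if "w \<in> tuples" for w
  proof -
    have "T.tensor_map w = lift (fgen w)" by simp
    moreover have "fgen w \<in> free_on tuples" using that by (simp add: fgen_free_on)
    ultimately show ?thesis by (rule image_eqI)
  qed
  have stable: "\<psi> x s u \<in> ?U" if "u \<in> ?U" for x s u
  proof -
    obtain p where p: "p \<in> free_on tuples" "u = lift p" using \<open>u \<in> ?U\<close> by blast
    have "\<psi> x s (T.tensor_map w) \<in> ?U" if w: "w \<in> tuples" for w
      unfolding psi_lift[OF w]
      by (intro V.subspace_sum[OF sub] V.subspace_scale[OF sub] gen PiE_upd[OF w])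
        (auto intro: opE_cyclic[OF psi_opE tuples_cyclic[OF w]])
    then have "(\<Sum>w\<in>Poly_Mapping.keys p. scV (Poly_Mapping.lookup p w) (\<psi> x s (T.tensor_map w))) \<in> ?U"
      using p(1) by (intro V.subspace_sum[OF sub] V.subspace_scale[OF sub]) (auto simp: free_on_def)
    moreover have "\<psi> x s u = (\<Sum>w\<in>Poly_Mapping.keys p. scV (Poly_Mapping.lookup p w) (\<psi> x s (T.tensor_map w)))"
      by (simp add: p(2) free_lift_def psi_sum psi_scale)
    ultimately show ?thesis by simp
  qed
  have "?U = {0} \<or> ?U = UNIV" by (rule irred[OF sub stable])
  moreover have "v0 \<in> ?U"
  proof -
    let ?w = "\<lambda>i\<in>{..<r}. v0"
    have "?w \<in> tuples" using v0_cyclic by auto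
    moreover have "T.tensor_map ?w = v0" by (rule T.tensor_map_const) simp
    ultimately show ?thesis using gen by metis
  qed
  ultimately show ?thesis using v0(1) by blast
qed

lemma evaluation_module_iso:
  assumes \<phi>: "\<And>p v. \<phi> (p +o tensor_rels scg scS) v = free_lift scV (\<lambda>(x, s). \<psi> x s v) p"
    and \<chi>: "\<And>i s. i < r \<Longrightarrow> \<chi> i s = residue scS (M i) s"
  shows "\<exists>f. module_iso (tensor_space scg scS) (multi_scale scV r T.cyclic)
    (multi_space scV r T.cyclic) (eval_action scS scV r M T.cyclic (\<lambda>i x. \<psi> x (e i))) scV UNIV \<phi> f"
proof -
  define f where "f A = lift (SOME p. p \<in> A)" for A
  \<comment> \<open>Covers any nonempty set on which \<open>lift\<close> is constant: cosets, where
    the choice made by \<open>f\<close> is harmless because \<open>lift\<close> kills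
    \<open>rels\<close>, and also the set produced by \<open>eval_action\<close>.\<close>
  have f_const: "f A = v" if "A \<noteq> {}" "\<And>p. p \<in> A \<Longrightarrow> lift p = v" for A v
    using that someI_ex[of "\<lambda>p. p \<in> A"] by (auto simp: f_def)
  have self: "p \<in> p +o rels" for p
    using free.span_zero by (force simp: multi_rels_def elt_set_plus_def)
  have f_coset: "f (p +o rels) = lift p" for p
    using self by (intro f_const) (auto simp: elt_set_plus_def V.free_lift_add lift_rels)
  have space: "multi_space scV r T.cyclic = (\<lambda>p. p +o rels) ` free_on tuples"
    by (simp add: multi_space_def)
  have "bij_betw f (multi_space scV r T.cyclic) UNIV"
    unfolding bij_betw_def
  proof
    show "inj_on f (multi_space scV r T.cyclic)"
      unfolding space
    proof (rule inj_onI, clarify)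
      fix p q assume "p \<in> free_on tuples" "q \<in> free_on tuples" "f (p +o rels) = f (q +o rels)"
      then have "p - q \<in> rels"
        by (intro lift_kernel) (auto simp: f_coset V.free_lift_diff free.subspace_diff[OF subspace_free_on])
      then show "p +o rels = q +o rels" unfolding multi_rels_def by (rule coset_eqI)
    qed
    show "f ` multi_space scV r T.cyclic = UNIV"
      unfolding space image_image f_coset using lift_surj .
  qed
  moreover have "f (A + B) = f A + f B"
    if A: "A \<in> multi_space scV r T.cyclic" and B: "B \<in> multi_space scV r T.cyclic" for A B
  proof -
    obtain p where "A = p +o rels" using A unfolding space by blast
    moreover obtain q where "B = q +o rels" using B unfolding space by blast
    ultimately have AB: "A = p +o rels" "B = q +o rels" .
    have "A + B = (p + q) +o rels" unfolding AB multi_rels_def by (rule coset_add)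
    then show ?thesis by (simp add: AB f_coset V.free_lift_add)
  qed
  moreover have "f (multi_scale scV r T.cyclic c A) = scV c (f A)"
    if A0: "A \<in> multi_space scV r T.cyclic" for A c
  proof -
    obtain p where A: "A = p +o rels" using A0 unfolding space by blast
    have "multi_scale scV r T.cyclic c A = fscale c p +o rels"
      unfolding A multi_scale_def multi_rels_def by (rule coset_scale)
    then show ?thesis by (simp add: A f_coset V.free_lift_scale)
  qed
  moreover have "f (eval_action scS scV r M T.cyclic (\<lambda>i x. \<psi> x (e i)) A B) = \<phi> A (f B)"
    if A: "A \<in> tensor_space scg scS" and B: "B \<in> multi_space scV r T.cyclic" for A B
  proof -
    let ?G = "\<lambda>(x, s) w. \<Sum>i<r. fscale (residue scS (M i) s) (fgen (w(i := \<psi> x (e i) (w i))))"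
    obtain p where p: "A = p +o tensor_rels scg scS" using A by (auto simp: tensor_space_def)
    obtain q where q: "B = q +o rels" "q \<in> free_on tuples" using B unfolding space by blast
    have G: "lift (?G (x, s) w) = \<psi> x s (T.tensor_map w)" if "w \<in> tuples" for x s w
      using psi_lift[OF that] \<chi> by (simp add: V.free_lift_sum V.free_lift_scale)
    have bil: "lift (bilinear_ext ?G p' q') = free_lift scV (\<lambda>(x, s). \<psi> x s (lift q')) p'"
      if q': "q' \<in> free_on tuples" for p' q'
    proof -
      have "lift (bilinear_ext ?G p' q') = (\<Sum>y\<in>Poly_Mapping.keys p'. \<Sum>w\<in>Poly_Mapping.keys q'.
          scV (Poly_Mapping.lookup p' y * Poly_Mapping.lookup q' w) (lift (?G y w)))"
        by (simp add: bilinear_ext_def V.free_lift_sum V.free_lift_scale)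
      also have "\<dots> = (\<Sum>y\<in>Poly_Mapping.keys p'. scV (Poly_Mapping.lookup p' y)
          ((\<lambda>(x, s). \<psi> x s (lift q')) y))"
      proof (rule sum.cong[OF refl])
        fix y assume "y \<in> Poly_Mapping.keys p'"
        obtain x s where y: "y = (x, s)" by fastforce
        have "lift (?G y w) = \<psi> x s (T.tensor_map w)" if "w \<in> Poly_Mapping.keys q'" for w
          unfolding y using q' that by (intro G) (auto simp: free_on_def)
        then show "(\<Sum>w\<in>Poly_Mapping.keys q'.
            scV (Poly_Mapping.lookup p' y * Poly_Mapping.lookup q' w) (lift (?G y w))) =
          scV (Poly_Mapping.lookup p' y) ((\<lambda>(x, s). \<psi> x s (lift q')) y)"
          by (simp add: y free_lift_def psi_sum psi_scale V.scale_sum_right)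
      qed
      finally show ?thesis by (simp add: free_lift_def)
    qed
    have "f (eval_action scS scV r M T.cyclic (\<lambda>i x. \<psi> x (e i)) A B) = \<phi> A (lift q)"
    proof (rule f_const)
      fix t assume "t \<in> eval_action scS scV r M T.cyclic (\<lambda>i x. \<psi> x (e i)) A B"
      then obtain p' q' c where t: "p' \<in> A" "q' \<in> B" "c \<in> rels" "t = bilinear_ext ?G p' q' + c"
        unfolding eval_action_def qbilinear_def set_plus_def by blast
      obtain a b where ab: "a \<in> tensor_rels scg scS" "p' = p + a" "b \<in> rels" "q' = q + b"
        using t p q by (auto simp: elt_set_plus_def)
      have "q' \<in> free_on tuples"
        unfolding ab using q(2) ab(3) rels_free_on free.subspace_add[OF subspace_free_on] by blast
      then have "lift t = free_lift scV (\<lambda>(x, s). \<psi> x s (lift q')) p'"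
        using bil t lift_rels by (simp add: V.free_lift_add)
      also have "lift q' = lift q" using ab lift_rels by (simp add: V.free_lift_add)
      also have "free_lift scV (\<lambda>(x, s). \<psi> x s (lift q)) p' = \<phi> (p' +o tensor_rels scg scS) (lift q)"
        by (rule \<phi>[symmetric])
      also have "p' +o tensor_rels scg scS = A"
        unfolding p using ab(1,2) unfolding tensor_rels_def by (intro coset_eqI) simp
      finally show "lift t = \<phi> A (lift q)" .
    next
      have "p \<in> A" unfolding p using free.span_zero by (force simp: tensor_rels_def elt_set_plus_def)
      moreover have "q \<in> B" unfolding q by (rule self)
      moreover have "0 \<in> rels" by (simp add: multi_rels_def free.span_zero)
      ultimately show "eval_action scS scV r M T.cyclic (\<lambda>i x. \<psi> x (e i)) A B \<noteq> {}"
        unfolding eval_action_def qbilinear_def set_plus_def by blast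
    qed
    then show ?thesis by (simp add: q f_coset)
  qed
  ultimately show ?thesis unfolding module_iso_def by blast
qed

end

lemma evaluation_module:
  assumes "v0 \<noteq> 0" "\<And>i. i < r \<Longrightarrow> simple_at i v0" "\<And>i. i < r \<Longrightarrow> schur_at i v0"
    and "\<And>p v. \<phi> (p +o tensor_rels scg scS) v = free_lift scV (\<lambda>(x, s). \<psi> x s v) p"
    and "\<And>i s. i < r \<Longrightarrow> \<chi> i s = residue scS (M i) s"
  shows "\<exists>W f. (\<forall>i<r. irreducible_rep scg br UNIV scV (W i) (\<lambda>x. \<psi> x (e i))) \<and>
    module_iso (tensor_space scg scS) (multi_scale scV r W) (multi_space scV r W)
      (eval_action scS scV r M W (\<lambda>i x. \<psi> x (e i))) scV UNIV \<phi> f"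
  using irreducible_cyclic[OF assms(1-3)] evaluation_module_iso[OF assms] by blast

end

section \<open>From the representation on cosets to operators on pure tensors\<close>

lemma phi_coset:
  assumes "vector_space scV"
    and rep: "lie_rep (tensor_scale scg scS) tbr (tensor_space scg scS) scV UNIV \<phi>"
  shows "\<phi> (p +o tensor_rels scg scS) v =
    free_lift scV (\<lambda>(x, s). \<phi> (pure_tensor scg scS x s) v) p"
proof -
  interpret V: vector_space scV by fact
  let ?R = "tensor_rels scg scS"
  have mem: "q +o ?R \<in> tensor_space scg scS" for q by (simp add: tensor_space_def free_on_def)
  have add: "\<phi> ((q + q') +o ?R) v = \<phi> (q +o ?R) v + \<phi> (q' +o ?R) v" for q q'
  proof -
    have "(q + q') +o ?R = (q +o ?R) + (q' +o ?R)" unfolding tensor_rels_def by (rule coset_add[symmetric])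
    then show ?thesis using rep mem[of q] mem[of q'] unfolding lie_rep_def by simp
  qed
  have sc: "\<phi> (fscale c q +o ?R) v = scV c (\<phi> (q +o ?R) v)" for c q
  proof -
    have "fscale c q +o ?R = tensor_scale scg scS c (q +o ?R)"
      unfolding tensor_rels_def tensor_scale_def by (rule coset_scale[symmetric])
    then show ?thesis using rep mem[of q] unfolding lie_rep_def by simp
  qed
  let ?E = "{p. \<phi> (p +o ?R) v = free_lift scV (\<lambda>(x, s). \<phi> (pure_tensor scg scS x s) v) p}"
  have "free.subspace ?E"
    unfolding free.subspace_def
    using sc[of 0 0] by (auto simp: add sc V.free_lift_add V.free_lift_scale)
  moreover have "range fgen \<subseteq> ?E" by (auto simp: pure_tensor_def)
  ultimately have "free.span (range fgen) \<subseteq> ?E" by (rule_tac free.span_minimal)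
  then show ?thesis using span_UNIV_fgen by blast
qed

lemma current_module_pure_tensor:
  fixes scg :: "'k::{alg_closed_field, field_char_0} \<Rightarrow> 'g::ab_group_add \<Rightarrow> 'g"
    and scS :: "'k \<Rightarrow> 's::{comm_ring, comm_monoid_mult} \<Rightarrow> 's"
    and scV :: "'k \<Rightarrow> 'v::ab_group_add \<Rightarrow> 'v"
  assumes g: "simple_lie_algebra scg br" "\<exists>B. finite_dimensional_vector_space scg B"
    and S: "comm_algebra scS" and V: "vector_space scV"
    and \<phi>: "irreducible_rep (tensor_scale scg scS) (tensor_bracket scg br scS) (tensor_space scg scS)
           scV UNIV \<phi>"
  shows "current_module scg br scS scV (\<lambda>x s. \<phi> (pure_tensor scg scS x s))"
proof -
  have lie: "lie_algebra scg br" using g(1) by (simp add: simple_lie_algebra_def)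
  interpret g: lie_algebra scg br by (rule lie)
  interpret S: comm_algebra scS by (rule S)
  interpret V: vector_space scV by (rule V)
  have rep: "lie_rep (tensor_scale scg scS) (tensor_bracket scg br scS) (tensor_space scg scS) scV UNIV \<phi>"
    using \<phi> by (simp add: irreducible_rep_def)
  have mem: "pure_tensor scg scS x s \<in> tensor_space scg scS" for x s
    by (simp add: pure_tensor_def tensor_space_def free_on_def)
  note repD = rep[unfolded lie_rep_def]
  show ?thesis
  proof
    fix x y :: 'g and s t :: 's and v w :: 'v and c :: 'k
    let ?\<psi> = "\<lambda>x s. \<phi> (pure_tensor scg scS x s)"
    show "?\<psi> (x + y) s v = ?\<psi> x s v + ?\<psi> y s v" "?\<psi> x (s + t) v = ?\<psi> x s v + ?\<psi> x t v"
      "?\<psi> (scg c x) s v = scV c (?\<psi> x s v)" "?\<psi> x (scS c s) v = scV c (?\<psi> x s v)"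
      "?\<psi> x s (v + w) = ?\<psi> x s v + ?\<psi> x s w" "?\<psi> x s (scV c v) = scV c (?\<psi> x s v)"
      using repD mem by (simp_all add: pure_tensor_bilinear)
    show "?\<psi> (br x y) (s * t) v = ?\<psi> x s (?\<psi> y t v) - ?\<psi> y t (?\<psi> x s v)"
      using repD mem tensor_bracket_pure[OF lie S, of x s y t] by (metis UNIV_I)
  next
    fix U assume U: "V.subspace U" "\<And>x s u. u \<in> U \<Longrightarrow> \<phi> (pure_tensor scg scS x s) u \<in> U"
    have "\<phi> A u \<in> U" if A: "A \<in> tensor_space scg scS" and u: "u \<in> U" for A u
    proof -
      obtain p where "A = p +o tensor_rels scg scS" using A by (auto simp: tensor_space_def)
      then have "\<phi> A u = free_lift scV (\<lambda>(x, s). \<phi> (pure_tensor scg scS x s) u) p"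
        using phi_coset[OF V rep] by simp
      also have "\<dots> \<in> U"
        unfolding free_lift_def
        by (intro V.subspace_sum[OF U(1)] V.subspace_scale[OF U(1)]) (use U(2) u in auto)
      finally show ?thesis .
    qed
    then show "U = {0} \<or> U = UNIV" using \<phi> U(1) unfolding irreducible_rep_def by blast
  next
    show "\<exists>v::'v. v \<noteq> 0" using \<phi> unfolding irreducible_rep_def by blast
    show "I = {0} \<or> I = UNIV" if "lie_ideal scg br I" for I
      using g(1) that by (simp add: simple_lie_algebra_def)
    show "\<exists>x y. br x y \<noteq> 0" using g(1) by (simp add: simple_lie_algebra_def)
    obtain B where "finite_dimensional_vector_space scg B" using g(2) by blast
    then interpret finite_dimensional_vector_space scg B .
    show "\<exists>X. finite X \<and> g.span X = UNIV" using finite_Basis span_Basis by blast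
  qed
qed

text \<open>Semisimplicity comes from the uniqueness of weight decompositions. If (h - b)^2 v = 0,
  the vectors (\<mu>(h) - b)^2 v_\<mu> decompose 0 and so vanish, and with them the components
  (\<mu>(h) - b) v_\<mu> of w.\<close>

lemma weight_current_module_admissible:
  fixes scg :: "'k::{alg_closed_field, field_char_0} \<Rightarrow> 'g::ab_group_add \<Rightarrow> 'g"
    and scS :: "'k \<Rightarrow> 's::{comm_ring, comm_monoid_mult} \<Rightarrow> 's"
    and scV :: "'k \<Rightarrow> 'v::ab_group_add \<Rightarrow> 'v"
  assumes "current_module scg br scS scV (\<lambda>x s. \<phi> (pure_tensor scg scS x s))"
    and H: "cartan_subalgebra scg br H" and adm: "admissible scg H scS scV \<phi>"
  shows "\<exists>B. weight_current_module scg br scS scV (\<lambda>x s. \<phi> (pure_tensor scg scS x s)) H B"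
proof -
  define \<psi> where "\<psi> = (\<lambda>x s. \<phi> (pure_tensor scg scS x s))"
  interpret current_module scg br scS scV \<psi> unfolding \<psi>_def by fact
  let ?W = "\<lambda>\<mu>. {v. \<forall>h\<in>H. \<psi> h 1 v = scV (\<mu> h) v}"
  have W: "weight_space scg H scS scV \<phi> = ?W"
    by (simp add: weight_space_def \<psi>_def fun_eq_iff)
  have wm: "weight_module scg H scS scV \<phi>" using adm by (simp add: admissible_def)
  let ?dec = "\<lambda>(d :: ('g \<Rightarrow> 'k) \<Rightarrow>\<^sub>0 'v) v. Poly_Mapping.keys d \<subseteq> dual_space scg H \<and>
      (\<forall>\<mu>\<in>Poly_Mapping.keys d. Poly_Mapping.lookup d \<mu> \<in> ?W \<mu>) \<and>
      v = (\<Sum>\<mu>\<in>Poly_Mapping.keys d. Poly_Mapping.lookup d \<mu>)"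
  have dec: "\<exists>!d. ?dec d v" for v using wm by (simp add: weight_module_def W)
  obtain B where B: "\<And>\<mu>. \<mu> \<in> dual_space scg H \<Longrightarrow> V.dim (?W \<mu>) \<le> B"
    using adm unfolding admissible_def W by blast
  have sub: "V.subspace (?W \<mu>)" for \<mu>
    by (auto simp: V.subspace_def psi_add psi_scale V.scale_right_distrib V.scale_left_commute)
  have "weight_current_module scg br scS scV \<psi> H B"
  proof
    show "g.subspace H" using H by (simp add: cartan_subalgebra_def lie_subalgebra_def)
    show "x \<in> H" if "\<And>y. y \<in> H \<Longrightarrow> br x y \<in> H" for x
      using H that unfolding cartan_subalgebra_def by blast
    show "V.span (\<Union>\<mu>\<in>dual_space scg H. ?W \<mu>) = UNIV"
    proof -
      have "v \<in> V.span (\<Union>\<mu>\<in>dual_space scg H. ?W \<mu>)" for v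
      proof -
        obtain d where d: "?dec d v" using dec by blast
        have "Poly_Mapping.lookup d \<mu> \<in> V.span (\<Union>\<mu>\<in>dual_space scg H. ?W \<mu>)"
          if "\<mu> \<in> Poly_Mapping.keys d" for \<mu>
        proof (rule V.span_base, rule UN_I)
          show "\<mu> \<in> dual_space scg H" "Poly_Mapping.lookup d \<mu> \<in> ?W \<mu>" using d that by blast+
        qed
        then have "(\<Sum>\<mu>\<in>Poly_Mapping.keys d. Poly_Mapping.lookup d \<mu>) \<in>
            V.span (\<Union>\<mu>\<in>dual_space scg H. ?W \<mu>)"
          by (rule V.span_sum)
        then show ?thesis using d by simp
      qed
      then show ?thesis by blast
    qed
  next
    fix h v b w assume h: "h \<in> H" and v: "\<psi> h 1 v = scV b v + w" and w: "\<psi> h 1 w = scV b w"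
    obtain d where d: "?dec d v" using dec by blast
    let ?K = "Poly_Mapping.keys d" and ?d = "Poly_Mapping.lookup d"
    have act: "\<psi> h 1 (?d \<mu>) = scV (\<mu> h) (?d \<mu>)" if "\<mu> \<in> ?K" for \<mu> using d that h by blast
    have w_eq: "w = (\<Sum>\<mu>\<in>?K. scV (\<mu> h - b) (?d \<mu>))"
    proof -
      have "w = \<psi> h 1 v - scV b v" using v by simp
      also have "\<dots> = (\<Sum>\<mu>\<in>?K. \<psi> h 1 (?d \<mu>) - scV b (?d \<mu>))"
        using d by (simp only: psi_sum V.scale_sum_right sum_subtractf)
      also have "\<dots> = (\<Sum>\<mu>\<in>?K. scV (\<mu> h - b) (?d \<mu>))"
        by (rule sum.cong) (simp_all add: act V.scale_left_diff_distrib)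
      finally show ?thesis .
    qed
    have "0 = \<psi> h 1 w - scV b w" using w by simp
    also have "\<dots> = (\<Sum>\<mu>\<in>?K. scV ((\<mu> h - b) * (\<mu> h - b)) (?d \<mu>))"
      unfolding w_eq psi_sum V.scale_sum_right sum_subtractf[symmetric]
    proof (rule sum.cong[OF refl])
      fix \<mu> assume "\<mu> \<in> ?K"
      then show "\<psi> h 1 (scV (\<mu> h - b) (?d \<mu>)) - scV b (scV (\<mu> h - b) (?d \<mu>)) =
          scV ((\<mu> h - b) * (\<mu> h - b)) (?d \<mu>)"
        by (simp add: psi_scale act V.scale_left_diff_distrib[symmetric] algebra_simps
            del: V.scale_left_diff_distrib)
    qed
    finally have zero: "0 = (\<Sum>\<mu>\<in>?K. scV ((\<mu> h - b) * (\<mu> h - b)) (?d \<mu>))" .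
    define d' where "d' = Poly_Mapping.mapp (\<lambda>\<mu> u. scV ((\<mu> h - b) * (\<mu> h - b)) u) d"
    have d': "Poly_Mapping.lookup d' \<mu> = scV ((\<mu> h - b) * (\<mu> h - b)) (?d \<mu>)" for \<mu>
      by (simp add: d'_def lookup_mapp when_def in_keys_iff)
    have K': "Poly_Mapping.keys d' \<subseteq> ?K" by (auto simp: in_keys_iff d')
    have "?dec d' 0"
    proof (intro conjI ballI)
      show "Poly_Mapping.keys d' \<subseteq> dual_space scg H" using K' d by blast
      show "Poly_Mapping.lookup d' \<mu> \<in> ?W \<mu>" if "\<mu> \<in> Poly_Mapping.keys d'" for \<mu>
        unfolding d' by (rule V.subspace_scale[OF sub]) (use K' d that in blast)
      have "(\<Sum>\<mu>\<in>Poly_Mapping.keys d'. Poly_Mapping.lookup d' \<mu>) = (\<Sum>\<mu>\<in>?K. Poly_Mapping.lookup d' \<mu>)"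
        by (rule sum.mono_neutral_left) (use K' in \<open>auto simp: in_keys_iff\<close>)
      then show "0 = (\<Sum>\<mu>\<in>Poly_Mapping.keys d'. Poly_Mapping.lookup d' \<mu>)"
        using zero by (simp add: d')
    qed
    moreover have "?dec 0 0" by simp
    ultimately have "d' = 0" using dec[of 0] by blast
    have "scV (\<mu> h - b) (?d \<mu>) = 0" for \<mu>
    proof -
      have "scV ((\<mu> h - b) * (\<mu> h - b)) (?d \<mu>) = 0" using d'[of \<mu>] \<open>d' = 0\<close> by simp
      then show ?thesis by auto
    qed
    then show "w = 0" unfolding w_eq by (intro sum.neutral) blast
  next
    fix \<mu> assume \<mu>: "\<mu> \<in> dual_space scg H"
    obtain C where C: "finite C" "V.span C = ?W \<mu>"
      using bspec[OF wm[unfolded weight_module_def W, THEN conjunct2] \<mu>] by (elim exE conjE)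
    have "?W \<mu> \<subseteq> V.span C" by (simp only: C(2) order_refl)
    then obtain D where D: "finite D" "V.span D = ?W \<mu>" "card D = V.dim (?W \<mu>)"
      by (rule V.subspace_basis[OF C(1) _ sub])
    show "\<exists>C. finite C \<and> card C \<le> B \<and> ?W \<mu> \<subseteq> V.span C"
    proof (intro exI conjI)
      show "card D \<le> B" unfolding D(3) by (rule B[OF \<mu>])
      show "?W \<mu> \<subseteq> V.span D" by (simp only: D(2) order_refl)
    qed (rule D(1))
  qed
  then show ?thesis unfolding \<psi>_def by blast
qed

theorem theorem4p5:
  fixes scg :: "'k::{alg_closed_field, field_char_0} \<Rightarrow> 'g::ab_group_add \<Rightarrow> 'g"
    and br :: "'g \<Rightarrow> 'g \<Rightarrow> 'g"
    and H :: "'g set"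
    and scS :: "'k \<Rightarrow> 's::{comm_ring, comm_monoid_mult} \<Rightarrow> 's"
    and scV :: "'k \<Rightarrow> 'v::ab_group_add \<Rightarrow> 'v"
    and \<phi> :: "('g \<times> 's \<Rightarrow>\<^sub>0 'k) set \<Rightarrow> 'v \<Rightarrow> 'v"
  assumes "simple_lie_algebra scg br"
    and "\<exists>B. finite_dimensional_vector_space scg B"
    and "cartan_subalgebra scg br H"
    and "comm_algebra scS"
    and "finite_type scS"
    and "vector_space scV"
    and "irreducible_rep (tensor_scale scg scS) (tensor_bracket scg br scS) (tensor_space scg scS)
           scV UNIV \<phi>"
    and "admissible scg H scS scV \<phi>"
  shows "\<exists>(r::nat) (M :: nat \<Rightarrow> 's set) (W :: nat \<Rightarrow> 'v set) (\<rho> :: nat \<Rightarrow> 'g \<Rightarrow> 'v \<Rightarrow> 'v) f.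
    inj_on M {..<r} \<and>
    (\<forall>i<r. maximal_ideal (M i)) \<and>
    (\<forall>i<r. irreducible_rep scg br UNIV scV (W i) (\<rho> i)) \<and>
    module_iso (tensor_space scg scS)
      (multi_scale scV r W) (multi_space scV r W) (eval_action scS scV r M W \<rho>)
      scV UNIV \<phi> f"
proof -
  define \<psi> where "\<psi> = (\<lambda>x s. \<phi> (pure_tensor scg scS x s))"
  have cm: "current_module scg br scS scV \<psi>"
    unfolding \<psi>_def using assms(1,2,4,6,7) by (rule current_module_pure_tensor)
  obtain B where wm: "weight_current_module scg br scS scV \<psi> H B"
    using weight_current_module_admissible[OF cm[unfolded \<psi>_def] assms(3,8)] unfolding \<psi>_def by blast
  interpret weight_current_module scg br scS scV \<psi> H B by (rule wm)
  have \<phi>: "\<phi> (p +o tensor_rels scg scS) v = free_lift scV (\<lambda>(x, s). \<psi> x s v) p" for p v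
    unfolding \<psi>_def by (rule phi_coset[OF assms(6) assms(7)[unfolded irreducible_rep_def, THEN conjunct1]])
  have eval: ?thesis
    if split: "split_current_module scg br scS scV \<psi> r e (\<lambda>i. residue scS (M i))"
      and M: "inj_on M {..<r}" "\<And>i. i < r \<Longrightarrow> maximal_ideal (M i)"
      and v: "v \<noteq> 0" "\<And>i. i < r \<Longrightarrow> split_current_module.simple_at scV \<psi> e i v"
        "\<And>i. i < r \<Longrightarrow> split_current_module.schur_at scV \<psi> e i v"
    for r e M v
  proof -
    interpret split_current_module scg br scS scV \<psi> r e "\<lambda>i. residue scS (M i)" by (rule split)
    have "\<exists>W f. (\<forall>i<r. irreducible_rep scg br UNIV scV (W i) (\<lambda>x. \<psi> x (e i))) \<and>
        module_iso (tensor_space scg scS) (multi_scale scV r W) (multi_space scV r W)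
          (eval_action scS scV r M W (\<lambda>i x. \<psi> x (e i))) scV UNIV \<phi> f"
      by (rule evaluation_module[OF v \<phi> refl])
    moreover have "\<forall>i<r. maximal_ideal (M i)" using M(2) by simp
    ultimately show ?thesis using M(1) by (elim exE conjE) (intro exI conjI)
  qed
  show ?thesis
  proof (cases "1 \<in> annih")
    case True
    then have "\<psi> x s v = 0" for x s v using annih_mult(1)[of 1 s] annih_psi by simp
    \<comment> \<open>A zero action is the case r = 0, where the empty tensor product is the
      one-dimensional trivial module. The values given for e and M are fillers, as no index lies
      below 0.\<close>
    then have "split_current_module scg br scS scV \<psi> 0 (\<lambda>_. 0) (\<lambda>i. residue scS UNIV)"
      by unfold_locales auto
    then show ?thesis using eval[of 0 "\<lambda>_. 0" "\<lambda>_. UNIV"] nontriv by auto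
  next
    case False
    obtain M r e where M: "inj_on M {..<r::nat}" "\<forall>i<r. maximal_ideal (M i)"
      and e: "\<forall>i<r. \<forall>j<r. i \<noteq> j \<longrightarrow> e i * e j \<in> annih" "\<forall>i<r. e i * e i - e i \<in> annih"
        "\<forall>s. s - (\<Sum>i<r. scS (residue scS (M i) s) (e i)) \<in> annih"
      by (rule radical_cofinite_ideal[OF assms(4) annih_ideal annih_cofinite annih_radical])
    have split: "split_current_module scg br scS scV \<psi> r e (\<lambda>i. residue scS (M i))"
    proof
      fix i j x s v
      show "\<psi> x (e i * e j) v = 0" if "i < r" "j < r" "i \<noteq> j" using e(1) that by (simp add: annih_psi)
      show "\<psi> x (e i * e i) v = \<psi> x (e i) v" if "i < r"
        using annih_psi[OF e(2)[rule_format, OF that], of x v] by (simp add: psi_diff)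
      show "\<psi> x s v = (\<Sum>i<r. scV (residue scS (M i) s) (\<psi> x (e i) v))"
        using annih_psi[OF e(3)[rule_format, of s], of x v] by (simp add: psi_diff psi_sum_right psi_scale_right)
    qed
    then interpret split: split_weight_module scg br scS scV \<psi> r e "\<lambda>i. residue scS (M i)" H B
      using wm False by (simp add: split_weight_module_def split_weight_module_axioms_def)
    obtain v where v: "v \<noteq> 0" "\<And>i. i < r \<Longrightarrow> split.simple_at i v" "\<And>i. i < r \<Longrightarrow> split.schur_at i v"
      by (rule split.exists_simple_vector) (rule that; blast)
    show ?thesis by (rule eval[OF split M(1) M(2)[rule_format] v])
  qed
qed

end
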